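(* Let $X$ be a proper geodesic metric space with a convergence boundary $\partial X$ and let $\Gamma<\mathrm{Isom}(X)$ be a non-elementary discrete subgroup with non-pinched contracting elements such that $\Gamma\curvearrowright X$ is statistically convex-cocompact (SCC). Suppose that a discrete subgroup $H<\mathrm{Isom}(X)$ is confined by $\Gamma$ with a compact confining subset $P$, and that one of the following holds: (i) $H$ is torsion-free and $X$ is a Gromov hyperbolic space or a geodesically complete CAT$(0)$ space; or (ii) the confining subset $P$ is finite and intersects $E(\Gamma)$ trivially. Then $\omega_H\ge\omega_\Gamma/2$.
   Context: Fix $o\in X$. Contracting: a closed $Z\subseteq X$ is $C$-contracting if $\mathrm{diam}(\pi_Z(x)\cup\pi_Z(y))\le C$ whenever $d(x,y)\le d(x,Z)$, where $\pi_Z$ is the nearest-point projection (set). An isometry $g$ is contracting if $n\mapsto g^no$ is a quasi-isometric embedding of $\mathbb Z$ with contracting image. A group is elementary if finite or virtually $\mathbb Z$. Growth rate: $\omega_A=\limsup_n\frac1n\log\sharp\{go:g\in A,d(o,go)\le n\}$. SCC: for $0\le M_1\le M_2$ let $\mathcal O_{M_1,M_2}$ be the set of $g\in\Gamma$ such that some geodesic between $N_{M_2}(o)$ and $N_{M_2}(go)$ has interior outside $N_{M_1}(\Gamma o)$ ($N_r$ = $r$-neighborhood). The action is SCC if $\omega_{\mathcal O_{M_1,M_2}}<\omega_\Gamma<\infty$ for some $M_1,M_2>0$. Confined: $P\subseteq\mathrm{Isom}(X)$ is compact and $g^{-1}Hg\cap(P\setminus\{1\})\ne\emptyset$ for all $g\in\Gamma$.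 "Intersects $E(\Gamma)$ trivially" means $P\cap E(\Gamma)\subseteq\{1\}$. Convergence boundary: a metrizable compactification $\overline X=X\cup\partial X$ with $X$ open and dense, to which the action of $\mathrm{Isom}(X)$ extends by homeomorphisms, with an $\mathrm{Isom}(X)$-invariant partition $[\cdot]$ of $\partial X$ ($[\xi]$ is the class of $\xi$; $[A]=\bigcup_{\xi\in A}[\xi]$). A sequence tends (accumulates) to $[\xi]$ if its limit (all its accumulation points) lie in $[\xi]$; subsets or points $A_n$ are escaping if $d(o,A_n)\to\infty$. Required: (A) any contracting geodesic ray $\gamma$ accumulates into a closed class $[\xi]$, and any $y_n\in X$ with $\pi_\gamma(y_n)$ escaping tends to $[\xi]$. (B) for any escaping sequence of $C$-contracting quasi-geodesics $X_n$ ($C$ fixed), and any $o$, some subsequence of the cones $\Omega_o(X_n)=\{y\in X:\text{some geodesic }[o,y]\text{ meets }X_n\}$ accumulates to a class $[\xi]$, i.e. any convergent sequence $y_n\in\Omega_o(X_n)$ tends to a point of $[\xi]$. (C) the set $\mathcal C$ of non-pinched points is nonempty, where $\xi$ is non-pinched if for all sequences $x_n,y_n\in X$ converging to $[\xi]$ the segments $[x_n,y_n]$ are escaping; and for $\xi\in\mathcal C$, $[\cdot]$ is closed on $U=\Gamma[\xi]$: if $x_n,y_n\in U$, $[x_n]=[y_n]$, $x_n\to\xi'$, $y_n\to\eta'$, then $[\xi']=[\eta']$. By (A) the rays $n\mapsto f^{\pm n}o$, $n\geq 0$, of a contracting element $f$ determine classes $[f^+],[f^-]$; $f$ is non-pinched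 if $[f^+]\cup[f^-]\subseteq\mathcal C$. The paper also assumes a subset $\mathcal C^{\mathrm{hor}}\subseteq\mathcal C$ with functions $B_\xi:X\times X\to\mathbb R$ ($\xi\in\mathcal C^{\mathrm{hor}}$) such that $\limsup_{z\to[\xi]}|B_\xi(x,y)-(d(x,z)-d(y,z))|\le\epsilon([\xi])$ for all $x,y$, and that $\partial X$ carries a nontrivial $\omega_\Gamma$-dimensional $\Gamma$-equivariant quasi-conformal density $\{\mu_x\}$: $g_\star\mu_x=\mu_{gx}$ for $g\in\Gamma$, $\frac{d\mu_x}{d\mu_y}(\xi)\in[\lambda^{-1},\lambda]\cdot e^{-\omega_\Gamma B_\xi(x,y)}$ for $\mu_y$-a.e. $\xi$ and a uniform $\lambda\ge1$, with $\mu_o$ a probability supported on $\mathcal C$. $E(\Gamma)=\{g\in\mathrm{Isom}(X): g[\xi]=[\xi]\text{ for every class }[\xi]\subseteq[\Lambda(\Gamma o)]\}$, where $\Lambda(\Gamma o)$ is the set of accumulation points of $\Gamma o$ in $\partial X$. *)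

theory Defs
  imports
    "HOL-Analysis.Analysis"
    "HOL-Algebra.Elementary_Groups"
begin

section \<open>Geodesics\<close>

definition geodesic_on :: "real set \<Rightarrow> (real \<Rightarrow> 'a::metric_space) \<Rightarrow> bool" where
  "geodesic_on I c \<longleftrightarrow> (\<forall>s\<in>I. \<forall>t\<in>I. dist (c s) (c t) = \<bar>s - t\<bar>)"

definition geodesic_segment :: "'a::metric_space \<Rightarrow> 'a \<Rightarrow> 'a set \<Rightarrow> bool" where
  "geodesic_segment x y S \<longleftrightarrow>
     (\<exists>c. geodesic_on {0..dist x y} c \<and> c 0 = x \<and> c (dist x y) = y \<and> S = c ` {0..dist x y})"

definition geodesic_space :: "'a::metric_space itself \<Rightarrow> bool" where
  "geodesic_space _ \<longleftrightarrow> (\<forall>x y :: 'a. \<exists>S. geodesic_segment x y S)"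

text \<open>Gromov hyperbolicity of a geodesic space, by slim triangles.\<close>

definition gromov_hyperbolic :: "'a::metric_space itself \<Rightarrow> bool" where
  "gromov_hyperbolic _ \<longleftrightarrow>
     (\<exists>\<delta>\<ge>0. \<forall>(x::'a) y z S T U.
        geodesic_segment x y S \<longrightarrow> geodesic_segment y z T \<longrightarrow> geodesic_segment x z U \<longrightarrow>
        (\<forall>p\<in>S. infdist p (T \<union> U) \<le> \<delta>))"

text \<open>The comparison triangle is \<open>p' q' r'\<close>; \<open>x'\<close> and \<open>y'\<close> are the comparison points of
  \<open>x\<close> and \<open>y\<close>. Any two sides share a vertex, so it suffices to compare
  the two sides issuing from \<open>p\<close>.\<close>

definition cat0 :: "'a::metric_space itself \<Rightarrow> bool" where
  "cat0 _ \<longleftrightarrow>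
     (\<forall>(p::'a) q r S T. geodesic_segment p q S \<longrightarrow> geodesic_segment p r T \<longrightarrow>
        (\<forall>(p'::real^2) q' r'.
           dist p' q' = dist p q \<longrightarrow> dist p' r' = dist p r \<longrightarrow> dist q' r' = dist q r \<longrightarrow>
           (\<forall>x\<in>S. \<forall>y\<in>T. \<forall>x'\<in>closed_segment p' q'. \<forall>y'\<in>closed_segment p' r'.
              dist p' x' = dist p x \<longrightarrow> dist p' y' = dist p y \<longrightarrow> dist x y \<le> dist x' y')))"

definition geodesically_complete :: "'a::metric_space itself \<Rightarrow> bool" where
  "geodesically_complete _ \<longleftrightarrow>
     (\<forall>L>0. \<forall>c :: real \<Rightarrow> 'a. geodesic_on {0..L} c \<longrightarrow>
        (\<exists>l. geodesic_on UNIV l \<and> (\<forall>t\<in>{0..L}. l t = c t)))"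

definition quasi_isometric_embedding_on ::
    "real \<Rightarrow> real set \<Rightarrow> (real \<Rightarrow> 'a::metric_space) \<Rightarrow> bool" where
  "quasi_isometric_embedding_on c S q \<longleftrightarrow> c \<ge> 1 \<and>
     (\<forall>s\<in>S. \<forall>t\<in>S. \<bar>s - t\<bar> / c - c \<le> dist (q s) (q t) \<and> dist (q s) (q t) \<le> c * \<bar>s - t\<bar> + c)"

definition quasi_geodesic :: "real \<Rightarrow> 'a::metric_space set \<Rightarrow> bool" where
  "quasi_geodesic c Z \<longleftrightarrow>
     (\<exists>I q. is_interval I \<and> I \<noteq> {} \<and> quasi_isometric_embedding_on c I q \<and> Z = q ` I)"


section \<open>Contracting subsets and escaping sequences\<close>

definition nearest_proj :: "'a::metric_space set \<Rightarrow> 'a \<Rightarrow> 'a set" where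
  "nearest_proj Z x = {z \<in> Z. dist x z = infdist x Z}"

definition contracting :: "real \<Rightarrow> 'a::metric_space set \<Rightarrow> bool" where
  "contracting C Z \<longleftrightarrow> closed Z \<and>
     (\<forall>x y. dist x y \<le> infdist x Z \<longrightarrow> diameter (nearest_proj Z x \<union> nearest_proj Z y) \<le> C)"

definition contracting_ray :: "(real \<Rightarrow> 'a::metric_space) \<Rightarrow> bool" where
  "contracting_ray \<gamma> \<longleftrightarrow> geodesic_on {0..} \<gamma> \<and> (\<exists>C. contracting C (\<gamma> ` {0..}))"

definition escaping :: "'a::metric_space \<Rightarrow> (nat \<Rightarrow> 'a set) \<Rightarrow> bool" where
  "escaping x0 A \<longleftrightarrow> filterlim (\<lambda>n. infdist x0 (A n)) at_top sequentially"

definition cone :: "'a::metric_space \<Rightarrow> 'a set \<Rightarrow> 'a set" where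
  "cone p Z = {y. \<exists>S. geodesic_segment p y S \<and> S \<inter> Z \<noteq> {}}"

text \<open>Neighborhoods are closed, so that \<open>nbhd 0 {x} = {x}\<close>.\<close>

definition nbhd :: "real \<Rightarrow> 'a::metric_space set \<Rightarrow> 'a set" where
  "nbhd r A = {x. infdist x A \<le> r}"


section \<open>The isometry group and its subgroups\<close>

definition Isom :: "('a::metric_space \<Rightarrow> 'a) monoid" where
  "Isom = \<lparr>carrier = {g. surj g \<and> (\<forall>x y. dist (g x) (g y) = dist x y)},
           monoid.mult = (\<circ>), one = id\<rparr>"

text \<open>The compact-open topology.\<close>

definition Isom_topology :: "('a::metric_space \<Rightarrow> 'a) topology" where
  "Isom_topology =
     topology_generated_by {{g \<in> carrier Isom. g ` K \<subseteq> U} | K U. compact K \<and> open U}"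

definition discrete_subgroup :: "('a::metric_space \<Rightarrow> 'a) set \<Rightarrow> bool" where
  "discrete_subgroup \<Gamma> \<longleftrightarrow>
     subgroup \<Gamma> Isom \<and> subtopology Isom_topology \<Gamma> = discrete_topology \<Gamma>"

definition virtually_Z :: "('g, 'm) monoid_scheme \<Rightarrow> bool" where
  "virtually_Z G \<longleftrightarrow>
     (\<exists>K. subgroup K G \<and> finite (rcosets\<^bsub>G\<^esub> K) \<and> G\<lparr>carrier := K\<rparr> \<cong> integer_group)"

definition elementary :: "('g, 'm) monoid_scheme \<Rightarrow> bool" where
  "elementary G \<longleftrightarrow> finite (carrier G) \<or> virtually_Z G"

definition torsion_free :: "('g, 'm) monoid_scheme \<Rightarrow> bool" where
  "torsion_free G \<longleftrightarrow>
     (\<forall>h\<in>carrier G. \<forall>n::nat. n > 0 \<and> h [^]\<^bsub>G\<^esub> n = \<one>\<^bsub>G\<^esub> \<longrightarrow> h = \<one>\<^bsub>G\<^esub>)"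

text \<open>The integers are regarded as the subset \<open>\<int>\<close> of the real line, where the floor
  only serves as a coercion.\<close>

definition contracting_isometry :: "'a::metric_space \<Rightarrow> ('a \<Rightarrow> 'a) \<Rightarrow> bool" where
  "contracting_isometry x0 g \<longleftrightarrow> g \<in> carrier Isom \<and>
     (\<exists>c. quasi_isometric_embedding_on c \<int> (\<lambda>t. (g [^]\<^bsub>Isom\<^esub> \<lfloor>t\<rfloor>) x0)) \<and>
     (\<exists>C. contracting C (range (\<lambda>n::int. (g [^]\<^bsub>Isom\<^esub> n) x0)))"

definition confined_by ::
    "('a::metric_space \<Rightarrow> 'a) set \<Rightarrow> ('a \<Rightarrow> 'a) set \<Rightarrow> ('a \<Rightarrow> 'a) set \<Rightarrow> bool" where
  "confined_by \<Gamma> H P \<longleftrightarrow> compactin Isom_topology P \<and>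
     (\<forall>g\<in>\<Gamma>. (\<lambda>h. inv\<^bsub>Isom\<^esub> g \<otimes>\<^bsub>Isom\<^esub> h \<otimes>\<^bsub>Isom\<^esub> g) ` H \<inter> (P - {\<one>\<^bsub>Isom\<^esub>}) \<noteq> {})"


section \<open>Growth rates and statistically convex-cocompact actions\<close>

definition orbit_ball :: "'a::metric_space \<Rightarrow> ('a \<Rightarrow> 'a) set \<Rightarrow> nat \<Rightarrow> 'a set" where
  "orbit_ball x0 A n = {g x0 | g. g \<in> A \<and> dist x0 (g x0) \<le> real n}"

text \<open>Conventions \<open>log 0 = -\<infinity>\<close> and \<open>log \<infinity> = \<infinity>\<close>; the case distinction is needed because
  in HOL \<open>ln 0 = 0\<close> and \<open>card\<close> vanishes on infinite sets.\<close>

definition log_card :: "'a set \<Rightarrow> ereal" where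
  "log_card S = (if infinite S then \<infinity> else if S = {} then -\<infinity> else ereal (ln (real (card S))))"

definition growth_rate :: "'a::metric_space \<Rightarrow> ('a \<Rightarrow> 'a) set \<Rightarrow> ereal" where
  "growth_rate x0 A = limsup (\<lambda>n. log_card (orbit_ball x0 A n) / ereal (real n))"

definition concave_region ::
    "'a::metric_space \<Rightarrow> ('a \<Rightarrow> 'a) set \<Rightarrow> real \<Rightarrow> real \<Rightarrow> ('a \<Rightarrow> 'a) set" where
  "concave_region x0 \<Gamma> M1 M2 = {g \<in> \<Gamma>. \<exists>L\<ge>0. \<exists>c. geodesic_on {0..L} c \<and>
     c 0 \<in> nbhd M2 {x0} \<and> c L \<in> nbhd M2 {g x0} \<and>
     (\<forall>t\<in>{0<..<L}. c t \<notin> nbhd M1 ((\<lambda>h. h x0) ` \<Gamma>))}"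

definition SCC :: "'a::metric_space \<Rightarrow> ('a \<Rightarrow> 'a) set \<Rightarrow> bool" where
  "SCC x0 \<Gamma> \<longleftrightarrow>
     (\<exists>M1 M2. 0 < M1 \<and> M1 \<le> M2 \<and>
        growth_rate x0 (concave_region x0 \<Gamma> M1 M2) < growth_rate x0 \<Gamma>) \<and>
     growth_rate x0 \<Gamma> < \<infinity>"


section \<open>Convergence boundaries\<close>

text \<open>A compactification of the space \<open>'a\<close> is given by an open dense embedding \<open>\<iota>\<close> into a compact
  space \<open>'b\<close>; the metric of \<open>'b\<close> only matters through its topology. \<open>act g\<close> is the extension of the
  isometry \<open>g\<close> (unique, since \<open>\<iota>\<close> has dense range), and the partition of the boundary is the one
  into the classes \<open>R `` {\<xi>}\<close> of an equivalence relation \<open>R\<close>.\<close>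

definition bdry :: "('a \<Rightarrow> 'b) \<Rightarrow> 'b set" where
  "bdry \<iota> = - range \<iota>"

definition compactification ::
    "('a::metric_space \<Rightarrow> 'b::metric_space) \<Rightarrow> (('a \<Rightarrow> 'a) \<Rightarrow> 'b \<Rightarrow> 'b) \<Rightarrow> bool" where
  "compactification \<iota> act \<longleftrightarrow>
     compact (UNIV :: 'b set) \<and>
     (\<exists>\<kappa>. homeomorphism UNIV (range \<iota>) \<iota> \<kappa>) \<and> open (range \<iota>) \<and> closure (range \<iota>) = UNIV \<and>
     (\<forall>g\<in>carrier Isom. (\<exists>h. homeomorphism UNIV UNIV (act g) h) \<and> (\<forall>x. act g (\<iota> x) = \<iota> (g x)))"

definition invariant_partition ::
    "('a::metric_space \<Rightarrow> 'b) \<Rightarrow> (('a \<Rightarrow> 'a) \<Rightarrow> 'b \<Rightarrow> 'b) \<Rightarrow> ('b \<times> 'b) set \<Rightarrow> bool" where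
  "invariant_partition \<iota> act R \<longleftrightarrow> equiv (bdry \<iota>) R \<and>
     (\<forall>g\<in>carrier Isom. \<forall>(\<xi>, \<eta>)\<in>R. (act g \<xi>, act g \<eta>) \<in> R)"

definition tends_into :: "('a \<Rightarrow> 'b::topological_space) \<Rightarrow> (nat \<Rightarrow> 'a) \<Rightarrow> 'b set \<Rightarrow> bool" where
  "tends_into \<iota> x A \<longleftrightarrow> (\<exists>l\<in>A. (\<lambda>n. \<iota> (x n)) \<longlonglongrightarrow> l)"

definition accumulates_into :: "('a \<Rightarrow> 'b::topological_space) \<Rightarrow> (nat \<Rightarrow> 'a) \<Rightarrow> 'b set \<Rightarrow> bool" where
  "accumulates_into \<iota> x A \<longleftrightarrow>
     (\<forall>r l. strict_mono (r :: nat \<Rightarrow> nat) \<and> (\<lambda>n. \<iota> (x (r n))) \<longlonglongrightarrow> l \<longrightarrow> l \<in> A)"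

definition non_pinched_points ::
    "'a::metric_space \<Rightarrow> ('a \<Rightarrow> 'b::topological_space) \<Rightarrow> ('b \<times> 'b) set \<Rightarrow> 'b set" where
  "non_pinched_points x0 \<iota> R = {\<xi> \<in> bdry \<iota>. \<forall>x y S.
     tends_into \<iota> x (R `` {\<xi>}) \<and> tends_into \<iota> y (R `` {\<xi>}) \<and>
     (\<forall>n. geodesic_segment (x n) (y n) (S n)) \<longrightarrow> escaping x0 S}"

text \<open>In the second part of (A) the sequence \<open>y\<close> need not converge, so ``tends to the class'' can
  only constrain its accumulation points.\<close>

definition conv_bdry_A ::
    "'a::metric_space \<Rightarrow> ('a \<Rightarrow> 'b::topological_space) \<Rightarrow> ('b \<times> 'b) set \<Rightarrow> bool" where
  "conv_bdry_A x0 \<iota> R \<longleftrightarrow> (\<forall>\<gamma>. contracting_ray \<gamma> \<longrightarrow>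
     (\<exists>\<xi>\<in>bdry \<iota>. closed (R `` {\<xi>}) \<and>
        (\<forall>t. filterlim t at_top sequentially \<longrightarrow> accumulates_into \<iota> (\<lambda>n. \<gamma> (t n)) (R `` {\<xi>})) \<and>
        (\<forall>y. escaping x0 (\<lambda>n. nearest_proj (\<gamma> ` {0..}) (y n)) \<longrightarrow>
           accumulates_into \<iota> y (R `` {\<xi>}))))"

text \<open>Accumulation of the cones to a class concerns the limits of all convergent subsequences of
  \<open>y\<close>: the limits of convergent \<open>y\<close> alone would say nothing when the cones along \<open>r\<close> alternate
  between two different classes. Both the contraction constant and the quasi-geodesic constant are
  uniform in \<open>n\<close>.\<close>

definition conv_bdry_B ::
    "'a::metric_space \<Rightarrow> ('a \<Rightarrow> 'b::topological_space) \<Rightarrow> ('b \<times> 'b) set \<Rightarrow> bool" where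
  "conv_bdry_B x0 \<iota> R \<longleftrightarrow> (\<forall>C c Z.
     (\<forall>n. contracting C (Z n) \<and> quasi_geodesic c (Z n)) \<and> escaping x0 Z \<longrightarrow>
     (\<forall>p. \<exists>r. strict_mono (r :: nat \<Rightarrow> nat) \<and> (\<exists>\<xi>\<in>bdry \<iota>.
        \<forall>y. (\<forall>n. y n \<in> cone p (Z (r n))) \<longrightarrow> accumulates_into \<iota> y (R `` {\<xi>}))))"

definition conv_bdry_C ::
    "'a::metric_space \<Rightarrow> ('a \<Rightarrow> 'b::topological_space) \<Rightarrow> (('a \<Rightarrow> 'a) \<Rightarrow> 'b \<Rightarrow> 'b) \<Rightarrow>
     ('b \<times> 'b) set \<Rightarrow> ('a \<Rightarrow> 'a) set \<Rightarrow> bool" where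
  "conv_bdry_C x0 \<iota> act R \<Gamma> \<longleftrightarrow> non_pinched_points x0 \<iota> R \<noteq> {} \<and>
     (\<forall>\<xi>\<in>non_pinched_points x0 \<iota> R. \<forall>x y \<xi>' \<eta>'.
        (\<forall>n::nat. x n \<in> (\<Union>g\<in>\<Gamma>. act g ` (R `` {\<xi>})) \<and> y n \<in> (\<Union>g\<in>\<Gamma>. act g ` (R `` {\<xi>})) \<and>
             (x n, y n) \<in> R) \<and>
        x \<longlonglongrightarrow> \<xi>' \<and> y \<longlonglongrightarrow> \<eta>' \<longrightarrow> (\<xi>', \<eta>') \<in> R)"

definition convergence_boundary ::
    "'a::metric_space \<Rightarrow> ('a \<Rightarrow> 'b::metric_space) \<Rightarrow> (('a \<Rightarrow> 'a) \<Rightarrow> 'b \<Rightarrow> 'b) \<Rightarrow>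
     ('b \<times> 'b) set \<Rightarrow> ('a \<Rightarrow> 'a) set \<Rightarrow> bool" where
  "convergence_boundary x0 \<iota> act R \<Gamma> \<longleftrightarrow>
     compactification \<iota> act \<and> invariant_partition \<iota> act R \<and>
     conv_bdry_A x0 \<iota> R \<and> conv_bdry_B x0 \<iota> R \<and> conv_bdry_C x0 \<iota> act R \<Gamma>"

text \<open>The classes \<open>a\<close> and \<open>b\<close> are \<open>[f\<^sup>+]\<close> and \<open>[f\<^sup>-]\<close>; they are determined by \<open>f\<close> because distinct
  classes are disjoint and the two sequences have accumulation points.\<close>

definition non_pinched_contracting ::
    "'a::metric_space \<Rightarrow> ('a \<Rightarrow> 'b::topological_space) \<Rightarrow> ('b \<times> 'b) set \<Rightarrow> ('a \<Rightarrow> 'a) \<Rightarrow> bool" where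
  "non_pinched_contracting x0 \<iota> R f \<longleftrightarrow> contracting_isometry x0 f \<and>
     (\<exists>a\<in>bdry \<iota> // R. \<exists>b\<in>bdry \<iota> // R.
        accumulates_into \<iota> (\<lambda>n. (f [^]\<^bsub>Isom\<^esub> int n) x0) a \<and>
        accumulates_into \<iota> (\<lambda>n. (f [^]\<^bsub>Isom\<^esub> (- int n)) x0) b \<and>
        a \<union> b \<subseteq> non_pinched_points x0 \<iota> R)"

definition limit_set :: "'a \<Rightarrow> ('a \<Rightarrow> 'b::topological_space) \<Rightarrow> ('a \<Rightarrow> 'a) set \<Rightarrow> 'b set" where
  "limit_set x0 \<iota> \<Gamma> = {\<xi> \<in> bdry \<iota>. \<xi> islimpt (\<lambda>g. \<iota> (g x0)) ` \<Gamma>}"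

definition E_group ::
    "'a::metric_space \<Rightarrow> ('a \<Rightarrow> 'b::topological_space) \<Rightarrow> (('a \<Rightarrow> 'a) \<Rightarrow> 'b \<Rightarrow> 'b) \<Rightarrow>
     ('b \<times> 'b) set \<Rightarrow> ('a \<Rightarrow> 'a) set \<Rightarrow> ('a \<Rightarrow> 'a) set" where
  "E_group x0 \<iota> act R \<Gamma> =
     {g \<in> carrier Isom. \<forall>c\<in>bdry \<iota> // R. c \<subseteq> R `` limit_set x0 \<iota> \<Gamma> \<longrightarrow> act g ` c = c}"


section \<open>Busemann quasi-cocycles and quasi-conformal densities\<close>

definition busemann_cocycles ::
    "'a::metric_space \<Rightarrow> ('a \<Rightarrow> 'b::topological_space) \<Rightarrow> ('b \<times> 'b) set \<Rightarrow> 'b set \<Rightarrow>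
     ('b \<Rightarrow> 'a \<Rightarrow> 'a \<Rightarrow> real) \<Rightarrow> ('b set \<Rightarrow> real) \<Rightarrow> bool" where
  "busemann_cocycles x0 \<iota> R Chor B \<epsilon> \<longleftrightarrow> Chor \<subseteq> non_pinched_points x0 \<iota> R \<and>
     (\<forall>\<xi>\<in>Chor. \<forall>x y z. tends_into \<iota> z (R `` {\<xi>}) \<longrightarrow>
        limsup (\<lambda>n. ereal \<bar>B \<xi> x y - (dist x (z n) - dist y (z n))\<bar>) \<le> ereal (\<epsilon> (R `` {\<xi>})))"

text \<open>\<open>B \<xi>\<close> is meaningful only for \<open>\<xi> \<in> Chor\<close>, so the bounds on the Radon-Nikodym derivative, which
  hold almost everywhere, include membership in \<open>Chor\<close>. The non-pinched points are not assumed to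
  be Borel; \<open>AE\<close> only requires the exceptional set to be contained in a null set.\<close>

definition quasi_conformal_density ::
    "'a::metric_space \<Rightarrow> ('a \<Rightarrow> 'b::topological_space) \<Rightarrow> (('a \<Rightarrow> 'a) \<Rightarrow> 'b \<Rightarrow> 'b) \<Rightarrow>
     ('b \<times> 'b) set \<Rightarrow> ('a \<Rightarrow> 'a) set \<Rightarrow> 'b set \<Rightarrow> ('b \<Rightarrow> 'a \<Rightarrow> 'a \<Rightarrow> real) \<Rightarrow> real \<Rightarrow>
     ('a \<Rightarrow> 'b measure) \<Rightarrow> bool" where
  "quasi_conformal_density x0 \<iota> act R \<Gamma> Chor B \<omega> \<mu> \<longleftrightarrow>
     (\<forall>x. sets (\<mu> x) = sets (restrict_space borel (bdry \<iota>))) \<and>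
     (\<forall>g\<in>\<Gamma>. \<forall>x. distr (\<mu> x) (restrict_space borel (bdry \<iota>)) (act g) = \<mu> (g x)) \<and>
     (\<exists>k\<ge>1. \<forall>x y. absolutely_continuous (\<mu> y) (\<mu> x) \<and>
        (AE \<xi> in \<mu> y. \<xi> \<in> Chor \<and>
           RN_deriv (\<mu> y) (\<mu> x) \<xi> \<in> {ennreal (inverse k * exp (- \<omega> * B \<xi> x y)) ..
                                      ennreal (k * exp (- \<omega> * B \<xi> x y))})) \<and>
     emeasure (\<mu> x0) (space (\<mu> x0)) = 1 \<and> (AE \<xi> in \<mu> x0. \<xi> \<in> non_pinched_points x0 \<iota> R)"

end

theory Submission
  imports Defs "HOL-Real_Asymp.Real_Asymp"
begin

text \<open>
  Suppose that \<open>H\<close> grows slower than \<open>s / 2\<close> for some \<open>s\<close> below the growth rate of \<open>\<Gamma>\<close>. Let \<open>f \<in> \<Gamma>\<close> be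
  contracting and let \<open>Y\<close> be the orbit of \<open>x0\<close> under its powers. Products of letters \<open>t = a f\<^sup>N\<close> or
  \<open>t = a f\<^sup>-\<^sup>N\<close>, with \<open>N\<close> large and \<open>a x0\<close> projecting to \<open>Y\<close> near \<open>x0\<close>, follow geodesics, because the
  translates of \<open>Y\<close> along the way are crossed over a long distance. Choose letters independently
  from a large finite alphabet, with probability proportional to \<open>exp (- s * dist x0 (t x0))\<close>.
  The normalising constant exceeds the number of letters by which a word can continue along a given
  geodesic, so a random word follows a given geodesic up to distance \<open>r\<close> with probability
  \<open>O(exp (- s * r))\<close>, even though the letters need not be free generators.

  By confinement each word \<open>w\<close> comes with some \<open>h\<^sub>w \<in> H\<close> such that \<open>w\<^sup>-\<^sup>1 h\<^sub>w w \<in> P - {1}\<close>. Since \<open>h\<^sub>w\<close>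
  moves \<open>w x0\<close> a bounded amount, \<open>w\<close> follows the geodesic from \<open>x0\<close> to \<open>h\<^sub>w x0\<close> up to its middle. Summing
  over \<open>H\<close>, whose growth is less than \<open>s / 2\<close>, one finds that \<open>h\<^sub>w\<close> belongs to a fixed finite set with
  probability at least \<open>1 / 2\<close>. Hence some \<open>h\<close> is the element of a word \<open>v\<close> and of arbitrarily long words
  beyond each letter after \<open>v\<close>. All powers of \<open>h\<close> then coarsely fix the centres of the tripods formed
  by such words, and so move \<open>v b x0\<close> by at most a constant \<open>K\<close>, for all \<open>b\<close> in a finite set chosen
  after \<open>K\<close>. In case (i) this makes \<open>h\<close> a torsion element. In case (ii) it shows that some element of
  \<open>P - {1}\<close> has bounded displacement on \<open>\<Gamma> x0\<close>, and such an element lies in \<open>E(\<Gamma>)\<close>.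
\<close>

section \<open>Geodesic segments\<close>

text \<open>The factor one half comes from the fact that \<open>w\<close> and its element
  \<open>h\<close> control the geodesic to \<open>h x0\<close> only up to the middle: words are
  caught by \<open>h x0\<close> with probability \<open>O(exp (- s / 2 * dist x0 (h x0)))\<close>,
  and these bounds have small tails over \<open>H\<close>. Freeness of the letters is replaced by
  counting: the number of ways to continue along a geodesic is linear in the letter length, while
  the normalising constant grows exponentially.

  A tripod is needed because an isometry that respects two far ends may still translate along the
  geodesic between them; the third end excludes this. The bound \<open>K\<close> is the same for all
  powers of \<open>h\<close>, although \<open>h ^^ n\<close> may move the ends by a multiple of
  \<open>n\<close>: recurrence supplies ends so far from the axis that this motion is comparatively
  small, and by contraction it barely changes their projections.

  \<open>K\<close> depends on the axis only. Therefore in case (ii) one may first choose, for each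
  of the finitely many elements of \<open>P - {1}\<close>, an orbit point that it moves by more than
  \<open>K\<close>, and only then an alphabet that sees these points.\<close>

lemma geodesic_segment_ends:
  assumes "geodesic_segment x y S"
  shows "x \<in> S" "y \<in> S"
  using assms unfolding geodesic_segment_def by (force, metis atLeastAtMost_iff imageI order_refl zero_le_dist)

lemma geodesic_segment_dist:
  assumes "geodesic_segment x y S" "u \<in> S"
  shows "dist x u + dist u y = dist x y"
proof -
  obtain c where c: "geodesic_on {0..dist x y} c" "c 0 = x" "c (dist x y) = y" "S = c ` {0..dist x y}"
    using assms(1) unfolding geodesic_segment_def by blast
  obtain t where t: "t \<in> {0..dist x y}" "u = c t"
    using assms(2) c(4) by blast
  have "dist (c 0) (c t) = t" "dist (c t) (c (dist x y)) = dist x y - t"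
    using c(1) t(1) unfolding geodesic_on_def by force+
  then show ?thesis
    using c t by simp
qed

lemma geodesic_segment_dist_within:
  assumes "geodesic_segment x y S" "u \<in> S" "v \<in> S"
  shows "dist u v = \<bar>dist x u - dist x v\<bar>"
proof -
  obtain c where c: "geodesic_on {0..dist x y} c" "c 0 = x" "c (dist x y) = y" "S = c ` {0..dist x y}"
    using assms(1) unfolding geodesic_segment_def by blast
  obtain t where t: "t \<in> {0..dist x y}" "u = c t"
    using assms(2) c(4) by blast
  obtain t' where t': "t' \<in> {0..dist x y}" "v = c t'"
    using assms(3) c(4) by blast
  have "dist (c 0) (c t) = t" "dist (c 0) (c t') = t'" "dist (c t) (c t') = \<bar>t - t'\<bar>"
    using c(1) t(1) t'(1) unfolding geodesic_on_def by force+
  then show ?thesis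
    using c t t' by simp
qed

lemma geodesic_segment_sym:
  assumes "geodesic_segment x y S"
  shows "geodesic_segment y x S"
proof -
  obtain c where c: "geodesic_on {0..dist x y} c" "c 0 = x" "c (dist x y) = y" "S = c ` {0..dist x y}"
    using assms(1) unfolding geodesic_segment_def by blast
  let ?L = "dist x y"
  have "geodesic_on {0..?L} (\<lambda>t. c (?L - t))"
    using c(1) unfolding geodesic_on_def by force
  moreover have "S = (\<lambda>t. c (?L - t)) ` {0..?L}"
  proof -
    have "(\<lambda>t. ?L - t) ` {0..?L} = {0..?L}"
      by (auto simp: image_iff intro: bexI[of _ "?L - _"])
    then show ?thesis
      unfolding c(4) by (metis image_image)
  qed
  ultimately show ?thesis
    unfolding geodesic_segment_def using c(2,3)
    by (intro exI[of _ "\<lambda>t. c (?L - t)"]) (auto simp: dist_commute)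
qed

lemma geodesic_segment_image:
  assumes "geodesic_segment x y S" "\<And>u v. dist (g u) (g v) = dist u v"
  shows "geodesic_segment (g x) (g y) (g ` S)"
proof -
  obtain c where c: "geodesic_on {0..dist x y} c" "c 0 = x" "c (dist x y) = y" "S = c ` {0..dist x y}"
    using assms(1) unfolding geodesic_segment_def by blast
  then show ?thesis
    unfolding geodesic_segment_def geodesic_on_def
    by (intro exI[of _ "g \<circ> c"]) (auto simp: assms(2))
qed

lemma geodesic_subsegment:
  assumes S: "geodesic_segment x y S" and v: "v \<in> S" "w \<in> S"
  shows "geodesic_segment v w {e \<in> S. dist v e + dist e w = dist v w}"
proof -
  obtain c where c: "geodesic_on {0..dist x y} c" "c 0 = x" "c (dist x y) = y" "S = c ` {0..dist x y}"
    using S unfolding geodesic_segment_def by blast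
  have *: "geodesic_segment (c a) (c b) {e \<in> S. dist (c a) e + dist e (c b) = dist (c a) (c b)}"
    if ab: "0 \<le> a" "a \<le> b" "b \<le> dist x y" for a b
  proof -
    have cd: "dist (c s) (c t) = \<bar>s - t\<bar>" if "s \<in> {0..dist x y}" "t \<in> {0..dist x y}" for s t
      using c(1) that unfolding geodesic_on_def by blast
    have d: "dist (c a) (c b) = b - a"
      using cd[of a b] ab by simp
    have "{e \<in> S. dist (c a) e + dist e (c b) = dist (c a) (c b)} = c ` {a..b}"
    proof -
      have "dist (c a) (c t) + dist (c t) (c b) = b - a \<longleftrightarrow> t \<in> {a..b}" if "t \<in> {0..dist x y}" for t
      proof -
        have 1: "dist (c a) (c t) = \<bar>a - t\<bar>" and 2: "dist (c t) (c b) = \<bar>t - b\<bar>"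
          using that ab by (auto intro!: cd)
        show ?thesis
          unfolding 1 2 using ab(2) by (simp add: abs_if)
      qed
      note iff = this
      show ?thesis
        unfolding c(4) d
      proof (intro equalityI subsetI)
        fix e assume "e \<in> {e \<in> c ` {0..dist x y}. dist (c a) e + dist e (c b) = b - a}"
        then show "e \<in> c ` {a..b}"
          using iff by blast
      next
        fix e assume "e \<in> c ` {a..b}"
        then obtain t where "t \<in> {a..b}" "e = c t"
          by blast
        moreover have "t \<in> {0..dist x y}"
          using calculation ab by auto
        ultimately show "e \<in> {e \<in> c ` {0..dist x y}. dist (c a) e + dist e (c b) = b - a}"
          using iff by blast
      qed
    qed
    also have "\<dots> = (\<lambda>t. c (a + t)) ` {0..b - a}"
    proof -
      have "{a..b} = (\<lambda>t. a + t) ` {0..b - a}"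
        by simp
      then show ?thesis
        by (metis image_image)
    qed
    finally have eq: "{e \<in> S. dist (c a) e + dist e (c b) = dist (c a) (c b)} = (\<lambda>t. c (a + t)) ` {0..b - a}" .
    have "geodesic_on {0..b - a} (\<lambda>t. c (a + t))"
      unfolding geodesic_on_def using ab by (simp add: cd)
    then show ?thesis
      unfolding geodesic_segment_def eq unfolding d
      by (intro exI[of _ "\<lambda>t. c (a + t)"]) simp
  qed
  obtain a b where ab: "a \<in> {0..dist x y}" "v = c a" "b \<in> {0..dist x y}" "w = c b"
    using v c(4) by blast
  show ?thesis
  proof (cases "a \<le> b")
    case True
    then show ?thesis
      using *[of a b] ab by simp
  next
    case False
    then have "geodesic_segment w v {e \<in> S. dist w e + dist e v = dist w v}"
      using *[of b a] ab by simp
    moreover have "{e \<in> S. dist w e + dist e v = dist w v} = {e \<in> S. dist v e + dist e w = dist v w}"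
      by (auto simp: dist_commute add.commute)
    ultimately show ?thesis
      using geodesic_segment_sym by simp
  qed
qed

section \<open>Projections to contracting sets\<close>

lemma nearest_projD:
  assumes "z \<in> nearest_proj Z x"
  shows "z \<in> Z" "dist x z = infdist x Z"
  using assms by (auto simp: nearest_proj_def)

lemma nearest_proj_le: "z \<in> nearest_proj Z x \<Longrightarrow> w \<in> Z \<Longrightarrow> dist x z \<le> dist x w"
  by (auto simp: nearest_proj_def infdist_le)

lemma nearest_projI:
  assumes "z \<in> Z" "\<And>w. w \<in> Z \<Longrightarrow> dist x z \<le> dist x w"
  shows "z \<in> nearest_proj Z x"
proof -
  have "infdist x Z = dist x z"
  proof (rule antisym)
    show "infdist x Z \<le> dist x z"
      using assms(1) by (rule infdist_le)
    show "dist x z \<le> infdist x Z"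
      unfolding infdist_def using assms by (auto intro!: cINF_greatest)
  qed
  then show ?thesis
    using assms by (simp add: nearest_proj_def)
qed

lemma nearest_proj_exists:
  fixes Z :: "'a::heine_borel set"
  assumes "closed Z" "Z \<noteq> {}"
  obtains z where "z \<in> nearest_proj Z x"
  using infdist_attains_inf[OF assms] unfolding nearest_proj_def by (metis (mono_tags, lifting) mem_Collect_eq)

lemma nearest_proj_self: "x \<in> Z \<Longrightarrow> z \<in> nearest_proj Z x \<Longrightarrow> z = x"
  using nearest_proj_le by fastforce

lemma nearest_proj_image:
  assumes "\<And>u v. dist (g u) (g v) = dist u v" "z \<in> nearest_proj Z x"
  shows "g z \<in> nearest_proj (g ` Z) (g x)"
  using assms by (intro nearest_projI) (auto simp: nearest_proj_def infdist_le)

lemma nearest_proj_dist2: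
  assumes "z \<in> nearest_proj Z x" "w \<in> Z"
  shows "dist w z \<le> 2 * dist x w"
  using nearest_proj_le[OF assms] by metric

lemma nearest_proj_on_geodesic:
  assumes "z \<in> nearest_proj Z x" "geodesic_segment x z S" "u \<in> S"
  shows "z \<in> nearest_proj Z u"
proof (rule nearest_projI)
  show "z \<in> Z"
    using assms(1) by (rule nearest_projD)
  fix w assume "w \<in> Z"
  then have "dist x z \<le> dist x w"
    using nearest_proj_le assms(1) by blast
  moreover have "dist x u + dist u z = dist x z"
    using geodesic_segment_dist assms(2,3) by blast
  moreover have "dist x w \<le> dist x u + dist u w"
    by metric
  ultimately show "dist u z \<le> dist u w"
    by linarith
qed

lemma contractingD:
  assumes "contracting C Z" "z \<in> nearest_proj Z x" "z' \<in> nearest_proj Z x'" "dist x x' \<le> infdist x Z"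
  shows "dist z z' \<le> C"
proof -
  have "nearest_proj Z w \<subseteq> cball w (infdist w Z)" for w
    by (auto simp: nearest_proj_def)
  then have "bounded (nearest_proj Z x \<union> nearest_proj Z x')"
    by (meson bounded_Un bounded_cball bounded_subset)
  then have "dist z z' \<le> diameter (nearest_proj Z x \<union> nearest_proj Z x')"
    using assms by (intro diameter_bounded_bound) auto
  also have "\<dots> \<le> C"
    using assms unfolding contracting_def by blast
  finally show ?thesis .
qed

lemma contracting_mono:
  assumes "contracting C Z" "C \<le> C'"
  shows "contracting C' Z"
  using assms unfolding contracting_def by (meson order_trans)

lemma contractingI:
  assumes "closed Z" "0 \<le> C"
    and *: "\<And>x y z w. z \<in> nearest_proj Z x \<Longrightarrow> w \<in> nearest_proj Z y \<Longrightarrow> dist x y \<le> infdist x Z \<Longrightarrow> dist z w \<le> C"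
  shows "contracting C Z"
proof -
  have "diameter (nearest_proj Z x \<union> nearest_proj Z y) \<le> C" if "dist x y \<le> infdist x Z" for x y
  proof (cases "nearest_proj Z x \<union> nearest_proj Z y = {}")
    case False
    let ?W = "nearest_proj Z x \<union> nearest_proj Z y"
    have self: "dist v v \<le> infdist v Z" for v
      using infdist_nonneg by simp
    have xy: "dist z w \<le> C" if "z \<in> nearest_proj Z x" "w \<in> nearest_proj Z y" for z w
      using *[OF that \<open>dist x y \<le> infdist x Z\<close>] .
    have "dist z w \<le> C" if zw: "z \<in> ?W" "w \<in> ?W" for z w
    proof -
      consider "z \<in> nearest_proj Z x" "w \<in> nearest_proj Z x" | "z \<in> nearest_proj Z y" "w \<in> nearest_proj Z y"
        | "z \<in> nearest_proj Z x" "w \<in> nearest_proj Z y" | "z \<in> nearest_proj Z y" "w \<in> nearest_proj Z x"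
        using zw by blast
      then show ?thesis
        by cases (use * self xy[of z w] xy[of w z] in \<open>simp_all add: dist_commute\<close>)
    qed
    note le = this
    have "(SUP (z, w)\<in>?W \<times> ?W. dist z w) \<le> C"
    proof (rule cSUP_least)
      show "?W \<times> ?W \<noteq> {}"
        using False by simp
    next
      fix p assume "p \<in> ?W \<times> ?W"
      then show "(case p of (z, w) \<Rightarrow> dist z w) \<le> C"
        using le by (cases p) simp
    qed
    then show ?thesis
      using False assms(2) unfolding diameter_def by (simp only: if_False)
  qed (simp add: diameter_def assms)
  then show ?thesis
    using assms(1) unfolding contracting_def by blast
qed

lemma contracting_image:
  assumes Z: "contracting C Z" "0 \<le> C" and g: "surj g" "\<And>u v. dist (g u) (g v) = dist u v"
  shows "contracting C (g ` Z)"
proof (rule contractingI)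
  let ?k = "inv_into UNIV g"
  have gk: "g (?k u) = u" for u
    using g(1) by (simp add: surj_f_inv_f)
  have "inj g"
    by (rule injI) (metis g(2) dist_eq_0_iff)
  then have kg: "?k (g u) = u" for u
    by simp
  have k: "dist (?k u) (?k v) = dist u v" for u v
    by (metis g(2) gk)
  have "continuous_on UNIV ?k"
    unfolding continuous_on_iff k by blast
  moreover have img: "g ` Z = ?k -` Z"
    by (intro Set.set_eqI) (metis gk kg image_iff vimage_eq)
  ultimately show "closed (g ` Z)"
    using Z(1) unfolding contracting_def by (metis closed_vimage)
  have pk: "?k z \<in> nearest_proj Z (?k x)" if "z \<in> nearest_proj (g ` Z) x" for z x
    using nearest_proj_image[of ?k z "g ` Z" x] k that kg by (simp add: image_image)
  fix x y z w
  assume zw: "z \<in> nearest_proj (g ` Z) x" "w \<in> nearest_proj (g ` Z) y" "dist x y \<le> infdist x (g ` Z)"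
  then have "dist (?k x) (?k y) \<le> infdist (?k x) Z"
    using nearest_projD(2)[OF zw(1)] nearest_projD(2)[OF pk[OF zw(1)]] k by metis
  then show "dist z w \<le> C"
    using contractingD[OF Z(1) pk[OF zw(1)] pk[OF zw(2)]] k by simp
qed (rule Z(2))

context
  fixes Z :: "'a::heine_borel set" and C :: real
  assumes contr: "contracting C Z" and C: "0 < C" and ne: "Z \<noteq> {}"
begin

lemma contracting_closed: "closed Z"
  using contr by (simp add: contracting_def)

text \<open>Cut \<open>[a, b]\<close> into pieces of length at most \<open>2 * C\<close>. No piece
  is longer than the distance from its starting point to \<open>Z\<close>, so the projection moves
  by at most \<open>C\<close> on it, half the length of a full piece. The summand \<open>C\<close>
  pays for an incomplete piece.\<close>

lemma contracting_moves_slowly: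
  assumes "\<And>s t. s \<in> {a..b} \<Longrightarrow> t \<in> {a..b} \<Longrightarrow> dist (c s) (c t) = \<bar>s - t\<bar>"
    and "\<And>t. t \<in> {a..b} \<Longrightarrow> 2 * C \<le> infdist (c t) Z"
    and "a \<le> b" "z \<in> nearest_proj Z (c a)" "z' \<in> nearest_proj Z (c b)"
  shows "dist z z' \<le> (b - a) / 2 + C"
proof -
  have *: "dist z z' \<le> C * Suc n"
    if "b - a \<le> 2 * C * Suc n" "a \<le> b" "z' \<in> nearest_proj Z (c b)"
       "\<And>s t. s \<in> {a..b} \<Longrightarrow> t \<in> {a..b} \<Longrightarrow> dist (c s) (c t) = \<bar>s - t\<bar>"
       "\<And>t. t \<in> {a..b} \<Longrightarrow> 2 * C \<le> infdist (c t) Z" for n b z'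
    using that
  proof (induction n arbitrary: b z')
    case 0
    have "dist (c a) (c b) = b - a"
      using 0 by simp
    then have "dist (c a) (c b) \<le> infdist (c a) Z"
      using 0(1) 0(5)[of a] 0(2) by simp
    then show ?case
      using contractingD[OF contr assms(4) 0(3)] by simp
  next
    case (Suc n)
    define b' where "b' = max a (b - 2 * C)"
    have b': "a \<le> b'" "b' \<le> b" "b - b' \<le> 2 * C" "b' - a \<le> 2 * C * Suc n"
      using Suc.prems(1,2) C by (auto simp: b'_def algebra_simps max_def)
    obtain w where w: "w \<in> nearest_proj Z (c b')"
      using nearest_proj_exists[OF contracting_closed ne] by blast
    have "dist z w \<le> C * Suc n"
      using b' w Suc.prems by (intro Suc.IH) auto
    moreover have "dist w z' \<le> C"
    proof (rule contractingD[OF contr w Suc.prems(3)])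
      have "dist (c b') (c b) = b - b'"
        using b' Suc.prems(4)[of b' b] by simp
      then show "dist (c b') (c b) \<le> infdist (c b') Z"
        using b' Suc.prems(5)[of b'] by auto
    qed
    ultimately have "dist z z' \<le> C * Suc n + C"
      by metric
    then show ?case
      by (simp add: algebra_simps)
  qed
  define n where "n = nat \<lfloor>(b - a) / (2 * C)\<rfloor>"
  have n: "real n \<le> (b - a) / (2 * C)" "(b - a) / (2 * C) \<le> real n + 1"
    using assms(3) C unfolding n_def by auto
  have "dist z z' \<le> C * Suc n"
    using n C assms by (intro *) (auto simp: field_simps)
  also have "\<dots> \<le> (b - a) / 2 + C"
    using n C by (simp add: field_simps)
  finally show ?thesis .
qed

text \<open>Either the geodesic stays away from \<open>Z\<close>, where its projection moves at half speed, so that it is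
  short by comparison with the detour through \<open>Z\<close>; or the same comparison applies up to the first
  point close to \<open>Z\<close>.\<close>

lemma contracting_geodesic_near_proj:
  assumes z: "z \<in> nearest_proj Z x" and z': "z' \<in> nearest_proj Z x'"
    and far: "dist z z' > 6 * C" and S: "geodesic_segment x x' S"
  shows "\<exists>u\<in>S. dist u z \<le> 8 * C"
proof -
  obtain c where c: "geodesic_on {0..dist x x'} c" "c 0 = x" "c (dist x x') = x'" "S = c ` {0..dist x x'}"
    using S unfolding geodesic_segment_def by blast
  let ?L = "dist x x'"
  have cd: "dist (c s) (c t) = \<bar>s - t\<bar>" if "s \<in> {0..?L}" "t \<in> {0..?L}" for s t
    using c(1) that unfolding geodesic_on_def by blast
  have cont: "continuous_on {0..?L} (\<lambda>t. infdist (c t) Z)"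
  proof (rule continuous_on_infdist)
    show "continuous_on {0..?L} c"
      unfolding continuous_on_iff using cd by (metis abs_minus_commute dist_real_def)
  qed
  let ?r = "infdist x Z" and ?r' = "infdist x' Z"
  have r: "dist x z = ?r" "dist x' z' = ?r'"
    using z z' nearest_projD by metis+
  have r0: "0 \<le> ?r" "0 \<le> ?r'" "0 \<le> ?L"
    using infdist_nonneg by auto
  show ?thesis
  proof (cases "\<exists>t\<in>{0..?L}. infdist (c t) Z < 2 * C")
    case False
    then have out: "2 * C \<le> infdist (c t) Z" if "t \<in> {0..?L}" for t
      using that by force
    have L1: "?L > ?r" and L2: "?L > ?r'"
    proof -
      show "?L > ?r"
        using contractingD[OF contr z z'] far C by (intro not_le_imp_less) auto
      show "?L > ?r'"
        using contractingD[OF contr z' z] far C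
        by (intro not_le_imp_less) (auto simp: dist_commute)
    qed
    obtain w where w: "w \<in> nearest_proj Z (c ?r)"
      using nearest_proj_exists[OF contracting_closed ne] by blast
    have zw: "dist z w \<le> C"
      using cd[of 0 ?r] c(2) L1 r0 by (intro contractingD[OF contr z w]) auto
    have "dist z z' \<le> 6 * C"
    proof (cases "?r + ?r' \<ge> ?L")
      case True
      have "dist z' w \<le> C"
        using cd[of ?L ?r] c(3) L1 r0 True by (intro contractingD[OF contr z' w]) auto
      then show ?thesis
        using zw C dist_triangle[of z z' w] by (simp add: dist_commute)
    next
      case False
      obtain w' where w': "w' \<in> nearest_proj Z (c (?L - ?r'))"
        using nearest_proj_exists[OF contracting_closed ne] by blast
      have zw': "dist z' w' \<le> C"
        using cd[of ?L "?L - ?r'"] c(3) L2 r0 by (intro contractingD[OF contr z' w']) auto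
      have "dist w w' \<le> (?L - ?r' - ?r) / 2 + C"
        using False r0 L1 L2 out cd w w' by (intro contracting_moves_slowly[where c = c]) auto
      then have 1: "dist z z' \<le> 3 * C + (?L - ?r' - ?r) / 2"
        using zw zw' dist_triangle[of z z' w] dist_triangle[of w z' w'] by (simp add: dist_commute)
      \<comment> \<open>The detour through \<open>z\<close> and \<open>z'\<close> bounds the middle
        part \<open>?L - ?r' - ?r\<close> by \<open>dist z z'\<close> itself, only half of which
        occurs in \<open>1\<close>.\<close>
      have "?L \<le> ?r + dist z z' + ?r'"
        using r dist_triangle[of x x' z] dist_triangle[of z x' z'] by (simp add: dist_commute)
      with 1 show ?thesis
        by (simp add: field_simps)
    qed
    then show ?thesis
      using far by simp
  next
    case True
    define A where "A = {0..?L} \<inter> (\<lambda>t. infdist (c t) Z) -` {..2 * C}"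
    have "closed A"
      unfolding A_def by (rule continuous_closed_preimage[OF cont]) auto
    then have "compact A"
      unfolding A_def by (metis bounded_Int bounded_closed_interval compact_eq_bounded_closed)
    moreover have "A \<noteq> {}"
      using True unfolding A_def by force
    ultimately obtain t where t: "t \<in> A" "\<And>s. s \<in> A \<Longrightarrow> t \<le> s"
      using compact_attains_inf by metis
    have tL: "t \<in> {0..?L}" and tle: "infdist (c t) Z \<le> 2 * C"
      using t(1) by (auto simp: A_def)
    have cS: "c t \<in> S"
      using c(4) tL by blast
    obtain w where w: "w \<in> nearest_proj Z (c t)"
      using nearest_proj_exists[OF contracting_closed ne] by blast
    have cw: "dist (c t) w \<le> 2 * C"
      using w tle nearest_projD by metis
    show ?thesis
    proof (cases "t \<le> ?r")
      case True
      have "dist z w \<le> C"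
        using cd[of 0 t] c(2) True tL by (intro contractingD[OF contr z w]) auto
      then have "dist (c t) z \<le> 3 * C"
        using cw dist_triangle[of "c t" z w] by (simp add: dist_commute)
      then show ?thesis
        using cS C by (intro bexI[of _ "c t"]) auto
    next
      case False
      \<comment> \<open>By minimality of \<open>t\<close> only \<open>s = t\<close> could violate
        this, and then the intermediate value theorem gives an earlier point at distance exactly
        \<open>2 * C\<close>.\<close>
      have out: "2 * C \<le> infdist (c s) Z" if "s \<in> {0..t}" for s
      proof (rule ccontr)
        assume neg: "\<not> 2 * C \<le> infdist (c s) Z"
        have s: "s \<in> A"
          using neg that tL by (auto simp: A_def)
        then have "s = t"
          using t(2) that by force
        have inf0: "2 * C < infdist (c 0) Z"
        proof (rule ccontr)
          assume "\<not> 2 * C < infdist (c 0) Z"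
          then have "0 \<in> A"
            by (auto simp: A_def)
          then show False
            using t(2) False r0 by force
        qed
        obtain s' where s': "0 \<le> s'" "s' \<le> t" "infdist (c s') Z = 2 * C"
          using IVT2'[of "\<lambda>t. infdist (c t) Z" t "2 * C" 0] tle inf0 tL
            continuous_on_subset[OF cont] by (auto)
        then have "s' \<in> A"
          using tL by (auto simp: A_def)
        then show False
          using t(2) s' neg \<open>s = t\<close> by force
      qed
      obtain v where v: "v \<in> nearest_proj Z (c ?r)"
        using nearest_proj_exists[OF contracting_closed ne] by blast
      have zv: "dist z v \<le> C"
        using cd[of 0 ?r] c(2) False r0 tL by (intro contractingD[OF contr z v]) auto
      have "dist v w \<le> (t - ?r) / 2 + C"
        using False r0 out cd v w tL by (intro contracting_moves_slowly[where c = c]) auto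
      then have 1: "dist z w \<le> 2 * C + (t - ?r) / 2"
        using zv dist_triangle[of z w v] by (simp add: dist_commute)
      have "t = dist x (c t)"
        using cd[of 0 t] c(2) tL by auto
      also have "\<dots> \<le> ?r + dist z w + 2 * C"
        using r cw dist_triangle[of x "c t" z] dist_triangle[of z "c t" w] by (simp add: dist_commute)
      finally have "dist z w \<le> 6 * C"
        using 1 by (simp add: field_simps)
      then have "dist (c t) z \<le> 8 * C"
        using cw dist_triangle[of "c t" z w] by (simp add: dist_commute)
      then show ?thesis
        using cS by blast
    qed
  qed
qed

lemma contracting_geodesic_near_proj':
  assumes "z \<in> nearest_proj Z x" "z' \<in> nearest_proj Z x'"
    and "dist z z' > 6 * C" "geodesic_segment x x' S"
  shows "\<exists>u\<in>S. dist u z' \<le> 8 * C"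
  using contracting_geodesic_near_proj[OF assms(2,1) _ geodesic_segment_sym[OF assms(4)]] assms(3)
  by (simp add: dist_commute)

text \<open>If the projections are more than \<open>6 * C\<close> apart, a geodesic from
  \<open>x\<close> to \<open>x'\<close> comes within \<open>8 * C\<close> of both of them, which
  accounts for the error \<open>16 * C\<close>.\<close>

lemma contracting_proj_lipschitz:
  assumes z: "z \<in> nearest_proj Z x" "z' \<in> nearest_proj Z x'" and "geodesic_space TYPE('a)"
  shows "dist z z' \<le> dist x x' + 16 * C"
proof (cases "dist z z' > 6 * C")
  case True
  obtain S where S: "geodesic_segment x x' S"
    using assms(3) unfolding geodesic_space_def by blast
  obtain u where u: "u \<in> S" "dist u z \<le> 8 * C"
    using contracting_geodesic_near_proj[OF z True S] by blast
  obtain v where v: "v \<in> S" "dist v z' \<le> 8 * C"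
    using contracting_geodesic_near_proj'[OF z True S] by blast
  have "dist x u + dist u x' = dist x x'" "dist x v + dist v x' = dist x x'"
    using geodesic_segment_dist S u v by blast+
  then have "dist u v \<le> dist x x'"
    using geodesic_segment_dist_within[OF S u(1) v(1)] zero_le_dist[of x u] zero_le_dist[of x v]
      zero_le_dist[of u x'] zero_le_dist[of v x'] by linarith
  moreover have "dist z z' \<le> dist u z + dist u v + dist v z'"
    by metric
  ultimately show ?thesis
    using u v by linarith
next
  case False
  then show ?thesis
    using C zero_le_dist[of x x'] by linarith
qed

text \<open>If the projections of \<open>s\<close> and of an end were far apart, the geodesic would pass near the
  projection of \<open>s\<close>; doing so on both sides of \<open>s\<close> is impossible for \<open>s\<close> far from \<open>Z\<close>.\<close>

lemma contracting_quasiconvex: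
  assumes S: "geodesic_segment x x' S" and u: "u \<in> S" "infdist u Z \<le> 8 * C"
    and u': "u' \<in> S" "infdist u' Z \<le> 8 * C"
    and s: "s \<in> S" "dist x u \<le> dist x s" "dist x s \<le> dist x u'"
  shows "infdist s Z \<le> 28 * C"
proof -
  obtain w where w: "w \<in> nearest_proj Z s"
    using nearest_proj_exists[OF contracting_closed ne] by blast
  have near: "\<exists>e\<in>S. dist e w \<le> 14 * C \<and> dist e s + dist v e = dist v s"
    if v: "v \<in> S" "infdist v Z \<le> 8 * C" for v
  proof -
    obtain wv where wv: "wv \<in> nearest_proj Z v"
      using nearest_proj_exists[OF contracting_closed ne] by blast
    have vwv: "dist v wv \<le> 8 * C"
      using wv v nearest_projD by metis
    show ?thesis
    proof (cases "dist w wv > 6 * C")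
      case True
      define I where "I = {e \<in> S. dist v e + dist e s = dist v s}"
      have "geodesic_segment v s I"
        unfolding I_def using geodesic_subsegment S v(1) s(1) by blast
      then obtain e where "e \<in> I" "dist e w \<le> 8 * C"
        using contracting_geodesic_near_proj'[OF wv w] True by (auto simp: dist_commute)
      then show ?thesis
        using C unfolding I_def by (intro bexI[of _ e]) (auto simp: dist_commute)
    next
      case False
      then have "dist v w \<le> 14 * C"
        using vwv dist_triangle[of v w wv] by (simp add: dist_commute)
      then show ?thesis
        using v by (intro bexI[of _ v]) auto
    qed
  qed
  obtain e where e: "e \<in> S" "dist e w \<le> 14 * C" "dist e s + dist u e = dist u s"
    using near u by blast
  obtain e' where e': "e' \<in> S" "dist e' w \<le> 14 * C" "dist e' s + dist u' e' = dist u' s"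
    using near u' by blast
  note d = geodesic_segment_dist_within[OF S]
  have "dist x e \<le> dist x s"
    using d[OF e(1) s(1)] d[OF u(1) e(1)] d[OF u(1) s(1)] e(3) s(2) by linarith
  moreover have "dist x s \<le> dist x e'"
    using d[OF e'(1) s(1)] d[OF u'(1) e'(1)] d[OF u'(1) s(1)] e'(3) s(3) by linarith
  ultimately have "dist e e' = dist e s + dist s e'"
    using d[OF e(1) e'(1)] d[OF e(1) s(1)] d[OF s(1) e'(1)] by linarith
  moreover have "dist e e' \<le> 28 * C"
    using e e' dist_triangle[of e e' w] by (simp add: dist_commute)
  moreover have "infdist s Z \<le> dist s e + 14 * C" "infdist s Z \<le> dist s e' + 14 * C"
    using w e(2) e'(2) nearest_projD[OF w] dist_triangle[of s w e] dist_triangle[of s w e'] by auto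
  ultimately show ?thesis
    by (simp add: dist_commute)
qed

end

text \<open>The Behrstock inequality. If \<open>p2\<close> and \<open>q\<close> are far apart, the
  geodesic from \<open>x\<close> to \<open>p1\<close> passes near \<open>q\<close>. All points of
  this geodesic have \<open>p1\<close> as a nearest point on \<open>Z1\<close>, so the coarsely
  Lipschitz projection to \<open>Z1\<close> puts \<open>w\<close> near \<open>p1\<close>.\<close>

lemma behrstock:
  fixes Z1 Z2 :: "'a::heine_borel set"
  assumes "contracting C Z1" "contracting C Z2" "0 < C" "geodesic_space TYPE('a)"
    and p1: "p1 \<in> nearest_proj Z1 x" and p2: "p2 \<in> nearest_proj Z2 x"
    and q: "q \<in> nearest_proj Z2 p1" and w: "w \<in> nearest_proj Z1 q"
    and far: "dist p2 q > 6 * C"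
  shows "dist p1 w \<le> 24 * C"
proof -
  obtain S where S: "geodesic_segment x p1 S"
    using assms(4) unfolding geodesic_space_def by blast
  have "Z1 \<noteq> {}" "Z2 \<noteq> {}"
    using nearest_projD(1)[OF p1] nearest_projD(1)[OF p2] by auto
  then obtain u where u: "u \<in> S" "dist u q \<le> 8 * C"
    using contracting_geodesic_near_proj'[OF assms(2,3) _ p2 q far S] by blast
  have "p1 \<in> nearest_proj Z1 u"
    using nearest_proj_on_geodesic[OF p1 S u(1)] .
  then have "dist p1 w \<le> dist u q + 16 * C"
    using contracting_proj_lipschitz[OF assms(1,3) \<open>Z1 \<noteq> {}\<close> _ w assms(4)] by blast
  then show ?thesis
    using u by linarith
qed

section \<open>Discrete groups of isometries\<close>

text \<open>Discreteness is recorded as \<open>finite_ball\<close>, which counts group elements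
  rather than orbit points and so includes finiteness of stabilisers.\<close>

locale isometry_group =
  fixes x0 :: "'a::heine_borel" and G :: "('a \<Rightarrow> 'a) set"
  assumes isometry: "g \<in> G \<Longrightarrow> dist (g x) (g y) = dist x y"
    and surjective: "g \<in> G \<Longrightarrow> surj g"
    and id_mem: "id \<in> G"
    and comp_mem: "g \<in> G \<Longrightarrow> h \<in> G \<Longrightarrow> g \<circ> h \<in> G"
    and inverse_mem: "g \<in> G \<Longrightarrow> inv_into UNIV g \<in> G"
    and finite_ball: "finite {g \<in> G. dist x0 (g x0) \<le> r}"
begin

abbreviation ginv :: "('a \<Rightarrow> 'a) \<Rightarrow> 'a \<Rightarrow> 'a" where "ginv \<equiv> inv_into UNIV"

lemma ginv_right [simp]: "g \<in> G \<Longrightarrow> g (ginv g x) = x"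
  using surjective by (simp add: surj_f_inv_f)

lemma injective: "g \<in> G \<Longrightarrow> inj g"
  by (rule injI) (metis isometry dist_eq_0_iff)

lemma ginv_left [simp]: "g \<in> G \<Longrightarrow> ginv g (g x) = x"
  using injective by simp

lemma ginv_comp: "g \<in> G \<Longrightarrow> ginv g \<circ> g = id" "g \<in> G \<Longrightarrow> g \<circ> ginv g = id"
  by auto

lemma ginv_ginv [simp]: "g \<in> G \<Longrightarrow> ginv (ginv g) = g"
  using injective surjective by (simp add: inv_inv_eq bij_def)

lemma ginv_mult: "g \<in> G \<Longrightarrow> h \<in> G \<Longrightarrow> ginv (g \<circ> h) = ginv h \<circ> ginv g"
  using injective surjective by (simp add: o_inv_distrib bij_def)

lemma dist_ginv: "g \<in> G \<Longrightarrow> dist (ginv g x) y = dist x (g y)"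
  by (metis isometry ginv_right)

lemma dist_ginv': "g \<in> G \<Longrightarrow> dist x (ginv g y) = dist (g x) y"
  by (metis isometry ginv_right)

lemma finite_ball_at: "finite {g \<in> G. dist x (g x) \<le> r}"
proof (rule finite_subset[OF _ finite_ball[of "r + 2 * dist x0 x"]], clarify)
  fix g assume g: "g \<in> G" "dist x (g x) \<le> r"
  have "dist x0 (g x0) \<le> dist x0 x + dist x (g x) + dist (g x) (g x0)"
    by metric
  then show "dist x0 (g x0) \<le> r + 2 * dist x0 x"
    using g isometry[of g x x0] by (simp add: dist_commute)
qed

end

section \<open>The compact-open topology: from discreteness to finite balls\<close>

lemma carrier_Isom: "g \<in> carrier Isom \<longleftrightarrow> surj g \<and> (\<forall>x y. dist (g x) (g y) = dist x y)"
  by (simp add: Isom_def)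

lemma mult_Isom [simp]: "g \<otimes>\<^bsub>Isom\<^esub> h = g \<circ> h" and one_Isom [simp]: "\<one>\<^bsub>Isom\<^esub> = id"
  by (simp_all add: Isom_def)

lemma inverse_carrier_Isom:
  assumes "g \<in> carrier Isom"
  shows "inv_into UNIV g \<in> carrier Isom" "inv_into UNIV g \<circ> g = id"
proof -
  have s: "surj g" and d: "dist (g x) (g y) = dist x y" for x y
    using assms by (auto simp: carrier_Isom)
  have "inj g"
    by (rule injI) (metis d dist_eq_0_iff)
  then show "inv_into UNIV g \<circ> g = id"
    by simp
  have "dist (inv_into UNIV g x) (inv_into UNIV g y) = dist x y" for x y
    by (metis d s surj_f_inv_f)
  then show "inv_into UNIV g \<in> carrier Isom"
    using \<open>inj g\<close> by (simp add: carrier_Isom inj_imp_surj_inv)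
qed

lemma group_Isom: "group (Isom :: ('a::metric_space \<Rightarrow> 'a) monoid)"
proof (rule groupI)
  fix g h k :: "'a \<Rightarrow> 'a"
  assume g: "g \<in> carrier Isom"
  then show "\<exists>y\<in>carrier Isom. y \<otimes>\<^bsub>Isom\<^esub> g = \<one>\<^bsub>Isom\<^esub>"
    using inverse_carrier_Isom[OF g] by (intro bexI[of _ "inv_into UNIV g"]) simp_all
  show "\<one>\<^bsub>Isom\<^esub> \<otimes>\<^bsub>Isom\<^esub> g = g"
    by simp
  assume h: "h \<in> carrier Isom"
  have "surj (g \<circ> h)"
    using g h by (intro comp_surj) (simp_all add: carrier_Isom)
  then show "g \<otimes>\<^bsub>Isom\<^esub> h \<in> carrier Isom"
    using g h by (simp add: carrier_Isom)
  show "g \<otimes>\<^bsub>Isom\<^esub> h \<otimes>\<^bsub>Isom\<^esub> k = g \<otimes>\<^bsub>Isom\<^esub> (h \<otimes>\<^bsub>Isom\<^esub> k)"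
    by (simp add: comp_assoc)
qed (simp add: carrier_Isom)

lemma inv_Isom:
  assumes "g \<in> carrier Isom"
  shows "inv\<^bsub>Isom\<^esub> g = inv_into UNIV g"
  using group.inv_equality[OF group_Isom _ assms] inverse_carrier_Isom[OF assms] by simp

text \<open>By induction over the generated topology. If the identity lies in a subbasic set, then
  \<open>K\<close> is contained in \<open>V\<close>, and the compact set \<open>K\<close> has
  positive distance from the complement of \<open>V\<close>.\<close>

lemma open_Isom_near_id:
  fixes U :: "('a::heine_borel \<Rightarrow> 'a) set"
  assumes "openin Isom_topology U" "id \<in> U"
  shows "\<exists>K e. compact K \<and> 0 < e \<and> (\<forall>g\<in>carrier Isom. (\<forall>x\<in>K. dist (g x) x < e) \<longrightarrow> g \<in> U)"
proof -
  have "generate_topology_on {{g \<in> carrier Isom. g ` K \<subseteq> U} | K U. compact K \<and> open U} U"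
    using assms(1) by (simp add: Isom_topology_def openin_topology_generated_by_iff)
  then show ?thesis
    using assms(2)
  proof induction
    case (Int a b)
    from Int.prems have "id \<in> a" "id \<in> b"
      by blast+
    from Int.IH(1)[OF this(1)] obtain K e where
      K: "compact K" "0 < e" "\<forall>g\<in>carrier Isom. (\<forall>x\<in>K. dist (g x) x < e) \<longrightarrow> g \<in> a"
      by blast
    from Int.IH(2)[OF \<open>id \<in> b\<close>] obtain K' e' where
      K': "compact K'" "0 < e'" "\<forall>g\<in>carrier Isom. (\<forall>x\<in>K'. dist (g x) x < e') \<longrightarrow> g \<in> b"
      by blast
    show ?case
      using K K' by (intro exI[of _ "K \<union> K'"] exI[of _ "min e e'"]) (simp add: compact_Un)
  next
    case (UN \<K>)
    then obtain k where k: "k \<in> \<K>" "id \<in> k"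
      by blast
    from UN.IH[OF this] obtain K e
      where "compact K" "0 < e" "\<forall>g\<in>carrier Isom. (\<forall>x\<in>K. dist (g x) x < e) \<longrightarrow> g \<in> k"
      by blast
    then show ?case
      using k(1) by (intro exI[of _ K] exI[of _ e]) blast
  next
    case (Basis s)
    then obtain K V where s: "s = {g \<in> carrier Isom. g ` K \<subseteq> V}" "compact K" "open V"
      by blast
    then have "K \<inter> - V = {}"
      using Basis(2) by auto
    then obtain d where d: "d > 0" "\<And>x y. x \<in> K \<Longrightarrow> y \<in> - V \<Longrightarrow> d \<le> dist x y"
      using separate_compact_closed[of K "- V"] s(2,3) closed_Compl by metis
    have *: "g \<in> s" if g: "g \<in> carrier Isom" "\<forall>x\<in>K. dist (g x) x < d" for g
    proof -
      have "g x \<in> V" if "x \<in> K" for x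
        using d(2)[OF that, of "g x"] g(2) that by (metis ComplI dist_commute not_le)
      then show ?thesis
        using g(1) s(1) by blast
    qed
    show ?case
    proof (intro exI[of _ K] exI[of _ d] conjI ballI impI)
      show "compact K" "0 < d"
        by fact+
    next
      fix g :: "'a \<Rightarrow> 'a"
      assume "g \<in> carrier Isom" "\<forall>x\<in>K. dist (g x) x < d"
      then show "g \<in> s"
        by (rule *)
    qed
  next
    case Empty
    then show ?case
      by (rule emptyE)
  qed
qed

text \<open>A singleton is compact, so the isometries taking \<open>x0\<close> into an open ball
  form an open set; finitely many of these cover \<open>P\<close>.\<close>

lemma compactin_Isom_bounded:
  fixes x0 :: "'a::metric_space"
  assumes "compactin Isom_topology P"
  obtains D where "\<And>p. p \<in> P \<Longrightarrow> dist x0 (p x0) \<le> D"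
proof -
  define U where "U = (\<lambda>n::nat. {g \<in> carrier Isom. g ` {x0} \<subseteq> ball x0 (real n)})"
  have open_U: "openin Isom_topology (U n)" for n
    unfolding Isom_topology_def U_def
    by (intro topology_generated_by_Basis CollectI exI[of _ "{x0}"] exI[of _ "ball x0 (real n)"]) simp
  have "P \<subseteq> carrier Isom"
  proof -
    have "topspace Isom_topology \<subseteq> carrier (Isom :: ('a \<Rightarrow> 'a) monoid)"
      unfolding Isom_topology_def topology_generated_by_topspace by auto
    then show ?thesis
      using assms by (meson compactin_subset_topspace order_trans)
  qed
  have "p \<in> \<Union> (range U)" if "p \<in> P" for p
  proof -
    obtain n where "dist x0 (p x0) < real n"
      using reals_Archimedean2 by blast
    then have "p \<in> U n"
      using \<open>P \<subseteq> carrier Isom\<close> that unfolding U_def by auto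
    then show ?thesis
      by blast
  qed
  then have "P \<subseteq> \<Union> (range U)"
    by (rule subsetI)
  then obtain \<F> where F: "finite \<F>" "\<F> \<subseteq> range U" "P \<subseteq> \<Union>\<F>"
    using assms open_U unfolding compactin_def by (metis (mono_tags, lifting) imageE)
  then obtain N where N: "finite N" "\<F> = U ` N"
    by (meson finite_subset_image subset_UNIV)
  show thesis
  proof (rule that[of "real (Max (insert 0 N))"])
    fix p assume "p \<in> P"
    then obtain n where "n \<in> N" "p \<in> U n"
      using F N by blast
    moreover have "n \<le> Max (insert 0 N)"
      using N calculation by simp
    ultimately show "dist x0 (p x0) \<le> real (Max (insert 0 N))"
      unfolding U_def by force
  qed
qed

text \<open>A finite form of the Arzela-Ascoli theorem: up to \<open>e\<close> on \<open>K\<close>,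
  an isometry is determined by its rounded values on a finite net, and the condition on
  \<open>x0\<close> leaves only finitely many roundings.\<close>

lemma two_close_isometries:
  fixes x0 :: "'a::heine_borel"
  assumes inf: "infinite {g \<in> A. dist x0 (g x0) \<le> r}" and K: "compact K" and e: "0 < e"
    and iso: "\<And>g x y. g \<in> A \<Longrightarrow> dist (g x) (g y) = dist x y"
  shows "\<exists>g\<in>A. \<exists>h\<in>A. g \<noteq> h \<and> (\<forall>x\<in>K. dist (g x) (h x) < e)"
proof -
  obtain N where N: "finite N" "K \<subseteq> (\<Union>x\<in>N. ball x (e/3))"
    using K e unfolding compact_eq_totally_bounded by (metis divide_pos_pos zero_less_numeral)
  have "\<exists>M. finite M \<and> cball x0 (r + dist x0 x) \<subseteq> (\<Union>y\<in>M. ball y (e/6))" for x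
    using e compact_cball[of x0 "r + dist x0 x"] unfolding compact_eq_totally_bounded
    by (metis divide_pos_pos zero_less_numeral)
  then obtain M where M: "\<And>x. finite (M x)" "\<And>x. cball x0 (r + dist x0 x) \<subseteq> (\<Union>y\<in>M x. ball y (e/6))"
    by metis
  let ?A = "{g \<in> A. dist x0 (g x0) \<le> r}"
  have "\<exists>y\<in>M x. dist (g x) y < e/6" if "g \<in> ?A" for g x
  proof -
    have "dist x0 (g x) \<le> dist x0 (g x0) + dist (g x0) (g x)"
      by metric
    then have "g x \<in> cball x0 (r + dist x0 x)"
      using that iso by simp
    then have "g x \<in> (\<Union>y\<in>M x. ball y (e/6))"
      using M(2) by blast
    then show ?thesis
      by (simp add: dist_commute)
  qed
  note ex = this
  define k where "k = (\<lambda>g x. SOME y. y \<in> M x \<and> dist (g x) y < e/6)"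
  have k: "k g x \<in> M x \<and> dist (g x) (k g x) < e/6" if "g \<in> ?A" for g x
    unfolding k_def by (rule someI_ex) (use ex[OF that, of x] in blast)
  have "finite ((\<lambda>g. restrict (k g) N) ` ?A)"
  proof (rule finite_subset[OF _ finite_PiE[of N M]])
    show "(\<lambda>g. restrict (k g) N) ` ?A \<subseteq> (\<Pi>\<^sub>E x\<in>N. M x)"
      using k by (intro image_subsetI) (simp add: PiE_def Pi_def)
  qed (use N M in simp_all)
  then have "\<not> inj_on (\<lambda>g. restrict (k g) N) ?A"
    using inf finite_imageD by blast
  then obtain g h where gh: "g \<in> ?A" "h \<in> ?A" "g \<noteq> h" "restrict (k g) N = restrict (k h) N"
    unfolding inj_on_def by blast
  have "dist (g x) (h x) < e" if x: "x \<in> K" for x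
  proof -
    obtain y where y: "y \<in> N" "dist x y < e/3"
      using N x by (force simp: dist_commute)
    have "k g y = k h y"
      using gh(4) y(1) by (metis restrict_apply')
    moreover have "dist (g x) (g y) < e/3" "dist (h x) (h y) < e/3"
      using y iso gh by auto
    moreover have "dist (g y) (k g y) < e/6" "dist (h y) (k h y) < e/6"
      using k gh by blast+
    ultimately show ?thesis
      by metric
  qed
  then show ?thesis
    using gh by blast
qed

lemma discrete_subgroup_isometry_group:
  fixes x0 :: "'a::heine_borel"
  assumes "discrete_subgroup \<Gamma>"
  shows "isometry_group x0 \<Gamma>"
proof -
  interpret \<Gamma>: subgroup \<Gamma> Isom
    using assms by (simp add: discrete_subgroup_def)
  have carr: "g \<in> carrier Isom" if "g \<in> \<Gamma>" for g
    using that by (rule \<Gamma>.mem_carrier)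
  have iso: "dist (g x) (g y) = dist x y" "surj g" if "g \<in> \<Gamma>" for g x y
    using carr[OF that] by (simp_all add: carrier_Isom)
  have inv: "inv_into UNIV g \<in> \<Gamma>" if "g \<in> \<Gamma>" for g
    using \<Gamma>.m_inv_closed[OF that] unfolding inv_Isom[OF carr[OF that]] .
  have comp: "g \<circ> h \<in> \<Gamma>" if "g \<in> \<Gamma>" "h \<in> \<Gamma>" for g h
    using \<Gamma>.m_closed that by fastforce
  have id: "id \<in> \<Gamma>"
    using \<Gamma>.one_closed by simp
  have "openin (subtopology Isom_topology \<Gamma>) {id}"
    using assms id unfolding discrete_subgroup_def by simp
  then obtain U where U: "openin Isom_topology U" "{id} = U \<inter> \<Gamma>"
    unfolding openin_subtopology by (elim exE conjE)
  have "id \<in> U"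
    using U(2) by (rule equalityE) simp
  from open_Isom_near_id[OF U(1) this] obtain K e where
    K: "compact K" "0 < e" "\<forall>g\<in>carrier Isom. (\<forall>x\<in>K. dist (g x) x < e) \<longrightarrow> g \<in> U"
    by (elim exE conjE)
  have "finite {g \<in> \<Gamma>. dist x0 (g x0) \<le> r}" for r
  proof (rule ccontr)
    assume "infinite {g \<in> \<Gamma>. dist x0 (g x0) \<le> r}"
    then obtain g h where gh: "g \<in> \<Gamma>" "h \<in> \<Gamma>" "g \<noteq> h" "\<And>x. x \<in> K \<Longrightarrow> dist (g x) (h x) < e"
      using two_close_isometries[of \<Gamma> x0 r K e, OF _ K(1,2) iso(1)] by metis
    \<comment> \<open>Two elements of \<open>\<Gamma>\<close> that are close on \<open>K\<close>
      differ by an element of \<open>U \<inter> \<Gamma>\<close>, that is, by the identity.\<close>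
    let ?k = "inv_into UNIV g \<circ> h"
    have k: "?k \<in> \<Gamma>"
      using comp inv gh by blast
    have g: "g (inv_into UNIV g x) = x" for x
      using iso(2)[OF gh(1)] by (simp add: surj_f_inv_f)
    have "dist (?k x) x < e" if "x \<in> K" for x
      using gh(4)[OF that] iso(1)[OF gh(1), of "?k x" x] g by (simp add: dist_commute)
    then have "?k \<in> U"
      using K(3) carr[OF k] by metis
    then have "?k \<in> {id}"
      unfolding U(2) using k by simp
    then have "?k = id"
      by (rule singletonD)
    then have "h x = g x" for x
      using g[of "h x"] by (metis comp_apply id_apply)
    then have "g = h"
      by (intro ext) simp
    then show False
      using gh(3) by simp
  qed
  then show ?thesis
    using iso inv comp id by unfold_locales
qed

section \<open>The axis of a contracting isometry\<close>

locale contracting_axis = isometry_group x0 G for x0 :: "'a::heine_borel" and G +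
  fixes F :: "int \<Rightarrow> 'a \<Rightarrow> 'a" and C c :: real
  assumes geodesic: "geodesic_space TYPE('a)"
    and F_mem: "F k \<in> G"
    and F_add: "F (j + k) = F j \<circ> F k"
    and c1: "1 \<le> c"
    and qi_lower: "\<bar>real_of_int (j - k)\<bar> / c - c \<le> dist (F j x0) (F k x0)"
    and qi_upper: "dist (F j x0) (F k x0) \<le> c * \<bar>real_of_int (j - k)\<bar> + c"
    and C_pos: "0 < C"
    and axis_contracting: "contracting C (range (\<lambda>k. F k x0))"
begin

definition y :: "int \<Rightarrow> 'a" where "y k = F k x0"

definition Y :: "'a set" where "Y = range y"

abbreviation proj :: "'a \<Rightarrow> 'a set" where "proj \<equiv> nearest_proj Y"

lemma F_add_app: "F (j + k) x = F j (F k x)"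
  by (simp add: F_add)

lemma F_0 [simp]: "F 0 x = x"
proof -
  have "F 0 (F 0 x) = F 0 x"
    using F_add_app[of 0 0 x] by simp
  then show ?thesis
    using injective[OF F_mem] by (meson injD)
qed

lemma F_minus [simp]: "F (- k) (F k x) = x" "F k (F (- k) x) = x"
  using F_add_app[of "- k" k x] F_add_app[of k "- k" x] by simp_all

lemma ginv_F: "ginv (F k) x = F (- k) x"
  by (metis F_minus(2) F_mem ginv_left)

lemma F_y: "F j (y k) = y (j + k)"
  by (simp add: y_def F_add_app)

lemma y_0: "y 0 = x0"
  by (simp add: y_def)

lemma y_Y [simp]: "y k \<in> Y"
  by (simp add: Y_def)

lemma x0_Y [simp]: "x0 \<in> Y"
  using y_Y[of 0] by (simp add: y_0)

lemma Y_ne: "Y \<noteq> {}"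
  using x0_Y by blast

lemma F_Y: "F k ` Y = Y"
proof -
  have "y j = F k (y (j - k))" for j
    by (simp add: F_y)
  then have "Y \<subseteq> F k ` Y"
    unfolding Y_def by (metis image_eqI image_subsetI rangeI)
  moreover have "F k ` Y \<subseteq> Y"
    unfolding Y_def by (intro image_subsetI) (metis F_y imageE rangeI)
  ultimately show ?thesis
    by (rule equalityI[OF _ _, rotated])
qed

lemma contr: "contracting C Y"
  using axis_contracting unfolding Y_def y_def .

lemma contr_image: "g \<in> G \<Longrightarrow> contracting C (g ` Y)"
  using contracting_image[OF contr less_imp_le[OF C_pos] surjective isometry] .

lemma closed_Y: "closed Y"
  using contr by (simp add: contracting_def)

lemma y_dist_lower: "\<bar>real_of_int (j - k)\<bar> \<le> c * (dist (y j) (y k) + c)"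
proof -
  have "\<bar>real_of_int (j - k)\<bar> / c \<le> dist (y j) (y k) + c"
    using qi_lower[of j k] by (simp add: y_def)
  then show ?thesis
    using c1 by (simp add: field_simps)
qed

lemma y_dist_upper: "dist (y j) (y k) \<le> c * \<bar>real_of_int (j - k)\<bar> + c"
  using qi_upper[of j k] by (simp add: y_def)

lemma proj_ex: obtains k where "y k \<in> proj x"
proof -
  obtain z where "z \<in> proj x"
    using nearest_proj_exists[OF closed_Y Y_ne] .
  moreover from this have "z \<in> Y"
    by (rule nearest_projD)
  ultimately show thesis
    using that unfolding Y_def by blast
qed

lemma proj_image_iff:
  assumes "g \<in> G"
  shows "g z \<in> nearest_proj (g ` Z) (g x) \<longleftrightarrow> z \<in> nearest_proj Z x"
proof
  assume "g z \<in> nearest_proj (g ` Z) (g x)"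
  then have "ginv g (g z) \<in> nearest_proj (ginv g ` g ` Z) (ginv g (g x))"
    by (rule nearest_proj_image[OF isometry[OF inverse_mem[OF assms]]])
  moreover have "ginv g ` g ` Z = Z"
    by (simp add: image_image assms)
  ultimately show "z \<in> nearest_proj Z x"
    by (simp only: ginv_left[OF assms])
qed (rule nearest_proj_image[OF isometry[OF assms]])

lemma proj_F:
  assumes "z \<in> proj x"
  shows "F k z \<in> proj (F k x)"
  using nearest_proj_image[OF isometry[OF F_mem] assms, of k] by (simp add: F_Y)

lemma proj_image_ex:
  assumes "g \<in> G"
  obtains z where "z \<in> proj (ginv g x)" "g z \<in> nearest_proj (g ` Y) x"
proof -
  obtain z where "z \<in> proj (ginv g x)"
    using nearest_proj_exists[OF closed_Y Y_ne] .
  then show thesis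
    using that proj_image_iff[OF assms, of z Y "ginv g x"] assms by simp
qed

lemma proj_same: "z \<in> proj x \<Longrightarrow> w \<in> proj x \<Longrightarrow> dist z w \<le> C"
  using contractingD[OF contr, of z x w x] infdist_nonneg[of x Y] by simp

text \<open>The elementary subgroup \<open>E(f)\<close> of the contracting isometry \<open>f = F 1\<close>.\<close>

definition commensurating :: "('a \<Rightarrow> 'a) set" where
  "commensurating = {g \<in> G. \<exists>k k'. k \<noteq> 0 \<and> F k \<circ> g = g \<circ> F k'}"

lemma intertwine_multiple:
  assumes "F k \<circ> g = g \<circ> F k'"
  shows "F (n * k) \<circ> g = g \<circ> F (n * k')"
proof -
  have app: "F k (g x) = g (F k' x)" for x
    using fun_cong[OF assms, of x] by simp
  have nat: "F (int m * k) (g x) = g (F (int m * k') x)" for m x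
  proof (induction m arbitrary: x)
    case (Suc m)
    have "F (int (Suc m) * k) (g x) = F k (F (int m * k) (g x))"
      by (simp add: algebra_simps flip: F_add_app)
    also have "\<dots> = g (F k' (F (int m * k') x))"
      by (simp add: Suc app)
    also have "\<dots> = g (F (int (Suc m) * k') x)"
      by (simp add: algebra_simps flip: F_add_app)
    finally show ?case .
  qed simp
  have neg: "F (- (int m * k)) (g x) = g (F (- (int m * k')) x)" for m x
  proof -
    have "F (int m * k) (g (F (- (int m * k')) x)) = g x"
      by (simp add: nat)
    then show ?thesis
      by (metis F_minus(1))
  qed
  show ?thesis
  proof (rule ext, cases n rule: int_cases2)
    case (nonneg m)
    then show "(F (n * k) \<circ> g) x = (g \<circ> F (n * k')) x" for x
      by (simp add: nat)
  next
    case (nonpos m)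
    then show "(F (n * k) \<circ> g) x = (g \<circ> F (n * k')) x" for x
      by (simp add: neg)
  qed
qed

text \<open>Otherwise all multiples of \<open>k\<close> would give the same point \<open>x0\<close>,
  against the lower quasi-isometry bound.\<close>

lemma F_id_imp_0:
  assumes "\<And>x. F k x = x"
  shows "k = 0"
proof (rule ccontr)
  assume "k \<noteq> 0"
  have y0: "y (int m * k) = x0" for m
  proof (induction m)
    case (Suc m)
    have "y (int (Suc m) * k) = F k (y (int m * k))"
      by (simp add: F_y algebra_simps)
    then show ?case
      using Suc assms by simp
  qed (simp add: y_0)
  have "real m \<le> c * c" for m
  proof -
    have "\<bar>real_of_int (int m * k - 0)\<bar> \<le> c * (dist (y (int m * k)) (y 0) + c)"
      by (rule y_dist_lower)
    moreover have "real m \<le> \<bar>real_of_int (int m * k - 0)\<bar>"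
    proof -
      have "1 \<le> \<bar>real_of_int k\<bar>"
        using \<open>k \<noteq> 0\<close> by linarith
      then show ?thesis
        by (simp add: abs_mult mult_le_cancel_left1)
    qed
    ultimately show ?thesis
      by (simp add: y0 y_0)
  qed
  then show False
    using reals_Archimedean2[of "c * c"] by (meson not_le)
qed

lemma commensurating_G: "g \<in> commensurating \<Longrightarrow> g \<in> G"
  by (simp add: commensurating_def)

lemma F_commensurating: "F j \<in> commensurating"
proof -
  have "F 1 \<circ> F j = F j \<circ> F 1"
    by (metis F_add add.commute)
  then show ?thesis
    unfolding commensurating_def using F_mem by (intro CollectI conjI exI[of _ 1]) simp_all
qed

lemma commensurating_comp:
  assumes "g \<in> commensurating" "h \<in> commensurating"
  shows "g \<circ> h \<in> commensurating"
proof -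
  obtain k k' where k: "k \<noteq> 0" "F k \<circ> g = g \<circ> F k'"
    using assms(1) unfolding commensurating_def by blast
  obtain j j' where j: "j \<noteq> 0" "F j \<circ> h = h \<circ> F j'"
    using assms(2) unfolding commensurating_def by blast
  have "F (j * k) \<circ> (g \<circ> h) = (g \<circ> F (j * k')) \<circ> h"
    using intertwine_multiple[OF k(2), of j] by (simp add: comp_assoc[symmetric])
  also have "\<dots> = g \<circ> (h \<circ> F (k' * j'))"
    using intertwine_multiple[OF j(2), of k'] by (simp add: comp_assoc mult.commute)
  finally have "F (j * k) \<circ> (g \<circ> h) = (g \<circ> h) \<circ> F (k' * j')"
    by (simp add: comp_assoc)
  moreover have "j * k \<noteq> 0"
    using k(1) j(1) by simp
  ultimately show ?thesis
    unfolding commensurating_def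
    using comp_mem[OF commensurating_G commensurating_G, OF assms] by blast
qed

lemma commensurating_ginv:
  assumes "g \<in> commensurating"
  shows "ginv g \<in> commensurating"
proof -
  have g: "g \<in> G"
    using assms by (rule commensurating_G)
  obtain k k' where k: "k \<noteq> 0" "F k \<circ> g = g \<circ> F k'"
    using assms unfolding commensurating_def by blast
  have app: "F k (g x) = g (F k' x)" for x
    using fun_cong[OF k(2), of x] by simp
  have "k' \<noteq> 0"
  proof
    assume "k' = 0"
    then have "F k x = x" for x
      using app[of "ginv g x"] g by simp
    then show False
      using F_id_imp_0 k(1) by blast
  qed
  moreover have "F k' \<circ> ginv g = ginv g \<circ> F k"
  proof
    fix x
    have "g (F k' (ginv g x)) = F k x"
      using app[of "ginv g x"] g by simp
    then show "(F k' \<circ> ginv g) x = (ginv g \<circ> F k) x"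
      using g by (metis comp_apply ginv_left)
  qed
  ultimately show ?thesis
    unfolding commensurating_def using inverse_mem[OF g] by blast
qed

lemma not_commensurating_ginv: "g \<in> G \<Longrightarrow> g \<notin> commensurating \<Longrightarrow> ginv g \<notin> commensurating"
  using commensurating_ginv[of "ginv g"] by auto

lemma not_commensurating_comp:
  assumes "g \<in> G" "h \<in> G" "g \<in> commensurating \<longleftrightarrow> h \<notin> commensurating"
  shows "g \<circ> h \<notin> commensurating"
proof
  assume gh: "g \<circ> h \<in> commensurating"
  show False
  proof (cases "g \<in> commensurating")
    case True
    then have "ginv g \<circ> (g \<circ> h) \<in> commensurating"
      using gh commensurating_comp commensurating_ginv by blast
    moreover have "ginv g \<circ> (g \<circ> h) = h"
      using assms(1) by (simp add: comp_assoc[symmetric] ginv_comp)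
    ultimately show False
      using True assms(3) by simp
  next
    case False
    then have "(g \<circ> h) \<circ> ginv h \<in> commensurating"
      using gh assms(3) commensurating_comp commensurating_ginv by blast
    moreover have "(g \<circ> h) \<circ> ginv h = g"
      using assms(2) by (simp add: comp_assoc ginv_comp)
    ultimately show False
      using False by simp
  qed
qed

end

lemma connected_geodesic_segment:
  assumes "geodesic_segment x y S"
  shows "connected S"
proof -
  obtain c where c: "geodesic_on {0..dist x y} c" "S = c ` {0..dist x y}"
    using assms unfolding geodesic_segment_def by blast
  have "continuous_on {0..dist x y} c"
    unfolding continuous_on_iff
  proof (intro ballI allI impI)
    fix s and e :: real
    assume s: "s \<in> {0..dist x y}" and "0 < e"
    have "dist (c t) (c s) < e" if "t \<in> {0..dist x y}" "dist t s < e" for t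
      using c(1) s that unfolding geodesic_on_def dist_real_def by metis
    then show "\<exists>d>0. \<forall>t\<in>{0..dist x y}. dist t s < d \<longrightarrow> dist (c t) (c s) < e"
      using \<open>0 < e\<close> by blast
  qed
  then show ?thesis
    unfolding c(2) by (intro connected_continuous_image connected_Icc)
qed

lemma infdist_lessE:
  assumes "infdist x A < r" "A \<noteq> {}"
  obtains a where "a \<in> A" "dist x a < r"
  using assms cInf_lessD[of "dist x ` A" r] by (auto simp: infdist_def)

context isometry_group
begin

definition ball_count :: "real \<Rightarrow> nat" where
  "ball_count r = card {g \<in> G. dist x0 (g x0) \<le> r}"

text \<open>The centre \<open>p\<close> need not be an orbit point: translating by one element of
  the set brings the others near \<open>x0\<close> at the cost of doubling the radius.\<close>

lemma finite_ball_around: "finite {g \<in> G. dist p (g x0) \<le> r}"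
  and card_ball_around: "card {g \<in> G. dist p (g x0) \<le> r} \<le> ball_count (2 * r)"
proof -
  have "finite {g \<in> G. dist p (g x0) \<le> r} \<and> card {g \<in> G. dist p (g x0) \<le> r} \<le> ball_count (2 * r)"
  proof (cases "{g \<in> G. dist p (g x0) \<le> r} = {}")
    case False
    then obtain a where a: "a \<in> G" "dist p (a x0) \<le> r"
      by blast
    have inj: "inj_on (\<lambda>g. ginv a \<circ> g) {g \<in> G. dist p (g x0) \<le> r}"
    proof (rule inj_onI)
      fix g h assume "ginv a \<circ> g = ginv a \<circ> h"
      then have "(a \<circ> ginv a) \<circ> g = (a \<circ> ginv a) \<circ> h"
        by (simp only: comp_assoc)
      then show "g = h"
        using a(1) by (simp add: ginv_comp)
    qed
    have sub: "(\<lambda>g. ginv a \<circ> g) ` {g \<in> G. dist p (g x0) \<le> r} \<subseteq> {g \<in> G. dist x0 (g x0) \<le> 2 * r}"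
    proof (intro image_subsetI CollectI conjI)
      fix g assume g: "g \<in> {g \<in> G. dist p (g x0) \<le> r}"
      then show "ginv a \<circ> g \<in> G"
        using a(1) comp_mem inverse_mem by simp
      have "dist x0 ((ginv a \<circ> g) x0) = dist (a x0) (g x0)"
        by (simp add: dist_ginv' a(1))
      also have "\<dots> \<le> dist p (a x0) + dist p (g x0)"
        by metric
      finally show "dist x0 ((ginv a \<circ> g) x0) \<le> 2 * r"
        using a g by simp
    qed
    show ?thesis
      using inj_on_finite[OF inj sub finite_ball] card_inj_on_le[OF inj sub finite_ball]
      by (simp add: ball_count_def)
  next
    case True
    show ?thesis
      unfolding True by simp
  qed
  then show "finite {g \<in> G. dist p (g x0) \<le> r}" "card {g \<in> G. dist p (g x0) \<le> r} \<le> ball_count (2 * r)"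
    by auto
qed

end

section \<open>Overlaps of translates of the axis, and the behaviour of geodesics near it\<close>

context contracting_axis
begin

lemmas near_proj = contracting_geodesic_near_proj[OF contr C_pos Y_ne]
lemmas near_proj' = contracting_geodesic_near_proj'[OF contr C_pos Y_ne]
lemmas quasiconvex = contracting_quasiconvex[OF contr C_pos Y_ne]

lemma geodesic_ex: fixes x x' :: 'a obtains S where "geodesic_segment x x' S"
  using geodesic unfolding geodesic_space_def by blast

lemma infdist_attained:
  obtains k where "dist x (y k) = infdist x Y"
  using proj_ex[of x] nearest_projD(2) by metis

text \<open>Room for one point more than there are elements moving \<open>x0\<close> by at most
  \<open>56 * C\<close>, at spacing \<open>56 * C + 1\<close>. The summand \<open>22 * C\<close>
  covers \<open>8 * C\<close> lost at each end and the threshold \<open>6 * C\<close> of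
  \<open>near_proj\<close>.\<close>

definition overlap_bound :: real where
  "overlap_bound = 22 * C + (56 * C + 1) * (real (ball_count (56 * C)) + 1)"

text \<open>The lower quasi-isometry bound turns the length of the overlap into a bound on an index
  difference. It does not depend on the translating element, which is what
  \<open>commensurating_near_axis\<close> relies on.\<close>

definition period_bound :: real where
  "period_bound = c * (56 * C + (56 * C + 1) * (real (ball_count (56 * C)) + 1) + c)"

text \<open>Points at bounded spacing on the common part of two translates of the axis are close to both of
  them, which yields more elements moving \<open>x0\<close> a bounded amount than there are: two coincide.\<close>

lemma overlap_imp_intertwine:
  assumes g: "g \<in> G" and x: "x \<in> g ` Y" and x': "x' \<in> g ` Y"
    and z: "z \<in> proj x" and z': "z' \<in> proj x'" and far: "dist z z' > overlap_bound"
  shows "\<exists>k k'. k \<noteq> 0 \<and> \<bar>real_of_int k'\<bar> \<le> period_bound \<and> F k \<circ> g = g \<circ> F k'"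
proof -
  define N where "N = ball_count (56 * C)"
  define \<Delta> where "\<Delta> = 56 * C + 1"
  have \<Delta>: "0 < \<Delta>" "56 * C < \<Delta>"
    using C_pos by (auto simp: \<Delta>_def)
  have far': "dist z z' > 22 * C + \<Delta> * (real N + 1)"
    using far by (simp add: overlap_bound_def \<Delta>_def N_def)
  have "0 \<le> \<Delta> * (real N + 1)"
    using \<Delta>(1) by simp
  then have far6: "dist z z' > 6 * C"
    using far' C_pos by linarith
  obtain S where S: "geodesic_segment x x' S"
    by (rule geodesic_ex)
  obtain u where u: "u \<in> S" "dist u z \<le> 8 * C"
    using near_proj[OF z z' far6 S] by blast
  obtain u' where u': "u' \<in> S" "dist u' z' \<le> 8 * C"
    using near_proj'[OF z z' far6 S] by blast
  have uY: "infdist u Y \<le> 8 * C" "infdist u' Y \<le> 8 * C"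
    using infdist_le2 u(2) u'(2) nearest_projD(1)[OF z] nearest_projD(1)[OF z'] by blast+
  define T where "T = {e \<in> S. dist u e + dist e u' = dist u u'}"
  have T: "geodesic_segment u u' T"
    unfolding T_def using geodesic_subsegment[OF S u(1) u'(1)] .
  have "dist z z' \<le> dist u z + dist u u' + dist u' z'"
    by metric
  then have uu': "dist u u' > \<Delta> * (real N + 1)"
    using far' u(2) u'(2) C_pos by linarith
  obtain p where p: "geodesic_on {0..dist u u'} p" "p 0 = u" "p (dist u u') = u'" "T = p ` {0..dist u u'}"
    using T unfolding geodesic_segment_def by blast
  define s where "s = (\<lambda>j::nat. p (\<Delta> * real j))"
  have dom: "\<Delta> * real j \<in> {0..dist u u'}" if "j \<le> N" for j
  proof -
    have "\<Delta> * real j \<le> \<Delta> * (real N + 1)"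
      using that \<Delta>(1) by (intro mult_left_mono) auto
    then have "\<Delta> * real j \<le> dist u u'"
      using uu' by linarith
    then show ?thesis
      using \<Delta>(1) by simp
  qed
  have sT: "s j \<in> T" if "j \<le> N" for j
    unfolding s_def p(4) using dom[OF that] by blast
  have sd: "dist (s i) (s j) = \<Delta> * \<bar>real i - real j\<bar>" if "i \<le> N" "j \<le> N" for i j
  proof -
    have "dist (s i) (s j) = \<bar>\<Delta> * real i - \<Delta> * real j\<bar>"
      unfolding s_def using p(1) dom that unfolding geodesic_on_def by blast
    also have "\<dots> = \<bar>\<Delta> * (real i - real j)\<bar>"
      by (simp add: algebra_simps)
    finally show ?thesis
      using \<Delta>(1) by (simp add: abs_mult)
  qed
  have "\<exists>a. dist (s j) (y a) \<le> 28 * C" if "j \<le> N" for j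
  proof -
    have "dist u (s j) \<le> dist u u'"
      using geodesic_segment_dist[OF T sT[OF that]] zero_le_dist[of "s j" u'] by linarith
    then have "infdist (s j) Y \<le> 28 * C"
      using quasiconvex[OF T geodesic_segment_ends(1)[OF T] uY(1) geodesic_segment_ends(2)[OF T] uY(2) sT[OF that]]
      by simp
    then show ?thesis
      using infdist_attained[of "s j"] by metis
  qed
  then obtain a where a: "\<And>j. j \<le> N \<Longrightarrow> dist (s j) (y (a j)) \<le> 28 * C"
    by metis
  have "\<exists>b. dist (s j) (g (y b)) \<le> 28 * C" if "j \<le> N" for j
  proof -
    have sS: "s j \<in> S"
      using sT[OF that] by (simp add: T_def)
    have "dist x (s j) \<le> dist x x'"
      using geodesic_segment_dist[OF S sS] zero_le_dist[of "s j" x'] by linarith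
    then have "infdist (s j) (g ` Y) \<le> 28 * C"
      using contracting_quasiconvex[OF contr_image[OF g] C_pos _ S geodesic_segment_ends(1)[OF S] _ geodesic_segment_ends(2)[OF S] _ sS]
        x x' C_pos by auto
    moreover obtain z where "z \<in> nearest_proj (g ` Y) (s j)"
      using nearest_proj_exists[of "g ` Y"] contr_image[OF g] Y_ne unfolding contracting_def by blast
    moreover from nearest_projD(1)[OF this] obtain b where "z = g (y b)"
      unfolding Y_def by blast
    ultimately have "dist (s j) (g (y b)) \<le> 28 * C"
      using nearest_projD(2)[of z "g ` Y" "s j"] by simp
    then show ?thesis
      by blast
  qed
  then obtain b where b: "\<And>j. j \<le> N \<Longrightarrow> dist (s j) (g (y (b j))) \<le> 28 * C"
    by metis
  define h where "h = (\<lambda>j. F (- a j) \<circ> (g \<circ> F (b j)))"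
  have hG: "h j \<in> {g \<in> G. dist x0 (g x0) \<le> 56 * C}" if "j \<le> N" for j
  proof -
    have "dist x0 (h j x0) = dist (F (a j) x0) (F (a j) (F (- a j) (g (F (b j) x0))))"
      by (simp only: h_def comp_apply isometry[OF F_mem])
    also have "\<dots> = dist (y (a j)) (g (y (b j)))"
      by (simp add: y_def)
    also have "\<dots> \<le> dist (s j) (y (a j)) + dist (s j) (g (y (b j)))"
      by metric
    finally have "dist x0 (h j x0) \<le> 56 * C"
      using a[OF that] b[OF that] by linarith
    then show ?thesis
      using g by (simp add: h_def comp_mem F_mem)
  qed
  have "\<not> inj_on h {..N}"
  proof
    assume "inj_on h {..N}"
    then have "card {..N} \<le> card {g \<in> G. dist x0 (g x0) \<le> 56 * C}"
      using hG by (intro card_inj_on_le[OF _ _ finite_ball]) auto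
    then show False
      by (simp add: N_def ball_count_def)
  qed
  then obtain i j where ij: "i \<le> N" "j \<le> N" "i \<noteq> j" "h i = h j"
    unfolding inj_on_def by auto
  have dij: "\<Delta> \<le> dist (s i) (s j)" "dist (s i) (s j) \<le> \<Delta> * (real N + 1)"
  proof -
    have "1 \<le> \<bar>real i - real j\<bar>" "\<bar>real i - real j\<bar> \<le> real N + 1"
      using ij by linarith+
    then show "\<Delta> \<le> dist (s i) (s j)" "dist (s i) (s j) \<le> \<Delta> * (real N + 1)"
      using sd[OF ij(1,2)] \<Delta>(1) by (simp_all add: mult_left_mono)
  qed
  \<comment> \<open>With \<open>a i = a j\<close> the points \<open>s i\<close> and
    \<open>s j\<close> would be within \<open>56 * C\<close>, which is less than the spacing
    \<open>\<Delta>\<close>.\<close>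
  have "a j - a i \<noteq> 0"
  proof
    assume "a j - a i = 0"
    then have "dist (s i) (s j) \<le> dist (s i) (y (a i)) + dist (s j) (y (a j))"
      by simp metric
    then show False
      using a[OF ij(1)] a[OF ij(2)] dij(1) \<Delta>(2) by linarith
  qed
  moreover have "F (a j - a i) \<circ> g = g \<circ> F (b j - b i)"
  proof
    fix v
    have "F (- a i) (g (F (b i) (F (- b i) v))) = F (- a j) (g (F (b j) (F (- b i) v)))"
      using fun_cong[OF ij(4), of "F (- b i) v"] by (simp add: h_def)
    then have "F (a j) (F (- a i) (g v)) = g (F (b j) (F (- b i) v))"
      by (metis F_minus(2))
    then show "(F (a j - a i) \<circ> g) v = (g \<circ> F (b j - b i)) v"
      using F_add_app[of "a j" "- a i"] F_add_app[of "b j" "- b i"] by simp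
  qed
  moreover have "\<bar>real_of_int (b j - b i)\<bar> \<le> period_bound"
  proof -
    have "dist (y (b j)) (y (b i)) = dist (g (y (b j))) (g (y (b i)))"
      using isometry[OF g] by simp
    also have "\<dots> \<le> dist (s j) (g (y (b j))) + dist (s i) (s j) + dist (s i) (g (y (b i)))"
      by metric
    also have "\<dots> \<le> 56 * C + \<Delta> * (real N + 1)"
      using b[OF ij(1)] b[OF ij(2)] dij(2) by linarith
    finally have d: "dist (y (b j)) (y (b i)) + c \<le> 56 * C + \<Delta> * (real N + 1) + c"
      by simp
    have "\<bar>real_of_int (b j - b i)\<bar> \<le> c * (dist (y (b j)) (y (b i)) + c)"
      by (rule y_dist_lower)
    also have "\<dots> \<le> c * (56 * C + \<Delta> * (real N + 1) + c)"
      using d c1 by (intro mult_left_mono) auto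
    finally show ?thesis
      by (simp add: period_bound_def \<Delta>_def N_def)
  qed
  ultimately show ?thesis
    by blast
qed

lemma bounded_projection:
  assumes "g \<in> G" "g \<notin> commensurating" "x \<in> g ` Y" "x' \<in> g ` Y" "z \<in> proj x" "z' \<in> proj x'"
  shows "dist z z' \<le> overlap_bound"
  using overlap_imp_intertwine[OF assms(1,3-6)] assms(1,2) unfolding commensurating_def by force

text \<open>Apply \<open>behrstock\<close> to the translate of \<open>Y\<close> by \<open>g\<close>
  and to \<open>Y\<close>. On the translate, \<open>g x\<close> projects far from where
  \<open>Y\<close> projects; hence on \<open>Y\<close> it projects near the projection of the
  translate, which is a bounded set containing the projection of \<open>g x0\<close>.\<close>

lemma translate_proj:
  assumes g: "g \<in> G" "g \<notin> commensurating" and w: "w \<in> proj x" and z: "z \<in> proj (g x)"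
    and v0: "v0 \<in> proj (ginv g x0)" and z0: "z0 \<in> proj (g x0)"
    and far: "24 * C + overlap_bound < dist w v0"
  shows "dist z z0 \<le> 6 * C + overlap_bound"
proof -
  have gw: "g w \<in> nearest_proj (g ` Y) (g x)"
    using w by (simp only: proj_image_iff[OF g(1)])
  obtain q where q: "q \<in> proj (g w)"
    using nearest_proj_exists[OF closed_Y Y_ne] .
  obtain v where v: "v \<in> proj (ginv g q)" "g v \<in> nearest_proj (g ` Y) q"
    using proj_image_ex[OF g(1)] .
  have "dist v v0 \<le> overlap_bound"
    using nearest_projD(1)[OF q]
    by (intro bounded_projection[OF inverse_mem[OF g(1)] not_commensurating_ginv[OF g] _ _ v(1) v0]) simp_all
  moreover have "dist w v0 \<le> dist w v + dist v v0"
    by metric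
  ultimately have "24 * C < dist w v"
    using far by linarith
  then have "dist z q \<le> 6 * C"
    using behrstock[OF contr_image[OF g(1)] contr C_pos geodesic gw z q v(2)] isometry[OF g(1)] by fastforce
  moreover have "dist q z0 \<le> overlap_bound"
    using nearest_projD(1)[OF w] by (intro bounded_projection[OF g _ _ q z0]) simp_all
  moreover have "dist z z0 \<le> dist z q + dist q z0"
    by metric
  ultimately show ?thesis
    by linarith
qed

lemma overlap_bound_pos: "6 * C < overlap_bound"
proof -
  have "0 \<le> (56 * C + 1) * (real (ball_count (56 * C)) + 1)"
    using C_pos by simp
  then show ?thesis
    unfolding overlap_bound_def using C_pos by linarith
qed

lemma exists_large_index:
  obtains m :: nat where "0 < m" "\<And>j k. \<bar>j - k\<bar> \<ge> int m \<Longrightarrow> r < dist (y j) (y k)"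
proof -
  obtain m where m: "c * (r + c) < real m"
    using reals_Archimedean2 by blast
  show thesis
  proof (rule that[of "Suc m"])
    fix j k :: int
    assume "\<bar>j - k\<bar> \<ge> int (Suc m)"
    then have "real m \<le> \<bar>real_of_int (j - k)\<bar>"
      by linarith
    then have "c * (r + c) < c * (dist (y j) (y k) + c)"
      using m y_dist_lower[of j k] by linarith
    then show "r < dist (y j) (y k)"
      using c1 by simp
  qed simp
qed

text \<open>The given exponents of \<open>g\<close> may be huge, so they only serve to produce a
  long overlap, from which \<open>overlap_imp_intertwine\<close> extracts exponents \<open>k\<close>
  and \<open>k'\<close> with \<open>k'\<close> bounded uniformly in \<open>g\<close>. If
  \<open>g x0\<close> were farther than \<open>R\<close> from \<open>Y\<close>, then
  \<open>g x0\<close> and \<open>g (y (i0 * k'))\<close> would have projections within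
  \<open>C\<close> of each other, but these differ by the shift \<open>i0 * k\<close>.\<close>

lemma commensurating_near_axis:
  obtains R where "\<And>g. g \<in> commensurating \<Longrightarrow> \<exists>l. dist (g x0) (y l) \<le> R"
proof -
  obtain i0 :: nat where i0: "0 < i0" "\<And>j k. \<bar>j - k\<bar> \<ge> int i0 \<Longrightarrow> C < dist (y j) (y k)"
    using exists_large_index[of C] by blast
  obtain i1 :: nat where i1: "0 < i1" "\<And>j k. \<bar>j - k\<bar> \<ge> int i1 \<Longrightarrow> overlap_bound < dist (y j) (y k)"
    using exists_large_index[of overlap_bound] by blast
  have big: "int i \<le> \<bar>int i * k\<bar>" if "k \<noteq> 0" for i k
  proof -
    have "1 \<le> \<bar>k\<bar>"
      using that by linarith
    then show ?thesis
      by (simp add: abs_mult mult_le_cancel_left1)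
  qed
  define R where "R = c * (real i0 * period_bound) + c"
  have "\<exists>l. dist (g x0) (y l) \<le> R" if gE: "g \<in> commensurating" for g
  proof -
    have g: "g \<in> G"
      using gE by (rule commensurating_G)
    obtain j j' where j: "j \<noteq> 0" "F j \<circ> g = g \<circ> F j'"
      using gE unfolding commensurating_def by blast
    obtain l where l: "y l \<in> proj (g x0)"
      by (rule proj_ex)
    have shift: "y (k + l) \<in> proj (g (y k'))" if "F k \<circ> g = g \<circ> F k'" for k k'
    proof -
      have "g (y k') = F k (g x0)"
        using fun_cong[OF that, of x0] by (simp add: y_def)
      then show ?thesis
        using proj_F[OF l, of k] by (simp add: F_y)
    qed
    have "overlap_bound < dist (y l) (y (int i1 * j + l))"
      using big[OF j(1), of i1] by (intro i1(2)) simp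
    moreover have "g x0 \<in> g ` Y" "g (y (int i1 * j')) \<in> g ` Y"
      by simp_all
    ultimately obtain k k' where k: "k \<noteq> 0" "\<bar>real_of_int k'\<bar> \<le> period_bound" "F k \<circ> g = g \<circ> F k'"
      using overlap_imp_intertwine[OF g _ _ l shift[OF intertwine_multiple[OF j(2), of "int i1"]]] by metis
    have proj': "y (int i0 * k + l) \<in> proj (g (y (int i0 * k')))"
      by (rule shift[OF intertwine_multiple[OF k(3)]])
    have "dist (g x0) (g (y (int i0 * k'))) = dist (y 0) (y (int i0 * k'))"
      using isometry[OF g] by (simp add: y_0)
    also have "\<dots> \<le> c * \<bar>real_of_int (0 - int i0 * k')\<bar> + c"
      by (rule y_dist_upper)
    also have "\<dots> = c * (real i0 * \<bar>real_of_int k'\<bar>) + c"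
      by (simp add: abs_mult)
    also have "\<dots> \<le> R"
      unfolding R_def using k(2) c1 by (simp add: mult_left_mono)
    finally have d: "dist (g x0) (g (y (int i0 * k'))) \<le> R" .
    have "infdist (g x0) Y \<le> R"
    proof (rule ccontr)
      assume "\<not> infdist (g x0) Y \<le> R"
      then have "dist (g x0) (g (y (int i0 * k'))) \<le> infdist (g x0) Y"
        using d by linarith
      then have "dist (y l) (y (int i0 * k + l)) \<le> C"
        by (rule contractingD[OF contr l proj'])
      moreover have "C < dist (y l) (y (int i0 * k + l))"
        using big[OF k(1), of i0] by (intro i0(2)) simp
      ultimately show False
        by simp
    qed
    then show ?thesis
      using nearest_projD(2)[OF l] by (intro exI[of _ l]) simp
  qed
  then show thesis
    by (rule that)
qed

text \<open>Each element is near some \<open>y l\<close>, linearly many \<open>l\<close> are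
  possible, and each serves boundedly many elements. An arbitrary centre \<open>p\<close> is allowed
  in order to count cosets as well.\<close>

lemma card_commensurating_ball:
  obtains A where "0 \<le> A"
    "\<And>p r. 0 \<le> r \<Longrightarrow> finite {g \<in> commensurating. dist p (g x0) \<le> r} \<and>
       real (card {g \<in> commensurating. dist p (g x0) \<le> r}) \<le> A * (r + dist p x0 + 1)"
proof -
  obtain R where R: "\<And>g. g \<in> commensurating \<Longrightarrow> \<exists>l. dist (g x0) (y l) \<le> R"
    using commensurating_near_axis by blast
  define M where "M = ball_count (2 * R)"
  define A where "A = (2 * c * (1 + \<bar>R\<bar> + c) + 1) * real M"
  have A: "0 \<le> A"
    using c1 by (simp add: A_def)
  have "finite {g \<in> commensurating. dist p (g x0) \<le> r} \<and>
    real (card {g \<in> commensurating. dist p (g x0) \<le> r}) \<le> A * (r + dist p x0 + 1)" if r: "0 \<le> r" for p r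
  proof -
    define q where "q = r + dist p x0"
    have q: "0 \<le> q"
      using r by (simp add: q_def)
    define n where "n = \<lfloor>c * (q + \<bar>R\<bar> + c)\<rfloor>"
    have n0: "0 \<le> n" and nle: "real_of_int n \<le> c * (q + \<bar>R\<bar> + c)"
      using c1 q by (simp_all add: n_def)
    let ?B = "\<lambda>l. {g \<in> G. dist (y l) (g x0) \<le> R}"
    have sub: "{g \<in> commensurating. dist p (g x0) \<le> r} \<subseteq> (\<Union>l\<in>{- n..n}. ?B l)"
    proof
      fix g assume g: "g \<in> {g \<in> commensurating. dist p (g x0) \<le> r}"
      then obtain l where l: "dist (g x0) (y l) \<le> R"
        using R by blast
      have "dist (y l) (y 0) \<le> dist (g x0) (y l) + dist p (g x0) + dist p x0"
        unfolding y_0 by metric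
      also have "\<dots> \<le> q + \<bar>R\<bar>"
        using g l abs_ge_self[of R] unfolding q_def mem_Collect_eq by linarith
      finally have "c * (dist (y l) (y 0) + c) \<le> c * (q + \<bar>R\<bar> + c)"
        using c1 by (intro mult_left_mono) auto
      then have "\<bar>real_of_int (l - 0)\<bar> \<le> c * (q + \<bar>R\<bar> + c)"
        using y_dist_lower[of l 0] by linarith
      then have "\<bar>l\<bar> \<le> n"
        unfolding n_def by (simp add: le_floor_iff)
      then have "l \<in> {- n..n}"
        by auto
      moreover have "g \<in> ?B l"
        using g l commensurating_G by (simp add: dist_commute)
      ultimately show "g \<in> (\<Union>l\<in>{- n..n}. ?B l)"
        by blast
    qed
    have fin: "finite (\<Union>l\<in>{- n..n}. ?B l)"
      by (intro finite_UN_I finite_atLeastAtMost_int finite_ball_around)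
    have "card {g \<in> commensurating. dist p (g x0) \<le> r} \<le> card (\<Union>l\<in>{- n..n}. ?B l)"
      using fin sub by (rule card_mono)
    also have "\<dots> \<le> (\<Sum>l\<in>{- n..n}. card (?B l))"
      by (rule card_UN_le) simp
    also have "\<dots> \<le> (\<Sum>l\<in>{- n..n}. M)"
      unfolding M_def by (intro sum_mono card_ball_around)
    also have "\<dots> = nat (2 * n + 1) * M"
    proof -
      have "card {- n..n} = nat (2 * n + 1)"
        by simp
      then show ?thesis
        by (simp only: sum_constant of_nat_id)
    qed
    finally have "real (card {g \<in> commensurating. dist p (g x0) \<le> r}) \<le> real (nat (2 * n + 1)) * real M"
      by (simp only: of_nat_mult[symmetric] of_nat_le_iff)
    also have "\<dots> = (2 * real_of_int n + 1) * real M"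
      using n0 by simp
    also have "\<dots> \<le> (2 * (c * (q + \<bar>R\<bar> + c)) + 1) * real M"
      using nle by (intro mult_right_mono) auto
    also have "\<dots> \<le> A * (q + 1)"
    proof -
      have "c * (q + \<bar>R\<bar> + c) \<le> c * ((1 + \<bar>R\<bar> + c) * (q + 1))"
      proof (rule mult_left_mono)
        have "0 \<le> q * (\<bar>R\<bar> + c)"
          using q c1 by simp
        then show "q + \<bar>R\<bar> + c \<le> (1 + \<bar>R\<bar> + c) * (q + 1)"
          by (simp add: algebra_simps)
      qed (use c1 in simp)
      then have "2 * (c * (q + \<bar>R\<bar> + c)) + 1 \<le> (2 * c * (1 + \<bar>R\<bar> + c) + 1) * (q + 1)"
        using q by (simp add: algebra_simps)
      then have "(2 * (c * (q + \<bar>R\<bar> + c)) + 1) * real M \<le> (2 * c * (1 + \<bar>R\<bar> + c) + 1) * (q + 1) * real M"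
        by (rule mult_right_mono) simp
      also have "\<dots> = A * (q + 1)"
        unfolding A_def by (simp only: ac_simps)
      finally show ?thesis .
    qed
    finally show ?thesis
      using finite_subset[OF sub fin] by (simp add: q_def)
  qed
  then show thesis
    using A by (rule that[rotated])
qed

text \<open>\<open>m\<close> is the number of indices by which one may go beyond the projections of
  the end points, at a cost of \<open>c * m + c\<close>. The other terms come from quasiconvexity
  and from the largest jump of index between orbit points near the same point of the
  geodesic.\<close>

definition fellow_bound :: "real \<Rightarrow> real" where
  "fellow_bound m = 36 * C + 1 + c * (c * (56 * C + 2 + c)) + c + c * m + c"

text \<open>A connectedness argument. Between \<open>u\<close> and \<open>u'\<close> the geodesic is
  covered by two closed sets, the points near some \<open>y j\<close> with \<open>j \<le> k\<close>
  and those near some \<open>y j\<close> with \<open>k \<le> j\<close>. They meet, and at a common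
  point the two indices, with \<open>k\<close> between them, are close to each other.\<close>

lemma axis_near_geodesic_aux:
  assumes i: "y i \<in> proj x" and i': "y i' \<in> proj x'" and far: "6 * C < dist (y i) (y i')"
    and S: "geodesic_segment x x' S" and k: "i \<le> k" "k \<le> i'"
  shows "\<exists>s\<in>S. dist s (y k) \<le> 28 * C + 1 + (c * (c * (56 * C + 2 + c)) + c)"
proof -
  obtain u where u: "u \<in> S" "dist u (y i) \<le> 8 * C"
    using near_proj[OF i i' far S] by blast
  obtain u' where u': "u' \<in> S" "dist u' (y i') \<le> 8 * C"
    using near_proj'[OF i i' far S] by blast
  have uY: "infdist u Y \<le> 8 * C" "infdist u' Y \<le> 8 * C"
    using infdist_le2[OF y_Y] u(2) u'(2) by blast+
  define T where "T = {e \<in> S. dist u e + dist e u' = dist u u'}"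
  have T: "geodesic_segment u u' T"
    unfolding T_def using geodesic_subsegment[OF S u(1) u'(1)] .
  define A where "A = {s. infdist s (y ` {..k}) \<le> 28 * C}"
  define B where "B = {s. infdist s (y ` {k..}) \<le> 28 * C}"
  have cl: "closed A" "closed B"
    unfolding A_def B_def by (intro closed_Collect_le continuous_intros)+
  have "T \<subseteq> A \<union> B"
  proof
    fix s assume s: "s \<in> T"
    have "dist u s \<le> dist u u'"
      using geodesic_segment_dist[OF T s] zero_le_dist[of s u'] by linarith
    then have "infdist s Y \<le> 28 * C"
      using quasiconvex[OF T geodesic_segment_ends(1)[OF T] uY(1) geodesic_segment_ends(2)[OF T] uY(2) s]
      by simp
    then obtain j where j: "dist s (y j) \<le> 28 * C"
      using infdist_attained[of s] by metis
    show "s \<in> A \<union> B"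
    proof (cases "j \<le> k")
      case True
      then have "infdist s (y ` {..k}) \<le> 28 * C"
        using infdist_le2[OF _ j] by simp
      then show ?thesis
        by (simp add: A_def)
    next
      case False
      then have "infdist s (y ` {k..}) \<le> 28 * C"
        using infdist_le2[OF _ j] by simp
      then show ?thesis
        by (simp add: B_def)
    qed
  qed
  moreover have "u \<in> A"
    using infdist_le2[of "y i" "y ` {..k}" u "8 * C"] u(2) k(1) C_pos by (simp add: A_def)
  then have "A \<inter> T \<noteq> {}"
    using geodesic_segment_ends(1)[OF T] by blast
  moreover have "u' \<in> B"
    using infdist_le2[of "y i'" "y ` {k..}" u' "8 * C"] u'(2) k(2) C_pos by (simp add: B_def)
  then have "B \<inter> T \<noteq> {}"
    using geodesic_segment_ends(2)[OF T] by blast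
  ultimately have "A \<inter> B \<inter> T \<noteq> {}"
    using connected_closedD[OF connected_geodesic_segment[OF T] _ _ cl] by blast
  then obtain s where s: "s \<in> T" "s \<in> A" "s \<in> B"
    by blast
  have "infdist s (y ` {..k}) < 28 * C + 1"
    using s(2) by (simp add: A_def)
  then obtain j where j: "j \<le> k" "dist s (y j) < 28 * C + 1"
    by (rule infdist_lessE) auto
  have "infdist s (y ` {k..}) < 28 * C + 1"
    using s(3) by (simp add: B_def)
  then obtain j' where j': "k \<le> j'" "dist s (y j') < 28 * C + 1"
    by (rule infdist_lessE) auto
  have "dist (y j') (y j) \<le> dist s (y j) + dist s (y j')"
    by metric
  then have "dist (y j') (y j) + c \<le> 56 * C + 2 + c"
    using j j' by linarith
  then have "c * (dist (y j') (y j) + c) \<le> c * (56 * C + 2 + c)"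
    using c1 by (intro mult_left_mono) auto
  then have jj': "\<bar>real_of_int (j' - j)\<bar> \<le> c * (56 * C + 2 + c)"
    using y_dist_lower[of j' j] by linarith
  have "\<bar>real_of_int (j - k)\<bar> \<le> \<bar>real_of_int (j' - j)\<bar>"
    using j(1) j'(1) by linarith
  then have "c * \<bar>real_of_int (j - k)\<bar> \<le> c * (c * (56 * C + 2 + c))"
    using jj' c1 by (intro mult_left_mono) auto
  then have "dist (y j) (y k) \<le> c * (c * (56 * C + 2 + c)) + c"
    using y_dist_upper[of j k] by linarith
  moreover have "dist s (y k) \<le> dist s (y j) + dist (y j) (y k)"
    by metric
  ultimately have "dist s (y k) \<le> 28 * C + 1 + (c * (c * (56 * C + 2 + c)) + c)"
    using j(2) by linarith
  then show ?thesis
    using s(1) by (auto simp: T_def)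
qed

lemma axis_near_geodesic:
  assumes i: "y i \<in> proj x" and i': "y i' \<in> proj x'" and far: "6 * C < dist (y i) (y i')"
    and S: "geodesic_segment x x' S" and "i \<le> i'" and k: "i - m \<le> k" "k \<le> i' + m" and m: "0 \<le> m"
  shows "\<exists>s\<in>S. dist s (y k) \<le> fellow_bound m"
proof -
  have pos: "0 \<le> c * (c * (56 * C + 2 + c))" "0 \<le> c * m" "0 \<le> c"
    using c1 C_pos m by auto
  have near: "\<exists>s\<in>S. dist s (y k) \<le> fellow_bound m"
    if "s \<in> S" "dist s (y j) \<le> 8 * C" "\<bar>j - k\<bar> \<le> m" for s j
  proof -
    have "c * \<bar>real_of_int (j - k)\<bar> \<le> c * m"
      using that(3) c1 by (intro mult_left_mono) linarith+
    then have "dist (y j) (y k) \<le> c * m + c"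
      using y_dist_upper[of j k] by linarith
    moreover have "dist s (y k) \<le> dist s (y j) + dist (y j) (y k)"
      by metric
    ultimately have "dist s (y k) \<le> fellow_bound m"
      using that(2) pos C_pos unfolding fellow_bound_def by linarith
    then show ?thesis
      using that(1) by blast
  qed
  consider "k < i" | "i \<le> k" "k \<le> i'" | "i' < k"
    by linarith
  then show ?thesis
  proof cases
    case 1
    obtain u where u: "u \<in> S" "dist u (y i) \<le> 8 * C"
      using near_proj[OF i i' far S] by blast
    show ?thesis
      using 1 k by (intro near[OF u]) linarith
  next
    case 2
    then obtain s where "s \<in> S" "dist s (y k) \<le> 28 * C + 1 + (c * (c * (56 * C + 2 + c)) + c)"
      using axis_near_geodesic_aux[OF i i' far S] by blast
    moreover from this have "dist s (y k) \<le> fellow_bound m"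
      using pos C_pos unfolding fellow_bound_def by linarith
    ultimately show ?thesis
      by blast
  next
    case 3
    obtain u where u: "u \<in> S" "dist u (y i') \<le> 8 * C"
      using near_proj'[OF i i' far S] by blast
    show ?thesis
      using 3 k by (intro near[OF u]) linarith
  qed
qed

lemma axis_between:
  assumes "y i \<in> proj x" "y i' \<in> proj x'" "6 * C < dist (y i) (y i')"
    and "i \<le> i'" "i - m \<le> k" "k \<le> i' + m" "0 \<le> m"
  shows "dist x (y k) + dist x' (y k) \<le> dist x x' + 2 * fellow_bound m"
proof -
  obtain S where S: "geodesic_segment x x' S"
    by (rule geodesic_ex)
  obtain s where s: "s \<in> S" "dist s (y k) \<le> fellow_bound m"
    using axis_near_geodesic[OF assms(1-3) S assms(4-7)] by blast
  have "dist x (y k) \<le> dist x s + dist s (y k)" "dist x' (y k) \<le> dist s x' + dist s (y k)"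
    by metric+
  then show ?thesis
    using s(2) geodesic_segment_dist[OF S s(1)] by linarith
qed

text \<open>\<open>q s\<close> and \<open>s'\<close> lie on one geodesic from \<open>q b\<close>, so
  their distance is the difference of their distances from \<open>q b\<close>. Up to
  \<open>2 * K\<close> this is the difference of the distances of \<open>p\<close> from
  \<open>b\<close> and from \<open>q b\<close>.\<close>

lemma displacement_near_geodesic:
  assumes q: "\<And>u v. dist (q u) (q v) = dist u v" and S: "geodesic_segment b b' S" and s: "s \<in> S" "dist s p \<le> K"
    and s': "s' \<in> q ` S" "dist s' p \<le> K" and L: "\<bar>dist (q b) p - dist b p\<bar> \<le> L"
  shows "dist p (q p) \<le> 4 * K + L"
proof -
  have qS: "geodesic_segment (q b) (q b') (q ` S)"
    using geodesic_segment_image[OF S q] .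
  have "dist (q s) s' = \<bar>dist (q b) (q s) - dist (q b) s'\<bar>"
    using s(1) by (intro geodesic_segment_dist_within[OF qS _ s'(1)]) simp
  also have "\<dots> = \<bar>dist b s - dist (q b) s'\<bar>"
    using q by simp
  also have "\<dots> \<le> 2 * K + L"
  proof -
    have "\<bar>dist b s - dist b p\<bar> \<le> dist s p" "\<bar>dist (q b) s' - dist (q b) p\<bar> \<le> dist s' p"
      by (metis abs_dist_diff_le dist_commute)+
    then show ?thesis
      using L s(2) s'(2) by linarith
  qed
  finally have "dist (q s) s' \<le> 2 * K + L" .
  moreover have "dist p (q p) \<le> dist s' p + dist (q s) s' + dist (q s) (q p)"
    by metric
  moreover have "dist (q s) (q p) = dist s p"
    using q .
  ultimately show ?thesis
    using s(2) s'(2) by linarith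
qed

text \<open>The shifts of \<open>q\<close> along the three geodesics joining the \<open>b\<^sub>j\<close>, all of which pass near the axis point
  of index \<open>i\<^sub>3\<close>, cancel in pairs, so all of them are small.\<close>

lemma tripod_displacement:
  obtains K :: real and m1 :: int where "0 < m1"
    "\<And>q b1 b2 b3 i1 i2 i3. (\<And>u v. dist (q u) (q v) = dist u v) \<Longrightarrow>
      y i1 \<in> proj b1 \<Longrightarrow> y i2 \<in> proj b2 \<Longrightarrow> y i3 \<in> proj b3 \<Longrightarrow>
      dist b1 (q b1) \<le> infdist b1 Y \<Longrightarrow> dist b2 (q b2) \<le> infdist b2 Y \<Longrightarrow> dist b3 (q b3) \<le> infdist b3 Y \<Longrightarrow>
      m1 \<le> i1 \<Longrightarrow> i2 \<le> - m1 \<Longrightarrow> i3 + m1 \<le> i1 \<Longrightarrow> i2 + m1 \<le> i3 \<Longrightarrow> dist x0 (q x0) \<le> K"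
proof -
  obtain m0 :: nat where m0: "0 < m0" "\<And>j k. \<bar>j - k\<bar> \<ge> int m0 \<Longrightarrow> 6 * C < dist (y j) (y k)"
    using exists_large_index[of "6 * C"] by blast
  \<comment> \<open>Under \<open>q\<close> the projection of an end moves by at most
    \<open>C\<close>; \<open>m\<close> expresses this in terms of indices.\<close>
  define m :: int where "m = \<lfloor>c * (C + c)\<rfloor>"
  have m: "0 \<le> m"
    using c1 C_pos by (simp add: m_def)
  define L where "L = fellow_bound m"
  \<comment> \<open>Indices that differ by \<open>m1\<close> still differ by \<open>m0\<close> after
    each has moved by \<open>m\<close>.\<close>
  define m1 where "m1 = int m0 + 2 * m"
  have "dist x0 (q x0) \<le> 9 * L"
    if q: "\<And>u v. dist (q u) (q v) = dist u v" and i: "y i1 \<in> proj b1" "y i2 \<in> proj b2" "y i3 \<in> proj b3"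
      and small: "dist b1 (q b1) \<le> infdist b1 Y" "dist b2 (q b2) \<le> infdist b2 Y" "dist b3 (q b3) \<le> infdist b3 Y"
      and sep: "m1 \<le> i1" "i2 \<le> - m1" "i3 + m1 \<le> i1" "i2 + m1 \<le> i3"
    for q b1 b2 b3 i1 i2 i3
  proof -
    have moved: "\<exists>k'. y k' \<in> proj (q b) \<and> \<bar>k' - k\<bar> \<le> m"
      if "y k \<in> proj b" "dist b (q b) \<le> infdist b Y" for b k
    proof -
      obtain k' where k': "y k' \<in> proj (q b)"
        by (rule proj_ex)
      have "dist (y k) (y k') \<le> C"
        by (rule contractingD[OF contr that(1) k' that(2)])
      then have "c * (dist (y k') (y k) + c) \<le> c * (C + c)"
        using c1 by (intro mult_left_mono) (auto simp: dist_commute)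
      then have "\<bar>real_of_int (k' - k)\<bar> \<le> c * (C + c)"
        using y_dist_lower[of k' k] by linarith
      then have "\<bar>k' - k\<bar> \<le> m"
        unfolding m_def by (simp add: le_floor_iff)
      then show ?thesis
        using k' by blast
    qed
    obtain j1 where j1: "y j1 \<in> proj (q b1)" "\<bar>j1 - i1\<bar> \<le> m"
      using moved[OF i(1) small(1)] by blast
    obtain j2 where j2: "y j2 \<in> proj (q b2)" "\<bar>j2 - i2\<bar> \<le> m"
      using moved[OF i(2) small(2)] by blast
    obtain j3 where j3: "y j3 \<in> proj (q b3)" "\<bar>j3 - i3\<bar> \<le> m"
      using moved[OF i(3) small(3)] by blast
    note idx = sep j1(2) j2(2) j3(2) m m1_def m0(1)
    have far: "6 * C < dist (y j) (y k)" if "j + int m0 \<le> k" for j k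
      using that by (intro m0(2)) linarith
    have btw: "dist x (y k) + dist x' (y k) \<le> dist x x' + 2 * L"
      if "y j \<in> proj x" "y j' \<in> proj x'" "j + int m0 \<le> j'" "j - m \<le> k" "k \<le> j' + m" for x x' j j' k
      unfolding L_def using that m by (intro axis_between[OF that(1,2) far]) auto
    define e where "e = y i3"
    have e: "y i3 \<in> proj e"
      unfolding e_def by (intro nearest_projI) auto
    have shift: "\<bar>(dist (q x) e + dist (q x') e) - (dist x e + dist x' e)\<bar> \<le> 2 * L"
      if "dist x e + dist x' e \<le> dist x x' + 2 * L" "dist (q x) e + dist (q x') e \<le> dist (q x) (q x') + 2 * L" for x x'
    proof -
      have "dist x x' \<le> dist x e + dist x' e" "dist (q x) (q x') \<le> dist (q x) e + dist (q x') e"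
        by metric+
      then show ?thesis
        using that q[of x x'] by linarith
    qed
    have s12: "\<bar>(dist (q b2) e + dist (q b1) e) - (dist b2 e + dist b1 e)\<bar> \<le> 2 * L"
      unfolding e_def by (intro shift[unfolded e_def] btw[OF i(2,1)] btw[OF j2(1) j1(1)]) (use idx in linarith)+
    have s13: "\<bar>(dist (q b3) e + dist (q b1) e) - (dist b3 e + dist b1 e)\<bar> \<le> 2 * L"
      unfolding e_def by (intro shift[unfolded e_def] btw[OF i(3,1)] btw[OF j3(1) j1(1)]) (use idx in linarith)+
    have s23: "\<bar>(dist (q b2) e + dist (q b3) e) - (dist b2 e + dist b3 e)\<bar> \<le> 2 * L"
      unfolding e_def by (intro shift[unfolded e_def] btw[OF i(2,3)] btw[OF j2(1) j3(1)]) (use idx in linarith)+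
    have near: "dist x0 (q x0) \<le> 9 * L"
      if S: "geodesic_segment b b' S" and b: "y k \<in> proj b" "y k' \<in> proj (q b)" "\<exists>s\<in>S. dist s x0 \<le> L"
        "\<exists>s\<in>q ` S. dist s x0 \<le> L" and eb: "\<bar>dist (q b) e - dist b e\<bar> \<le> 3 * L"
        and be: "dist b x0 + dist e x0 \<le> dist b e + 2 * L" "dist (q b) x0 + dist e x0 \<le> dist (q b) e + 2 * L"
      for b b' S k k'
    proof -
      have "dist b e \<le> dist b x0 + dist e x0" "dist (q b) e \<le> dist (q b) x0 + dist e x0"
        by metric+
      then have L5: "\<bar>dist (q b) x0 - dist b x0\<bar> \<le> 5 * L"
        using eb be by linarith
      obtain s s' where "s \<in> S" "dist s x0 \<le> L" "s' \<in> q ` S" "dist s' x0 \<le> L"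
        using b(3,4) by (elim bexE)
      then have "dist x0 (q x0) \<le> 4 * L + 5 * L"
        by (rule displacement_near_geodesic[OF q S _ _ _ _ L5])
      then show ?thesis
        by simp
    qed
    obtain S where S: "geodesic_segment b2 b1 S"
      by (rule geodesic_ex)
    have qS: "geodesic_segment (q b2) (q b1) (q ` S)"
      using geodesic_segment_image[OF S q] .
    have S0: "\<exists>s\<in>S. dist s x0 \<le> L"
      by (rule axis_near_geodesic[OF i(2,1) far S, of m 0, unfolded y_0, folded L_def]) (use idx in linarith)+
    have qS0: "\<exists>s\<in>q ` S. dist s x0 \<le> L"
      by (rule axis_near_geodesic[OF j2(1) j1(1) far qS, of m 0, unfolded y_0, folded L_def]) (use idx in linarith)+
    show ?thesis
    \<comment> \<open>\<open>x0\<close> lies coarsely between \<open>b2\<close> and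
      \<open>e\<close>, or between \<open>e\<close> and \<open>b1\<close>. The shift of that end
      relative to \<open>e\<close> is then also its shift relative to \<open>x0\<close>.\<close>
    proof (cases "0 \<le> i3")
      case True
      have "\<bar>dist (q b2) e - dist b2 e\<bar> \<le> 3 * L"
        using s12 s13 s23 by linarith
      moreover have "dist b2 x0 + dist e x0 \<le> dist b2 e + 2 * L"
        by (rule btw[OF i(2) e, of 0, unfolded y_0]) (use idx True in linarith)+
      moreover have "dist (q b2) x0 + dist e x0 \<le> dist (q b2) e + 2 * L"
        by (rule btw[OF j2(1) e, of 0, unfolded y_0]) (use idx True in linarith)+
      ultimately show ?thesis
        by (rule near[OF S i(2) j2(1) S0 qS0])
    next
      case False
      have "\<bar>dist (q b1) e - dist b1 e\<bar> \<le> 3 * L"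
        using s12 s13 s23 by linarith
      moreover have "dist e x0 + dist b1 x0 \<le> dist e b1 + 2 * L"
        by (rule btw[OF e i(1), of 0, unfolded y_0]) (use idx False in linarith)+
      moreover have "dist e x0 + dist (q b1) x0 \<le> dist e (q b1) + 2 * L"
        by (rule btw[OF e j1(1), of 0, unfolded y_0]) (use idx False in linarith)+
      ultimately show ?thesis
        using near[OF geodesic_segment_sym[OF S] i(1) j1(1) S0 qS0] by (simp add: dist_commute add.commute)
    qed
  qed
  note main = this
  have "0 < m1"
    using m0(1) m by (simp add: m1_def)
  then show thesis
    by (rule that[of m1 "9 * L"]) (rule main)
qed

end

section \<open>Words in well-spread elements\<close>

definition word_prod :: "('a \<Rightarrow> 'a) list \<Rightarrow> 'a \<Rightarrow> 'a" where
  "word_prod w = foldr (\<circ>) w id"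

lemma word_prod_simps [simp]:
  "word_prod [] = id" "word_prod (t # w) = t \<circ> word_prod w"
  by (simp_all add: word_prod_def)

lemma word_prod_append: "word_prod (u @ w) = word_prod u \<circ> word_prod w"
  by (induction u) (simp_all add: comp_assoc)

text \<open>Each letter \<open>t\<close> carries the translate \<open>t ` Y\<close> of the axis, which is seen from \<open>x0\<close> near its entry point
  and far from its exit point \<open>t x0\<close>; so the geodesic from \<open>x0\<close> to the end of a word follows the word.\<close>

locale spread_alphabet = contracting_axis +
  fixes T :: "('a \<Rightarrow> 'a) set" and \<alpha> \<Lambda> :: real
  assumes T_G: "t \<in> T \<Longrightarrow> t \<in> G"
    and T_noncomm: "t \<in> T \<Longrightarrow> t \<notin> commensurating"
    and T_start: "t \<in> T \<Longrightarrow> z \<in> proj (t x0) \<Longrightarrow> dist x0 z \<le> \<alpha>"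
    and T_end: "t \<in> T \<Longrightarrow> z \<in> proj (ginv t x0) \<Longrightarrow> \<Lambda> \<le> dist x0 z"
    and \<alpha>_nonneg: "0 \<le> \<alpha>"
    and \<Lambda>_large: "10 * (\<alpha> + overlap_bound + 12 * C) + 100 * C + 2 \<le> \<Lambda>"
begin

abbreviation words :: "('a \<Rightarrow> 'a) list set" where "words \<equiv> lists T"

text \<open>Every letter restores the bound \<open>\<rho>\<close>. The larger \<open>\<rho>'\<close>
  exceeds it by \<open>6 * C\<close>, the threshold of \<open>near_proj\<close>: a geodesic from a
  point projecting beyond \<open>\<rho>'\<close> to a point of \<open>visible \<rho>\<close> must
  pass near the projection of the latter.\<close>

abbreviation \<rho> :: real where "\<rho> \<equiv> \<alpha> + overlap_bound + 6 * C"

abbreviation \<rho>' :: real where "\<rho>' \<equiv> \<alpha> + overlap_bound + 12 * C"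

definition visible :: "real \<Rightarrow> 'a set" where
  "visible r = {x. \<forall>z\<in>proj x. dist x0 z \<le> r}"

lemma visible_mono: "x \<in> visible r \<Longrightarrow> r \<le> r' \<Longrightarrow> x \<in> visible r'"
  unfolding visible_def by force

lemma x0_visible: "0 \<le> r \<Longrightarrow> x0 \<in> visible r"
  unfolding visible_def using nearest_proj_self[OF x0_Y] by force

lemma x0_visible_\<rho>: "x0 \<in> visible \<rho>"
  using overlap_bound_pos C_pos \<alpha>_nonneg by (intro x0_visible) linarith

lemma word_prod_G: "w \<in> words \<Longrightarrow> word_prod w \<in> G"
proof (induction w)
  case Nil
  show ?case
    unfolding word_prod_simps by (rule id_mem)
next
  case (Cons t w)
  then have "t \<in> G" "word_prod w \<in> G"
    using T_G by simp_all
  then show ?case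
    unfolding word_prod_simps by (rule comp_mem)
qed

text \<open>The ping-pong step. The projection of \<open>x\<close> is near \<open>x0\<close>, that
  of \<open>ginv t x0\<close> is at least \<open>\<Lambda>\<close> away, so by
  \<open>translate_proj\<close> the projection of \<open>t x\<close> is near that of
  \<open>t x0\<close>. The bound improves from \<open>\<rho>'\<close> to \<open>\<rho>\<close>, so
  the step can be iterated along a word.\<close>

lemma letter_visible:
  assumes t: "t \<in> T" and x: "x \<in> visible \<rho>'"
  shows "t x \<in> visible \<rho>"
  unfolding visible_def
proof (intro CollectI ballI)
  fix z assume z: "z \<in> proj (t x)"
  obtain w where w: "w \<in> proj x"
    using nearest_proj_exists[OF closed_Y Y_ne] .
  obtain z0 where z0: "z0 \<in> proj (t x0)"
    using nearest_proj_exists[OF closed_Y Y_ne] .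
  obtain v0 where v0: "v0 \<in> proj (ginv t x0)"
    using nearest_proj_exists[OF closed_Y Y_ne] .
  have "dist x0 w \<le> \<rho>'"
    using x w unfolding visible_def by blast
  moreover have "dist x0 v0 \<le> dist x0 w + dist w v0"
    by metric
  ultimately have "24 * C + overlap_bound < dist w v0"
    using T_end[OF t v0] \<Lambda>_large overlap_bound_pos \<alpha>_nonneg C_pos by argo
  then have "dist z z0 \<le> 6 * C + overlap_bound"
    by (rule translate_proj[OF T_G[OF t] T_noncomm[OF t] w z v0 z0])
  moreover have "dist x0 z \<le> dist x0 z0 + dist z z0"
    by metric
  ultimately show "dist x0 z \<le> \<rho>"
    using T_start[OF t z0] by linarith
qed

lemma word_visible:
  assumes "w \<in> words" "x \<in> visible \<rho>"
  shows "word_prod w x \<in> visible \<rho>"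
  using assms(1)
proof (induction w)
  case Nil
  then show ?case
    using assms(2) by simp
next
  case (Cons t w)
  then have "word_prod w x \<in> visible \<rho>'"
    using C_pos by (intro visible_mono[of _ \<rho> \<rho>']) auto
  then show ?case
    using letter_visible Cons.hyps by simp
qed

text \<open>Ping-pong for the inverse letters, with the roles of start and end exchanged:
  \<open>t x0\<close> projects near \<open>x0\<close>, so a point projecting far away is sent near
  the projection of \<open>ginv t x0\<close>.\<close>

lemma letter_back:
  assumes t: "t \<in> T" and far: "\<And>z. z \<in> proj x \<Longrightarrow> \<Lambda> - \<rho> \<le> dist x0 z" and z: "z \<in> proj (ginv t x)"
  shows "\<Lambda> - \<rho> \<le> dist x0 z"
proof -
  note tG = T_G[OF t]
  obtain w where w: "w \<in> proj x"
    using nearest_proj_exists[OF closed_Y Y_ne] .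
  obtain z0 where z0: "z0 \<in> proj (t x0)"
    using nearest_proj_exists[OF closed_Y Y_ne] .
  then have z0': "z0 \<in> proj (ginv (ginv t) x0)"
    using tG by simp
  obtain v0 where v0: "v0 \<in> proj (ginv t x0)"
    using nearest_proj_exists[OF closed_Y Y_ne] .
  have "dist x0 w \<le> dist x0 z0 + dist w z0"
    by metric
  then have "24 * C + overlap_bound < dist w z0"
    using far[OF w] T_start[OF t z0] \<Lambda>_large overlap_bound_pos \<alpha>_nonneg C_pos by argo
  then have "dist z v0 \<le> 6 * C + overlap_bound"
    by (rule translate_proj[OF inverse_mem[OF tG] not_commensurating_ginv[OF tG T_noncomm[OF t]] w z z0' v0])
  moreover have "dist x0 v0 \<le> dist x0 z + dist z v0"
    by metric
  ultimately show ?thesis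
    using T_end[OF t v0] \<alpha>_nonneg by linarith
qed

lemma word_back:
  assumes "w \<in> words" "w \<noteq> []" "z \<in> proj (ginv (word_prod w) x0)"
  shows "\<Lambda> - \<rho> \<le> dist x0 z"
  using assms
proof (induction w arbitrary: z rule: rev_induct)
  case (snoc t w)
  then have t: "t \<in> T" and w: "w \<in> words"
    by auto
  have eq: "ginv (word_prod (w @ [t])) x0 = ginv t (ginv (word_prod w) x0)"
    using ginv_mult[OF word_prod_G[OF w] T_G[OF t]] by (simp add: word_prod_append)
  show ?case
  proof (cases "w = []")
    case True
    have "\<Lambda> \<le> dist x0 z"
      using snoc.prems(3) True t by (intro T_end[OF t]) simp
    then show ?thesis
      using overlap_bound_pos \<alpha>_nonneg C_pos by linarith
  next
    case False
    show ?thesis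
      using snoc.IH[OF w False] snoc.prems(3) unfolding eq by (rule letter_back[OF t])
  qed
qed simp

text \<open>Translate back by the word. Its inverse takes \<open>x0\<close> to a point that projects
  far away by \<open>word_back\<close>, whereas \<open>x\<close> projects near \<open>x0\<close>; so
  the geodesic between them passes near the projection of \<open>x\<close>.\<close>

lemma geodesic_passes_word:
  assumes w: "w \<in> words" and x: "x \<in> visible \<rho>'" and S: "geodesic_segment x0 (word_prod w x) S"
  shows "\<exists>s\<in>S. dist s (word_prod w x0) \<le> 8 * C + \<rho>'"
proof (cases "w = []")
  case True
  have "0 \<le> 8 * C + \<rho>'"
    using overlap_bound_pos \<alpha>_nonneg C_pos by linarith
  then show ?thesis
    using geodesic_segment_ends(1)[OF S] True by (intro bexI[of _ x0]) auto
next
  case False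
  define g where "g = word_prod w"
  have g: "g \<in> G"
    unfolding g_def by (rule word_prod_G[OF w])
  have S': "geodesic_segment (ginv g x0) x (ginv g ` S)"
    using geodesic_segment_image[OF S isometry[OF inverse_mem[OF g]]] g by (simp add: g_def)
  obtain z where z: "z \<in> proj x"
    using nearest_proj_exists[OF closed_Y Y_ne] .
  obtain z' where z': "z' \<in> proj (ginv g x0)"
    using nearest_proj_exists[OF closed_Y Y_ne] .
  have zd: "dist x0 z \<le> \<rho>'"
    using x z unfolding visible_def by blast
  have "\<Lambda> - \<rho> \<le> dist x0 z'"
    using word_back[OF w False] z' by (simp add: g_def)
  moreover have "dist x0 z' \<le> dist x0 z + dist z' z"
    by metric
  ultimately have "6 * C < dist z' z"
    using zd \<Lambda>_large overlap_bound_pos \<alpha>_nonneg C_pos by argo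
  then obtain u where u: "u \<in> ginv g ` S" "dist u z \<le> 8 * C"
    using near_proj'[OF z' z _ S'] by blast
  then obtain s where s: "s \<in> S" "u = ginv g s"
    by blast
  have "dist s (g x0) = dist u x0"
    unfolding s(2) by (simp add: dist_ginv g)
  also have "\<dots> \<le> dist u z + dist x0 z"
    by metric
  finally have "dist s (g x0) \<le> 8 * C + \<rho>'"
    using u(2) zd by linarith
  then show ?thesis
    using s(1) unfolding g_def by blast
qed

lemma letter_long: "t \<in> T \<Longrightarrow> \<Lambda> \<le> 2 * dist x0 (t x0)"
proof -
  assume t: "t \<in> T"
  obtain z where z: "z \<in> proj (ginv t x0)"
    using nearest_proj_exists[OF closed_Y Y_ne] .
  have "dist x0 z \<le> 2 * dist (ginv t x0) x0"
    by (rule nearest_proj_dist2[OF z x0_Y])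
  then show ?thesis
    using T_end[OF t z] by (simp add: dist_ginv T_G[OF t])
qed

text \<open>Passing near \<open>t x0\<close> costs at most twice \<open>8 * C + \<rho>'\<close>, and
  a letter has length at least \<open>\<Lambda> / 2\<close>, so each letter gains at least
  \<open>1\<close>.\<close>

lemma length_le_word:
  assumes "w \<in> words"
  shows "real (length w) \<le> dist x0 (word_prod w x0)"
  using assms
proof (induction w)
  case (Cons t w)
  then have t: "t \<in> T" and w: "w \<in> words"
    by auto
  let ?x = "word_prod w x0"
  have vis: "?x \<in> visible \<rho>'"
    using word_visible[OF w x0_visible_\<rho>] C_pos by (auto elim: visible_mono)
  obtain S where S: "geodesic_segment x0 (t ?x) S"
    by (rule geodesic_ex)
  obtain s where s: "s \<in> S" "dist s (t x0) \<le> 8 * C + \<rho>'"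
    using geodesic_passes_word[of "[t]" ?x S] t vis S by auto
  have "dist x0 s + dist s (t ?x) = dist x0 (t ?x)"
    by (rule geodesic_segment_dist[OF S s(1)])
  moreover have "dist x0 (t x0) \<le> dist x0 s + dist s (t x0)" "dist (t x0) (t ?x) \<le> dist s (t x0) + dist s (t ?x)"
    by metric+
  moreover have "dist (t x0) (t ?x) = dist x0 ?x"
    by (rule isometry[OF T_G[OF t]])
  ultimately have "dist x0 ?x + 1 \<le> dist x0 (t ?x)"
    using s(2) letter_long[OF t] \<Lambda>_large overlap_bound_pos \<alpha>_nonneg C_pos by argo
  then show ?case
    using Cons.IH by simp
qed simp

text \<open>The last prefix after which \<open>h x0\<close> is still visible is about half way to \<open>h x0\<close>, since
  \<open>h x0\<close> and \<open>x0\<close> are at about the same distance from the end of the word.\<close>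

lemma shadow:
  assumes w: "w \<in> words" and h: "\<And>x y. dist (h x) (h y) = dist x y"
    and D: "dist (word_prod w x0) (h (word_prod w x0)) \<le> D"
    and S: "geodesic_segment x0 (h x0) S" and L: "\<And>t. t \<in> T \<Longrightarrow> dist x0 (t x0) \<le> L" "0 \<le> L"
  shows "\<exists>j\<le>length w. (\<forall>i\<le>j. \<exists>s\<in>S. dist s (word_prod (take i w) x0) \<le> 8 * C + \<rho>') \<and>
      dist x0 (h x0) \<le> 2 * dist x0 (word_prod (take j w) x0) + (2 * L + D + 16 * C + 2 * \<rho>)"
proof -
  let ?y = "h x0"
  let ?m = "length w"
  define p where "p = (\<lambda>i. word_prod (take i w))"
  have takew: "take i w \<in> words" for i
    using w set_take_subset[of i w] by (auto simp: in_lists_conv_set dest: in_set_takeD)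
  have pG: "p i \<in> G" for i
    unfolding p_def by (rule word_prod_G[OF takew])
  have pS: "p (Suc i) = p i \<circ> w ! i" if "i < ?m" for i
    using that by (simp add: p_def take_Suc_conv_app_nth word_prod_append)
  define J where "J = {j. j \<le> ?m \<and> (j = 0 \<or> ginv (p j) ?y \<in> visible \<rho>')}"
  define j where "j = Max J"
  have "finite J" "0 \<in> J"
    by (auto simp: J_def intro: finite_subset[of _ "{..?m}"])
  then have jJ: "j \<in> J"
    unfolding j_def by (intro Max_in) auto
  have down: "i = 0 \<or> ginv (p i) ?y \<in> visible \<rho>'" if "i \<le> j" for i
    using that
  proof (induction i rule: inc_induct)
    case base
    then show ?case
      using jJ by (simp add: J_def)
  next
    case (step n)
    then have nm: "n < ?m"
      using jJ by (auto simp: J_def)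
    then have wT: "w ! n \<in> T"
      using w by auto
    have "ginv (p (Suc n)) ?y = ginv (w ! n) (ginv (p n) ?y)"
      using pS[OF nm] ginv_mult[OF pG T_G[OF wT]] by simp
    then have "ginv (p n) ?y = (w ! n) (ginv (p (Suc n)) ?y)"
      using T_G[OF wT] by simp
    moreover have "ginv (p (Suc n)) ?y \<in> visible \<rho>'"
      using step by simp
    ultimately have "ginv (p n) ?y \<in> visible \<rho>"
      using letter_visible[OF wT] by simp
    then have "ginv (p n) ?y \<in> visible \<rho>'"
      by (rule visible_mono) (use C_pos in linarith)
    then show ?case ..
  qed
  have near: "\<exists>s\<in>S. dist s (p i x0) \<le> 8 * C + \<rho>'" if "i \<le> j" for i
    using down[OF that]
  proof
    assume "i = 0"
    have "0 \<le> 8 * C + \<rho>'"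
      using overlap_bound_pos \<alpha>_nonneg C_pos by linarith
    then show ?thesis
      using geodesic_segment_ends(1)[OF S] \<open>i = 0\<close> by (intro bexI[of _ x0]) (auto simp: p_def)
  next
    assume "ginv (p i) ?y \<in> visible \<rho>'"
    then show ?thesis
      using geodesic_passes_word[OF takew[of i], of "ginv (p i) ?y" S] S pG[of i] by (simp add: p_def)
  qed
  have nonneg: "0 \<le> C" "0 \<le> \<rho>"
    using overlap_bound_pos \<alpha>_nonneg C_pos by linarith+
  have end_close: "dist ?y (p ?m x0) \<le> D + dist x0 (p ?m x0)"
  proof -
    have "dist ?y (p ?m x0) \<le> dist ?y (h (p ?m x0)) + dist (p ?m x0) (h (p ?m x0))"
      by metric
    then show ?thesis
      using D h[of x0 "p ?m x0"] by (simp add: p_def)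
  qed
  have "dist x0 ?y \<le> 2 * dist x0 (p j x0) + (2 * L + D + 16 * C + 2 * \<rho>)"
  proof (cases "j = ?m")
    case True
    have "dist x0 ?y \<le> dist x0 (p ?m x0) + dist ?y (p ?m x0)"
      by metric
    then show ?thesis
      using end_close L(2) nonneg unfolding True by argo
  next
    case False
    then have jm: "j < ?m"
      using jJ by (simp add: J_def)
    then have wT: "w ! j \<in> T"
      using w by auto
    let ?g = "p (Suc j)"
    have "Suc j \<notin> J"
      using Max_ge[OF \<open>finite J\<close>, of "Suc j"] by (auto simp: j_def)
    then have "ginv ?g ?y \<notin> visible \<rho>'"
      using jm by (simp add: J_def)
    \<comment> \<open>In the frame of \<open>?g\<close> the point \<open>h x0\<close> projects
      beyond \<open>\<rho>'\<close>, the end of the word within \<open>\<rho>\<close>. Hence the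
      geodesic joining them passes near \<open>?g x0\<close>, which is one letter, of length at most
      \<open>L\<close>, beyond the prefix \<open>j\<close>.\<close>
    then obtain z where z: "z \<in> proj (ginv ?g ?y)" "\<rho>' < dist x0 z"
      unfolding visible_def by (auto simp: not_le)
    have split: "p ?m = ?g \<circ> word_prod (drop (Suc j) w)"
      unfolding p_def by (simp flip: word_prod_append)
    define v where "v = word_prod (drop (Suc j) w) x0"
    have "drop (Suc j) w \<in> words"
      using w by (auto dest: in_set_dropD)
    then have "v \<in> visible \<rho>"
      unfolding v_def using word_visible x0_visible_\<rho> by blast
    obtain z' where z': "z' \<in> proj v"
      using nearest_proj_exists[OF closed_Y Y_ne] .
    then have z'd: "dist x0 z' \<le> \<rho>"
      using \<open>v \<in> visible \<rho>\<close> unfolding visible_def by blast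
    have "dist x0 z \<le> dist x0 z' + dist z z'"
      by metric
    then have far: "6 * C < dist z z'"
      using z(2) z'd by linarith
    obtain S' where S': "geodesic_segment (ginv ?g ?y) v S'"
      by (rule geodesic_ex)
    obtain u where u: "u \<in> S'" "dist u z' \<le> 8 * C"
      using near_proj'[OF z(1) z' far S'] by blast
    have "dist (ginv ?g ?y) u + dist u v = dist (ginv ?g ?y) v"
      by (rule geodesic_segment_dist[OF S' u(1)])
    moreover have "dist u x0 \<le> dist u z' + dist x0 z'"
      by metric
    moreover have "dist (ginv ?g ?y) x0 \<le> dist (ginv ?g ?y) u + dist u x0" "dist x0 v \<le> dist u x0 + dist u v"
      by metric+
    ultimately have a: "dist (ginv ?g ?y) x0 + dist x0 v \<le> dist (ginv ?g ?y) v + 16 * C + 2 * \<rho>"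
      using u(2) z'd by argo
    have gv: "?g v = p ?m x0"
      using split by (simp add: v_def)
    have "dist ?y (?g x0) + dist (?g x0) (p ?m x0) \<le> dist ?y (p ?m x0) + 16 * C + 2 * \<rho>"
      using a by (simp add: dist_ginv pG isometry[OF pG] flip: gv)
    moreover have "dist x0 (p ?m x0) \<le> dist x0 (?g x0) + dist (?g x0) (p ?m x0)"
      by metric
    moreover have "dist x0 ?y \<le> dist x0 (?g x0) + dist ?y (?g x0)"
      by metric
    ultimately have "dist x0 ?y \<le> 2 * dist x0 (?g x0) + D + 16 * C + 2 * \<rho>"
      using end_close by argo
    moreover have "dist x0 (?g x0) \<le> dist x0 (p j x0) + L"
    proof -
      have "dist x0 (?g x0) \<le> dist x0 (p j x0) + dist (p j x0) (p j ((w ! j) x0))"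
        unfolding pS[OF jm] comp_apply by metric
      then show ?thesis
        using L(1)[OF wT] isometry[OF pG] by simp
    qed
    ultimately show ?thesis
      by argo
  qed
  then show ?thesis
    using near jJ unfolding p_def J_def by blast
qed

end

section \<open>Random words\<close>

locale random_words =
  fixes T :: "'l set" and q :: "'l \<Rightarrow> real"
  assumes finite_T: "finite T" and q_pos: "t \<in> T \<Longrightarrow> 0 < q t" and q_sum: "sum q T = 1"
begin

definition weight :: "'l list \<Rightarrow> real" where
  "weight w = prod_list (map q w)"

definition level :: "nat \<Rightarrow> 'l list set" where
  "level m = {w \<in> lists T. length w = m}"

text \<open>Only words of a fixed length are sampled, so expectations are finite sums;
  \<open>expect_take\<close> relates different lengths.\<close>

definition expect :: "nat \<Rightarrow> ('l list \<Rightarrow> real) \<Rightarrow> real" where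
  "expect m f = (\<Sum>w\<in>level m. weight w * f w)"

definition prob :: "nat \<Rightarrow> ('l list \<Rightarrow> bool) \<Rightarrow> real" where
  "prob m Q = expect m (\<lambda>w. of_bool (Q w))"

lemma weight_simps [simp]: "weight [] = 1" "weight (t # w) = q t * weight w"
  "weight (u @ w) = weight u * weight w"
  by (simp_all add: weight_def)

lemma weight_nonneg: "w \<in> lists T \<Longrightarrow> 0 \<le> weight w"
  by (induction w) (auto simp: q_pos less_imp_le)

lemma finite_level: "finite (level m)"
  using finite_lists_length_eq[OF finite_T, of m] by (simp add: level_def lists_eq_set)

lemma level_0: "level 0 = {[]}"
  by (auto simp: level_def)

lemma level_lists: "w \<in> level m \<Longrightarrow> w \<in> lists T"
  by (simp add: level_def)

lemma level_snoc: "u \<in> level m \<Longrightarrow> t \<in> T \<Longrightarrow> u @ [t] \<in> level (Suc m)"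
  by (simp add: level_def)

lemma level_Suc: "level (Suc m) = (\<lambda>(u, t). u @ [t]) ` (level m \<times> T)"
proof (intro equalityI subsetI)
  fix w assume w: "w \<in> level (Suc m)"
  then have "w \<noteq> []"
    by (auto simp: level_def)
  then have "w = butlast w @ [last w]"
    by simp
  moreover have "last w \<in> T" "butlast w \<in> level m"
    using w \<open>w \<noteq> []\<close> by (auto simp: level_def dest: in_set_butlastD)
  ultimately show "w \<in> (\<lambda>(u, t). u @ [t]) ` (level m \<times> T)"
    by force
qed (auto simp: level_snoc)

lemma expect_Suc: "expect (Suc m) f = expect m (\<lambda>u. \<Sum>t\<in>T. q t * f (u @ [t]))"
proof -
  have "expect (Suc m) f = (\<Sum>(u, t)\<in>level m \<times> T. weight (u @ [t]) * f (u @ [t]))"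
    unfolding expect_def level_Suc
    by (subst sum.reindex) (auto simp: inj_on_def case_prod_unfold)
  also have "\<dots> = (\<Sum>u\<in>level m. \<Sum>t\<in>T. weight (u @ [t]) * f (u @ [t]))"
    by (rule sum.cartesian_product[symmetric])
  also have "\<dots> = expect m (\<lambda>u. \<Sum>t\<in>T. q t * f (u @ [t]))"
    unfolding expect_def by (simp add: sum_distrib_left mult.assoc)
  finally show ?thesis .
qed

lemma expect_mono: "(\<And>w. w \<in> level m \<Longrightarrow> f w \<le> g w) \<Longrightarrow> expect m f \<le> expect m g"
  unfolding expect_def by (intro sum_mono mult_left_mono weight_nonneg level_lists)

lemma expect_cong: "(\<And>w. w \<in> level m \<Longrightarrow> f w = g w) \<Longrightarrow> expect m f = expect m g"
  unfolding expect_def by (intro sum.cong) auto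

lemma expect_add: "expect m (\<lambda>w. f w + g w) = expect m f + expect m g"
  by (simp add: expect_def distrib_left sum.distrib)

lemma expect_cmult: "expect m (\<lambda>w. r * f w) = r * expect m f"
  by (simp add: expect_def sum_distrib_left mult.left_commute)

lemma expect_sum: "expect m (\<lambda>w. \<Sum>i\<in>I. f i w) = (\<Sum>i\<in>I. expect m (f i))"
  unfolding expect_def sum_distrib_left by (rule sum.swap)

text \<open>The weights of all continuations of a prefix add up to the weight of the prefix, because
  \<open>q\<close> sums to \<open>1\<close>.\<close>

lemma expect_take: "expect (j + d) (\<lambda>w. f (take j w)) = expect j f"
proof (induction d)
  case 0
  show ?case
    unfolding add_0_right by (rule expect_cong) (simp add: level_def)
next
  case (Suc d)
  have "expect (j + Suc d) (\<lambda>w. f (take j w)) =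
      expect (j + d) (\<lambda>u. \<Sum>t\<in>T. q t * f (take j (u @ [t])))"
    by (simp add: expect_Suc)
  also have "\<dots> = expect (j + d) (\<lambda>u. f (take j u))"
  proof (rule expect_cong)
    fix u assume "u \<in> level (j + d)"
    then have "(\<Sum>t\<in>T. q t * f (take j (u @ [t]))) = (\<Sum>t\<in>T. q t) * f (take j u)"
      by (simp add: level_def sum_distrib_right)
    then show "(\<Sum>t\<in>T. q t * f (take j (u @ [t]))) = f (take j u)"
      by (simp add: q_sum)
  qed
  finally show ?case
    using Suc by simp
qed

lemma prob_take: "j \<le> m \<Longrightarrow> prob m (\<lambda>w. Q (take j w)) = prob j Q"
  using expect_take[of j "m - j" "\<lambda>w. of_bool (Q w)"] by (simp add: prob_def)

lemma prob_nonneg: "0 \<le> prob m Q"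
  unfolding prob_def expect_def by (intro sum_nonneg mult_nonneg_nonneg weight_nonneg level_lists) auto

lemma prob_mono: "(\<And>w. w \<in> level m \<Longrightarrow> Q w \<Longrightarrow> Q' w) \<Longrightarrow> prob m Q \<le> prob m Q'"
  unfolding prob_def by (rule expect_mono) auto

lemma prob_True: "prob m (\<lambda>w. True) = 1"
proof -
  have "prob m (\<lambda>w. True) = prob 0 (\<lambda>w. True)"
    using prob_take[of 0 m "\<lambda>w. True"] by simp
  then show ?thesis
    by (simp add: prob_def expect_def level_0)
qed

lemma prob_disj_le: "prob m (\<lambda>w. Q w \<or> Q' w) \<le> prob m Q + prob m Q'"
  unfolding prob_def expect_add[symmetric] by (rule expect_mono) auto

lemma prob_Bex_le:
  assumes "finite I"
  shows "prob m (\<lambda>w. \<exists>i\<in>I. Q i w) \<le> (\<Sum>i\<in>I. prob m (Q i))"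
  unfolding prob_def expect_sum[symmetric]
proof (rule expect_mono)
  fix w
  show "of_bool (\<exists>i\<in>I. Q i w) \<le> (\<Sum>i\<in>I. of_bool (Q i w) :: real)"
  proof (cases "\<exists>i\<in>I. Q i w")
    case True
    then obtain i where i: "i \<in> I" "Q i w"
      by blast
    have "(of_bool (Q i w) :: real) \<le> (\<Sum>i\<in>I. of_bool (Q i w))"
      by (rule member_le_sum[OF i(1)]) (auto simp: assms)
    then show ?thesis
      using i by auto
  next
    case False
    then show ?thesis
      by (auto intro: sum_nonneg)
  qed
qed

lemma prob_eq_sum: "prob m Q = (\<Sum>w\<in>{w \<in> level m. Q w}. weight w)"
  unfolding prob_def expect_def
  by (intro sum.mono_neutral_cong_right) (auto simp: finite_level)

text \<open>Suppose that each occurrence of the label \<open>h\<close> has a next letter after which \<open>h\<close> eventually dies out.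
  Each visit of \<open>h\<close> is then followed by this letter with probability bounded below, and after that only
  boundedly many levels can carry \<open>h\<close>; so the probability of seeing \<open>h\<close> tends to zero.\<close>

lemma prob_label_tendsto_0:
  fixes \<phi> :: "'l list \<Rightarrow> 'h"
  assumes kill: "\<And>v. v \<in> lists T \<Longrightarrow> \<phi> v = h \<Longrightarrow> a v \<in> T"
    "\<And>v u. v \<in> lists T \<Longrightarrow> u \<in> lists T \<Longrightarrow> \<phi> v = h \<Longrightarrow> M v \<le> length u \<Longrightarrow> \<phi> (v @ a v # u) \<noteq> h"
  shows "(\<lambda>m. prob m (\<lambda>w. \<phi> w = h)) \<longlonglongrightarrow> 0"
proof -
  have "T \<noteq> {}"
    using q_sum by auto
  define q0 where "q0 = Min (q ` T)"
  have q0: "0 < q0" "\<And>t. t \<in> T \<Longrightarrow> q0 \<le> q t"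
    using finite_T \<open>T \<noteq> {}\<close> q_pos by (auto simp: q0_def)
  \<comment> \<open>A word dies when a prefix \<open>v\<close> labelled \<open>h\<close> is followed
    by its fatal letter \<open>a v\<close>, and it stays dead under extension.\<close>
  define dead where "dead = (\<lambda>w. \<exists>v u. w = v @ a v # u \<and> \<phi> v = h)"
  have dead_append: "dead (w @ u)" if d: "dead w" for w u
  proof -
    obtain v u' where "w = v @ a v # u'" "\<phi> v = h"
      using d unfolding dead_def by blast
    then have "w @ u = v @ a v # (u' @ u)" "\<phi> v = h"
      by simp_all
    then show ?thesis
      unfolding dead_def by blast
  qed
  have dead_take: "dead w" if "dead (take k w)" for k w
    using dead_append[OF that, of "drop k w"] by simp
  \<comment> \<open>The survival probability decreases to a limit, so its decrements tend to zero;
    \<open>step\<close> bounds the probability of a living word labelled \<open>h\<close> by such a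
    decrement.\<close>
  define x where "x = (\<lambda>m. prob m (\<lambda>w. \<not> dead w))"
  have x_take: "prob m (\<lambda>w. \<not> dead (take k w)) = x k" if "k \<le> m" for k m
    using prob_take[OF that, of "\<lambda>w. \<not> dead w"] by (simp add: x_def)
  have "decseq x"
  proof (rule decseq_SucI)
    fix m
    have "x (Suc m) \<le> prob (Suc m) (\<lambda>w. \<not> dead (take m w))"
      unfolding x_def by (rule prob_mono) (use dead_take in blast)
    then show "x (Suc m) \<le> x m"
      using x_take[of m "Suc m"] by simp
  qed
  moreover have "0 \<le> x m" for m
    unfolding x_def by (rule prob_nonneg)
  ultimately obtain l where l: "x \<longlonglongrightarrow> l" "\<And>m. l \<le> x m"
    using decseq_convergent[of x 0] by blast
  have step: "q0 * prob m (\<lambda>w. \<phi> w = h \<and> \<not> dead w) \<le> x m - x (Suc m)" for m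
  proof -
    have "x (Suc m) = expect m (\<lambda>u. \<Sum>t\<in>T. q t * of_bool (\<not> dead (u @ [t])))"
      by (simp add: x_def prob_def expect_Suc)
    also have "\<dots> \<le> expect m (\<lambda>u. of_bool (\<not> dead u) + (- q0) * of_bool (\<phi> u = h \<and> \<not> dead u))"
    proof (rule expect_mono)
      fix u assume u: "u \<in> level m"
      have le: "(\<Sum>t\<in>T. q t * of_bool (\<not> dead (u @ [t]))) \<le> (\<Sum>t\<in>T. q t)"
        by (rule sum_mono) (auto simp: q_pos less_imp_le)
      show "(\<Sum>t\<in>T. q t * of_bool (\<not> dead (u @ [t]))) \<le> of_bool (\<not> dead u) + (- q0) * of_bool (\<phi> u = h \<and> \<not> dead u)"
      proof (cases "dead u")
        case True
        then show ?thesis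
          using dead_append by simp
      next
        case nd: False
        show ?thesis
        proof (cases "\<phi> u = h")
          case True
          have aT: "a u \<in> T"
            using kill(1)[OF level_lists[OF u] True] .
          have "dead (u @ [a u])"
            using True unfolding dead_def by blast
          then have "(\<Sum>t\<in>T. q t * of_bool (\<not> dead (u @ [t]))) = (\<Sum>t\<in>T - {a u}. q t * of_bool (\<not> dead (u @ [t])))"
            using finite_T by (simp add: sum.remove[OF finite_T aT])
          also have "\<dots> \<le> (\<Sum>t\<in>T - {a u}. q t)"
            by (rule sum_mono) (auto simp: q_pos less_imp_le)
          also have "\<dots> = 1 - q (a u)"
            using sum.remove[OF finite_T aT, of q] q_sum by simp
          finally show ?thesis
            using q0(2)[OF aT] nd True by simp
        next
          case False
          then show ?thesis
            using le nd q_sum by simp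
        qed
      qed
    qed
    also have "\<dots> = x m - q0 * prob m (\<lambda>w. \<phi> w = h \<and> \<not> dead w)"
      unfolding expect_add expect_cmult by (simp add: x_def prob_def)
    finally show ?thesis
      by simp
  qed
  \<comment> \<open>Only finitely many prefixes \<open>v\<close> of length at most \<open>k\<close>
    are concerned, so their thresholds \<open>M v\<close> have a maximum.\<close>
  have extinct: "\<exists>N. \<forall>m\<ge>N. \<forall>w\<in>level m. dead (take k w) \<longrightarrow> \<phi> w \<noteq> h" for k
  proof -
    define S where "S = {v. set v \<subseteq> T \<and> length v \<le> k}"
    have "finite S"
      unfolding S_def by (rule finite_lists_length_le[OF finite_T])
    show ?thesis
    proof (intro exI[of _ "Suc k + Max (insert 0 (M ` S))"] allI impI ballI)
      fix m w
      assume m: "Suc k + Max (insert 0 (M ` S)) \<le> m" and w: "w \<in> level m" and d: "dead (take k w)"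
      obtain v u where vu: "take k w = v @ a v # u" "\<phi> v = h"
        using d unfolding dead_def by blast
      have "v @ a v # (u @ drop k w) = w"
        using append_take_drop_id[of k w] unfolding vu(1) by simp
      then have "\<exists>r. w = v @ a v # r"
        by (intro exI[of _ "u @ drop k w"]) (rule sym)
      then obtain r where w_eq: "w = v @ a v # r" ..
      have len: "length v + Suc (length r) = m"
        using w arg_cong[OF w_eq, of length] by (simp add: level_def)
      have "set w \<subseteq> T"
        using w by (auto simp: level_def)
      moreover have "set w = set v \<union> insert (a v) (set r)"
        using arg_cong[OF w_eq, of set] by simp
      ultimately have sets: "set v \<subseteq> T" "set r \<subseteq> T"
        by auto
      have "length v \<le> k"
        using arg_cong[OF vu(1), of length] by simp
      then have "v \<in> S"
        using sets unfolding S_def by simp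
      then have "M v \<le> Max (insert 0 (M ` S))"
        using \<open>finite S\<close> by simp
      then have "M v \<le> length r"
        using len m \<open>length v \<le> k\<close> by linarith
      then have "\<phi> (v @ a v # r) \<noteq> h"
        using sets vu(2) by (intro kill(2)) (auto simp: lists_eq_set)
      then show "\<phi> w \<noteq> h"
        using w_eq by simp
    qed
  qed
  show ?thesis
  proof (rule LIMSEQ_I)
    fix r :: real assume r: "0 < r"
    \<comment> \<open>Solves \<open>e / q0 + e = r\<close>: the first term bounds the living words
      labelled \<open>h\<close>, the second those that die after time \<open>k\<close>.\<close>
    define e where "e = r * q0 / (1 + q0)"
    have e: "0 < e"
      using r q0 by (simp add: e_def)
    obtain k where k: "\<And>m. m \<ge> k \<Longrightarrow> \<bar>x m - l\<bar> < e"
      using LIMSEQ_D[OF l(1) e] by auto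
    obtain N where N: "\<And>m w. N \<le> m \<Longrightarrow> w \<in> level m \<Longrightarrow> dead (take k w) \<Longrightarrow> \<phi> w \<noteq> h"
      using extinct[of k] by blast
    have "norm (prob m (\<lambda>w. \<phi> w = h) - 0) < r" if m: "max k N \<le> m" for m
    proof -
      have "prob m (\<lambda>w. \<phi> w = h) \<le> prob m (\<lambda>w. (\<phi> w = h \<and> \<not> dead w) \<or> (dead w \<and> \<not> dead (take k w)))"
      proof (rule prob_mono)
        fix w assume w: "w \<in> level m" "\<phi> w = h"
        have "\<not> dead (take k w)"
          using N[OF _ w(1)] w(2) m by (metis max.bounded_iff)
        then show "(\<phi> w = h \<and> \<not> dead w) \<or> (dead w \<and> \<not> dead (take k w))"
          using w(2) by simp
      qed
      also have "\<dots> \<le> prob m (\<lambda>w. \<phi> w = h \<and> \<not> dead w) + prob m (\<lambda>w. dead w \<and> \<not> dead (take k w))"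
        by (rule prob_disj_le)
      also have "prob m (\<lambda>w. dead w \<and> \<not> dead (take k w)) = x k - x m"
      proof -
        have "prob m (\<lambda>w. \<not> dead (take k w)) = prob m (\<lambda>w. dead w \<and> \<not> dead (take k w)) + prob m (\<lambda>w. \<not> dead w)"
          unfolding prob_def expect_add[symmetric]
        proof (rule expect_cong)
          fix w
          show "of_bool (\<not> dead (take k w)) = (of_bool (dead w \<and> \<not> dead (take k w)) + of_bool (\<not> dead w) :: real)"
            using dead_take[of k w] by (cases "dead w"; cases "dead (take k w)") simp_all
        qed
        then show ?thesis
          using x_take[of k m] m by (simp add: x_def)
      qed
      also have "x k - x m < e"
        using k[of k] l(2)[of m] by linarith
      finally have 1: "prob m (\<lambda>w. \<phi> w = h) < prob m (\<lambda>w. \<phi> w = h \<and> \<not> dead w) + e"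
        by simp
      have "q0 * prob m (\<lambda>w. \<phi> w = h \<and> \<not> dead w) < e"
        using step[of m] k[of m] l(2)[of "Suc m"] m by linarith
      then have "prob m (\<lambda>w. \<phi> w = h \<and> \<not> dead w) < e / q0"
        using q0(1) by (simp add: pos_less_divide_eq mult.commute)
      then have "prob m (\<lambda>w. \<phi> w = h) < e / q0 + e"
        using 1 by linarith
      also have "\<dots> = (e * (1 + q0)) / q0"
        using q0(1) by (simp add: field_simps)
      also have "e * (1 + q0) = r * q0"
        using q0(1) by (simp add: e_def)
      also have "r * q0 / q0 = r"
        using q0(1) by simp
      finally show ?thesis
        using prob_nonneg[of m "\<lambda>w. \<phi> w = h"] by simp
    qed
    then show "\<exists>no. \<forall>m\<ge>no. norm (prob m (\<lambda>w. \<phi> w = h) - 0) < r"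
      by blast
  qed
qed

text \<open>Otherwise every \<open>h\<close> in \<open>A\<close> satisfies the assumptions of
  \<open>prob_label_tendsto_0\<close>, and the probability of the finite set \<open>A\<close> would
  tend to zero.\<close>

lemma recurrent_label:
  fixes \<phi> :: "'l list \<Rightarrow> 'h"
  assumes "finite A" and A: "\<And>m. 1 / 2 \<le> prob m (\<lambda>w. \<phi> w \<in> A)"
  shows "\<exists>v\<in>lists T. \<phi> v \<in> A \<and> (\<forall>t\<in>T. \<forall>M. \<exists>u\<in>lists T. M \<le> length u \<and> \<phi> (v @ t # u) = \<phi> v)"
proof (rule ccontr)
  assume neg: "\<not> ?thesis"
  have "\<exists>t M. t \<in> T \<and> (\<forall>u\<in>lists T. M \<le> length u \<longrightarrow> \<phi> (v @ t # u) \<noteq> \<phi> v)"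
    if "v \<in> lists T" "\<phi> v \<in> A" for v
    using neg that by blast
  then obtain a M where aM: "\<And>v. v \<in> lists T \<Longrightarrow> \<phi> v \<in> A \<Longrightarrow> a v \<in> T"
    "\<And>v u. v \<in> lists T \<Longrightarrow> \<phi> v \<in> A \<Longrightarrow> u \<in> lists T \<Longrightarrow> M v \<le> length u \<Longrightarrow> \<phi> (v @ a v # u) \<noteq> \<phi> v"
    by metis
  have "(\<lambda>m. prob m (\<lambda>w. \<phi> w = h)) \<longlonglongrightarrow> 0" if "h \<in> A" for h
    by (rule prob_label_tendsto_0[of \<phi> h a M]) (use aM that in auto)
  then have "(\<lambda>m. \<Sum>h\<in>A. prob m (\<lambda>w. \<phi> w = h)) \<longlonglongrightarrow> (\<Sum>h\<in>A. 0)"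
    by (intro tendsto_sum)
  moreover have "1 / 2 \<le> (\<Sum>h\<in>A. prob m (\<lambda>w. \<phi> w = h))" for m
    using A[of m] prob_Bex_le[OF assms(1), of m "\<lambda>h w. \<phi> w = h"] by simp
  ultimately have "1 / 2 \<le> (\<Sum>h\<in>A. 0 :: real)"
    by (intro LIMSEQ_le_const) auto
  then show False
    by simp
qed

end

text \<open>Tails of a Poincare series at an exponent above the growth of \<open>A\<close>. Grouping
  the points by the integer part of their distance compares the sum with a geometric series of ratio
  \<open>exp (\<sigma> - \<tau>)\<close>.\<close>

lemma sum_exp_small:
  fixes x0 :: "'a::metric_space" and \<sigma> \<tau> \<epsilon> :: real
  assumes count: "\<And>n. n1 \<le> n \<Longrightarrow> finite {y \<in> A. dist x0 y \<le> real n} \<and> real (card {y \<in> A. dist x0 y \<le> real n}) \<le> exp (\<sigma> * real n)"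
    and \<tau>: "\<sigma> < \<tau>" and "0 < \<tau>" and \<epsilon>: "0 < \<epsilon>"
  shows "\<exists>r. \<forall>B\<subseteq>A. finite B \<and> (\<forall>y\<in>B. r < dist x0 y) \<longrightarrow> (\<Sum>y\<in>B. exp (- \<tau> * dist x0 y)) < \<epsilon>"
proof -
  define \<theta> where "\<theta> = exp (\<sigma> - \<tau>)"
  have \<theta>: "0 < \<theta>" "\<theta> < 1"
    using \<tau> by (simp_all add: \<theta>_def)
  have "(\<lambda>n. exp \<sigma> * (\<theta> ^ n / (1 - \<theta>))) \<longlonglongrightarrow> exp \<sigma> * (0 / (1 - \<theta>))"
    using \<theta> by (intro tendsto_intros LIMSEQ_power_zero) auto
  then have "eventually (\<lambda>n. exp \<sigma> * (\<theta> ^ n / (1 - \<theta>)) < \<epsilon>) sequentially"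
    using \<epsilon> by (intro order_tendstoD(2)) auto
  then obtain n2 where n2: "\<And>n. n2 \<le> n \<Longrightarrow> exp \<sigma> * (\<theta> ^ n / (1 - \<theta>)) < \<epsilon>"
    by (auto simp: eventually_sequentially)
  define k where "k = max n1 n2"
  have "(\<Sum>y\<in>B. exp (- \<tau> * dist x0 y)) < \<epsilon>"
    if B: "B \<subseteq> A" "finite B" and far: "\<forall>y\<in>B. real k < dist x0 y" for B
  proof -
    define f where "f = (\<lambda>y. nat \<lfloor>dist x0 y\<rfloor>)"
    have f: "real (f y) \<le> dist x0 y" "dist x0 y \<le> real (Suc (f y))" for y
    proof -
      have "0 \<le> dist x0 y"
        by simp
      then show "real (f y) \<le> dist x0 y" "dist x0 y \<le> real (Suc (f y))"
        unfolding f_def by linarith+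
    qed
    define m where "m = Suc (Max (insert 0 (f ` B)))"
    have fB: "f y \<in> {k..<m}" if "y \<in> B" for y
    proof -
      have "real k < real (Suc (f y))"
        using f(2)[of y] far that by fastforce
      moreover have "f y \<le> Max (insert 0 (f ` B))"
        using B(2) that by (intro Max_ge) auto
      ultimately show ?thesis
        by (simp add: m_def)
    qed
    have "(\<Sum>y\<in>B. exp (- \<tau> * dist x0 y)) = (\<Sum>n\<in>{k..<m}. \<Sum>y\<in>{y \<in> B. f y = n}. exp (- \<tau> * dist x0 y))"
      using fB by (intro sum.group[symmetric] B(2)) auto
    also have "\<dots> \<le> (\<Sum>n\<in>{k..<m}. exp \<sigma> * \<theta> ^ n)"
    proof (rule sum_mono)
      fix n assume n: "n \<in> {k..<m}"
      have sub: "{y \<in> B. f y = n} \<subseteq> {y \<in> A. dist x0 y \<le> real (Suc n)}"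
        using B(1) f(2) by auto
      have "n1 \<le> Suc n"
        using n by (simp add: k_def)
      note cnt = count[OF this]
      have "real (card {y \<in> B. f y = n}) \<le> real (card {y \<in> A. dist x0 y \<le> real (Suc n)})"
        using card_mono[OF conjunct1[OF cnt] sub] by simp
      also have "\<dots> \<le> exp (\<sigma> * real (Suc n))"
        using cnt by simp
      finally have c: "real (card {y \<in> B. f y = n}) \<le> exp (\<sigma> * real (Suc n))" .
      have "(\<Sum>y\<in>{y \<in> B. f y = n}. exp (- \<tau> * dist x0 y)) \<le> (\<Sum>y\<in>{y \<in> B. f y = n}. exp (- \<tau> * real n))"
      proof (rule sum_mono)
        fix y assume "y \<in> {y \<in> B. f y = n}"
        then have "\<tau> * real n \<le> \<tau> * dist x0 y"
          using f(1)[of y] \<open>0 < \<tau>\<close> by (intro mult_left_mono) auto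
        then show "exp (- \<tau> * dist x0 y) \<le> exp (- \<tau> * real n)"
          by simp
      qed
      also have "\<dots> = real (card {y \<in> B. f y = n}) * exp (- \<tau> * real n)"
        by simp
      also have "\<dots> \<le> exp (\<sigma> * real (Suc n)) * exp (- \<tau> * real n)"
        using c by (intro mult_right_mono) auto
      also have "\<dots> = exp \<sigma> * \<theta> ^ n"
        by (simp add: \<theta>_def exp_add[symmetric] exp_of_nat_mult[symmetric] algebra_simps)
      finally show "(\<Sum>y\<in>{y \<in> B. f y = n}. exp (- \<tau> * dist x0 y)) \<le> exp \<sigma> * \<theta> ^ n" .
    qed
    also have "\<dots> = exp \<sigma> * (\<Sum>n\<in>{k..<m}. \<theta> ^ n)"
      by (simp add: sum_distrib_left)
    also have "(\<Sum>n\<in>{k..<m}. \<theta> ^ n) \<le> \<theta> ^ k / (1 - \<theta>)"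
    proof -
      have "(\<Sum>n\<in>{k..<m}. \<theta> ^ n) * (1 - \<theta>) \<le> \<theta> ^ k"
      proof (cases "k \<le> m")
        case True
        then have "(\<Sum>n\<in>{k..<m}. \<theta> ^ n) * (1 - \<theta>) = \<theta> ^ k - \<theta> ^ m"
        proof (induction m rule: dec_induct)
          case (step n)
          have "(\<Sum>n\<in>{k..<Suc n}. \<theta> ^ n) * (1 - \<theta>) = (\<Sum>n\<in>{k..<n}. \<theta> ^ n) * (1 - \<theta>) + \<theta> ^ n * (1 - \<theta>)"
            using step(1) by (simp add: distrib_right)
          also have "\<dots> = \<theta> ^ k - \<theta> ^ Suc n"
            unfolding step.IH by (simp add: algebra_simps)
          finally show ?case .
        qed simp
        then show ?thesis
          using \<theta> by simp
      next
        case False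
        then show ?thesis
          using \<theta> by simp
      qed
      then show ?thesis
        using \<theta> by (simp add: pos_le_divide_eq)
    qed
    also have "exp \<sigma> * (\<theta> ^ k / (1 - \<theta>)) < \<epsilon>"
      using n2[of k] by (simp add: k_def)
    finally show ?thesis
      by simp
  qed
  then show ?thesis
    by blast
qed

section \<open>Shadow estimates for random words\<close>

context spread_alphabet
begin

definition near_orbit :: "'a set \<Rightarrow> ('a \<Rightarrow> 'a) \<Rightarrow> bool" where
  "near_orbit S g \<longleftrightarrow> (\<exists>s\<in>S. dist s (g x0) \<le> 8 * C + \<rho>')"

text \<open>The number of unit pieces of a geodesic within reach of one letter, times the number of
  group elements near one piece. It is linear in the letter length \<open>L\<close>, which lets the
  normalising constant of a large alphabet exceed it.\<close>

definition branching :: "real \<Rightarrow> real" where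
  "branching L = (2 * (L + 2 * (8 * C + \<rho>')) + 2) * real (ball_count (2 * (8 * C + \<rho>' + 1)))"

text \<open>The letters are sorted by the integer part of the distance from \<open>x0\<close> to a
  point of \<open>S\<close> near \<open>a (t x0)\<close>. Points of \<open>S\<close> with the same
  integer part are within \<open>1\<close> of each other, so each class is contained in a
  ball.\<close>

lemma card_next_near:
  assumes S: "geodesic_segment x0 z S" and L: "\<And>t. t \<in> T \<Longrightarrow> dist x0 (t x0) \<le> L" "0 \<le> L"
    and a: "a \<in> G" "near_orbit S a" and T: "finite T"
  shows "real (card {t \<in> T. near_orbit S (a \<circ> t)}) \<le> branching L"
proof -
  define r where "r = 8 * C + \<rho>'"
  have r: "0 \<le> r"
    unfolding r_def using overlap_bound_pos \<alpha>_nonneg C_pos by linarith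
  define M where "M = ball_count (2 * (r + 1))"
  obtain p where p: "p \<in> S" "dist p (a x0) \<le> r"
    using a(2) unfolding near_orbit_def r_def by blast
  define I where "I = {\<lfloor>dist x0 p - (L + 2 * r)\<rfloor>..\<lfloor>dist x0 p + (L + 2 * r)\<rfloor>}"
  define U where "U = (\<lambda>n. {t \<in> T. \<exists>s\<in>S. \<lfloor>dist x0 s\<rfloor> = n \<and> dist s (a (t x0)) \<le> r})"
  have cover: "{t \<in> T. near_orbit S (a \<circ> t)} \<subseteq> (\<Union>n\<in>I. U n)"
  proof
    fix t assume t: "t \<in> {t \<in> T. near_orbit S (a \<circ> t)}"
    then obtain s where s: "s \<in> S" "dist s (a (t x0)) \<le> r"
      unfolding near_orbit_def r_def by auto
    have "dist p s \<le> dist p (a x0) + dist (a x0) (a (t x0)) + dist s (a (t x0))"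
      by metric
    moreover have "dist (a x0) (a (t x0)) \<le> L"
      using isometry[OF a(1)] L(1) t by simp
    ultimately have "dist p s \<le> L + 2 * r"
      using p s by linarith
    then have "\<bar>dist x0 p - dist x0 s\<bar> \<le> L + 2 * r"
      using geodesic_segment_dist_within[OF S p(1) s(1)] by simp
    then have "\<lfloor>dist x0 s\<rfloor> \<in> I"
      unfolding I_def by (auto intro!: floor_mono)
    then show "t \<in> (\<Union>n\<in>I. U n)"
      using s t unfolding U_def by blast
  qed
  have cardU: "card (U n) \<le> M" for n
  proof (cases "U n = {}")
    case False
    then obtain t0 s0 where s0: "s0 \<in> S" "\<lfloor>dist x0 s0\<rfloor> = n"
      unfolding U_def by blast
    have sub: "(\<lambda>t. a \<circ> t) ` U n \<subseteq> {g \<in> G. dist s0 (g x0) \<le> r + 1}"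
    proof (intro image_subsetI CollectI conjI)
      fix t assume t: "t \<in> U n"
      then obtain s where s: "t \<in> T" "s \<in> S" "\<lfloor>dist x0 s\<rfloor> = n" "dist s (a (t x0)) \<le> r"
        unfolding U_def by blast
      show "a \<circ> t \<in> G"
        using comp_mem[OF a(1) T_G[OF s(1)]] .
      have "dist s0 s = \<bar>dist x0 s0 - dist x0 s\<bar>"
        by (rule geodesic_segment_dist_within[OF S s0(1) s(2)])
      also have "\<dots> \<le> 1"
        using s0(2) s(3) by linarith
      finally have "dist s0 s \<le> 1" .
      moreover have "dist s0 (a (t x0)) \<le> dist s0 s + dist s (a (t x0))"
        by metric
      ultimately show "dist s0 ((a \<circ> t) x0) \<le> r + 1"
        using s(4) by simp
    qed
    have "inj_on (\<lambda>t. a \<circ> t) (U n)"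
      using injective[OF a(1)] by (intro inj_onI) (metis fun.inj_map injD)
    then have "card (U n) \<le> card {g \<in> G. dist s0 (g x0) \<le> r + 1}"
      using sub finite_ball_around by (rule card_inj_on_le)
    also have "\<dots> \<le> M"
      unfolding M_def by (rule card_ball_around)
    finally show ?thesis .
  qed simp
  have finU: "finite (U n)" for n
    unfolding U_def using T by simp
  have "card {t \<in> T. near_orbit S (a \<circ> t)} \<le> card (\<Union>n\<in>I. U n)"
    using cover finU by (intro card_mono) (auto simp: I_def)
  also have "\<dots> \<le> (\<Sum>n\<in>I. card (U n))"
    by (rule card_UN_le) (simp add: I_def)
  also have "\<dots> \<le> (\<Sum>n\<in>I. M)"
    by (intro sum_mono cardU)
  also have "\<dots> = card I * M"
    by simp
  finally have "real (card {t \<in> T. near_orbit S (a \<circ> t)}) \<le> real (card I) * real M"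
    by (simp only: of_nat_mult[symmetric] of_nat_le_iff)
  also have "\<dots> \<le> (2 * (L + 2 * r) + 2) * real M"
  proof (rule mult_right_mono)
    have "real (card I) = real_of_int (max 0 (\<lfloor>dist x0 p + (L + 2 * r)\<rfloor> - \<lfloor>dist x0 p - (L + 2 * r)\<rfloor> + 1))"
      by (simp add: I_def)
    also have "\<dots> \<le> 2 * (L + 2 * r) + 2"
    proof -
      have "real_of_int (\<lfloor>dist x0 p + (L + 2 * r)\<rfloor> - \<lfloor>dist x0 p - (L + 2 * r)\<rfloor> + 1) \<le> 2 * (L + 2 * r) + 2"
        using of_int_floor_le[of "dist x0 p + (L + 2 * r)"] real_of_int_floor_add_one_gt[of "dist x0 p - (L + 2 * r)"]
        unfolding of_int_add of_int_diff of_int_1 by argo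
      moreover have "0 \<le> 2 * (L + 2 * r) + 2"
        using L(2) r by simp
      ultimately show ?thesis
        by (simp add: max_def)
    qed
    finally show "real (card I) \<le> 2 * (L + 2 * r) + 2" .
  qed simp
  finally show ?thesis
    unfolding branching_def M_def r_def .
qed

end

text \<open>The factor \<open>2\<close> in \<open>Z_large\<close> makes the contributions of the
  successive prefix lengths to a shadow decay like powers of \<open>1 / 2\<close>.\<close>

locale conformal_words = spread_alphabet +
  fixes L s Z :: real
  assumes finite_alphabet: "finite T" and letter_length: "t \<in> T \<Longrightarrow> dist x0 (t x0) \<le> L" and L_nonneg: "0 \<le> L"
    and s_pos: "0 < s" and Z_eq: "Z = (\<Sum>t\<in>T. exp (- s * dist x0 (t x0)))"
    and Z_pos: "0 < Z" and Z_large: "2 * branching L \<le> Z"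

begin

definition letter_prob :: "('a \<Rightarrow> 'a) \<Rightarrow> real" where
  "letter_prob t = exp (- s * dist x0 (t x0)) / Z"

sublocale random_words T letter_prob
proof
  show "sum letter_prob T = 1"
    using Z_pos unfolding letter_prob_def sum_divide_distrib[symmetric] Z_eq[symmetric] by simp
  show "0 < letter_prob t" for t
    using Z_pos by (simp add: letter_prob_def)
qed (rule finite_alphabet)

text \<open>The exponent of the weight is the total length of the letters, and by the triangle
  inequality this is at least the distance travelled by the word.\<close>

lemma weight_le:
  assumes "w \<in> words"
  shows "weight w \<le> exp (- s * dist x0 (word_prod w x0)) / Z ^ length w"
  using assms
proof (induction w)
  case Nil
  show ?case
    by simp
next
  case (Cons t w)
  let ?x = "word_prod w x0"
  have "dist x0 (t ?x) \<le> dist x0 (t x0) + dist (t x0) (t ?x)"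
    by metric
  then have "dist x0 (t ?x) \<le> dist x0 (t x0) + dist x0 ?x"
    using isometry[OF T_G[OF Cons.hyps(1)]] by simp
  then have "s * dist x0 (t ?x) \<le> s * (dist x0 (t x0) + dist x0 ?x)"
    using s_pos by (intro mult_left_mono) auto
  then have le: "exp (- s * dist x0 (t x0)) * exp (- s * dist x0 ?x) \<le> exp (- s * dist x0 (t ?x))"
    by (simp add: exp_add[symmetric] algebra_simps)
  have "weight (t # w) \<le> exp (- s * dist x0 (t x0)) / Z * (exp (- s * dist x0 ?x) / Z ^ length w)"
    unfolding weight_simps letter_prob_def[of t] using Cons.IH Z_pos by (intro mult_left_mono) auto
  also have "\<dots> = (exp (- s * dist x0 (t x0)) * exp (- s * dist x0 ?x)) / Z ^ length (t # w)"
    by simp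
  also have "\<dots> \<le> exp (- s * dist x0 (t ?x)) / Z ^ length (t # w)"
    using le Z_pos by (intro divide_right_mono) auto
  finally show ?case
    by simp
qed

lemma card_following:
  assumes S: "geodesic_segment x0 z S"
  shows "real (card {w \<in> level j. \<forall>i\<le>j. near_orbit S (word_prod (take i w))}) \<le> branching L ^ j"
proof (induction j)
  case 0
  have "card {w \<in> level 0. \<forall>i\<le>0. near_orbit S (word_prod (take i w))} \<le> card {[] :: ('a \<Rightarrow> 'a) list}"
    by (intro card_mono) (auto simp: level_0)
  also have "\<dots> = 1"
    by simp
  finally show ?case
    unfolding power_0 by linarith
next
  case (Suc j)
  let ?W = "\<lambda>j. {w \<in> level j. \<forall>i\<le>j. near_orbit S (word_prod (take i w))}"
  let ?U = "\<lambda>u. {t \<in> T. near_orbit S (word_prod u \<circ> t)}"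
  have fin: "finite (?W j)"
    using finite_level by simp
  have sub: "?W (Suc j) \<subseteq> (\<Union>u\<in>?W j. (\<lambda>t. u @ [t]) ` ?U u)"
  proof
    fix w assume w: "w \<in> ?W (Suc j)"
    then obtain u t where ut: "u \<in> level j" "t \<in> T" "w = u @ [t]"
      unfolding level_Suc by auto
    have len: "length u = j"
      using ut(1) by (simp add: level_def)
    have "near_orbit S (word_prod (take i u))" if "i \<le> j" for i
    proof -
      have "near_orbit S (word_prod (take i w))"
        using w that by simp
      then show ?thesis
        using that len ut(3) by simp
    qed
    moreover have "near_orbit S (word_prod (take (Suc j) w))"
      using w by blast
    then have "near_orbit S (word_prod u \<circ> t)"
      using len ut(3) by (simp add: word_prod_append)
    ultimately show "w \<in> (\<Union>u\<in>?W j. (\<lambda>t. u @ [t]) ` ?U u)"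
      using ut by blast
  qed
  have "card (?W (Suc j)) \<le> card (\<Union>u\<in>?W j. (\<lambda>t. u @ [t]) ` ?U u)"
    using sub fin finite_alphabet by (intro card_mono) auto
  also have "\<dots> \<le> (\<Sum>u\<in>?W j. card ((\<lambda>t. u @ [t]) ` ?U u))"
    by (rule card_UN_le[OF fin])
  also have "\<dots> \<le> (\<Sum>u\<in>?W j. card (?U u))"
    using finite_alphabet by (intro sum_mono card_image_le) auto
  finally have "real (card (?W (Suc j))) \<le> (\<Sum>u\<in>?W j. real (card (?U u)))"
    by (simp only: of_nat_sum[symmetric] of_nat_le_iff)
  also have "\<dots> \<le> (\<Sum>u\<in>?W j. branching L)"
  proof (rule sum_mono)
    fix u assume u: "u \<in> ?W j"
    have "u \<in> words"
      using u level_lists by blast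
    moreover have "near_orbit S (word_prod (take j u))"
      using u by blast
    then have "near_orbit S (word_prod u)"
      using u by (simp add: level_def)
    ultimately show "real (card (?U u)) \<le> branching L"
      by (intro card_next_near[of z S L "word_prod u"] S L_nonneg finite_alphabet word_prod_G letter_length)
  qed
  also have "\<dots> = real (card (?W j)) * branching L"
    by simp
  also have "\<dots> \<le> branching L ^ j * branching L"
  proof (rule mult_right_mono[OF Suc])
    have "0 \<le> L + 2 * (8 * C + \<rho>')"
      using L_nonneg overlap_bound_pos \<alpha>_nonneg C_pos by argo
    then show "0 \<le> branching L"
      unfolding branching_def by (intro mult_nonneg_nonneg) auto
  qed
  finally show ?case
    by (simp add: mult.commute)
qed

text \<open>Shadow lemma. For each \<open>j\<close>, at most \<open>(Z / 2) ^ j\<close> prefixes of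
  length \<open>j\<close> follow \<open>S\<close>. Those reaching the middle weigh at most
  \<open>exp (- (s / 2) * (dist x0 z - K)) / Z ^ j\<close> each, and the sum over \<open>j\<close>
  is geometric.\<close>

lemma prob_shadow_le:
  assumes S: "geodesic_segment x0 z S"
  shows "prob m (\<lambda>w. \<exists>j\<le>m. (\<forall>i\<le>j. near_orbit S (word_prod (take i w))) \<and>
      dist x0 z \<le> 2 * dist x0 (word_prod (take j w) x0) + K) \<le> 2 * exp (- (s / 2) * (dist x0 z - K))"
    (is "prob m ?E \<le> 2 * ?e")
proof -
  define Q where "Q = (\<lambda>j w. (\<forall>i\<le>j. near_orbit S (word_prod (take i w))) \<and>
      dist x0 z \<le> 2 * dist x0 (word_prod w x0) + K)"
  have Qprob: "prob j (Q j) \<le> (1 / 2) ^ j * ?e" for j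
  proof -
    have fin: "finite {w \<in> level j. Q j w}"
      using finite_level by simp
    have "prob j (Q j) \<le> (\<Sum>w\<in>{w \<in> level j. Q j w}. ?e / Z ^ j)"
      unfolding prob_eq_sum
    proof (rule sum_mono)
      fix w assume w: "w \<in> {w \<in> level j. Q j w}"
      then have "dist x0 z - K \<le> 2 * dist x0 (word_prod w x0)"
        unfolding Q_def by simp
      then have "(s / 2) * (dist x0 z - K) \<le> (s / 2) * (2 * dist x0 (word_prod w x0))"
        using s_pos by (intro mult_left_mono) auto
      then have le: "exp (- s * dist x0 (word_prod w x0)) \<le> ?e"
        by simp
      have "weight w \<le> exp (- s * dist x0 (word_prod w x0)) / Z ^ j"
        using weight_le[of w] w by (simp add: level_def)
      also have "\<dots> \<le> ?e / Z ^ j"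
        using le Z_pos by (intro divide_right_mono) auto
      finally show "weight w \<le> ?e / Z ^ j" .
    qed
    also have "\<dots> = real (card {w \<in> level j. Q j w}) * (?e / Z ^ j)"
      by simp
    also have "\<dots> \<le> (Z / 2) ^ j * (?e / Z ^ j)"
    proof (rule mult_right_mono)
      have "card {w \<in> level j. Q j w} \<le> card {w \<in> level j. \<forall>i\<le>j. near_orbit S (word_prod (take i w))}"
        using finite_level by (intro card_mono) (auto simp: Q_def)
      then have "real (card {w \<in> level j. Q j w}) \<le> branching L ^ j"
        using card_following[OF S, of j] by linarith
      also have "\<dots> \<le> (Z / 2) ^ j"
      proof (rule power_mono)
        have "0 \<le> L + 2 * (8 * C + \<rho>')"
          using L_nonneg overlap_bound_pos \<alpha>_nonneg C_pos by argo
        then show "0 \<le> branching L"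
          unfolding branching_def by (intro mult_nonneg_nonneg) auto
      qed (use Z_large in simp)
      finally show "real (card {w \<in> level j. Q j w}) \<le> (Z / 2) ^ j" .
    qed (use Z_pos in simp)
    also have "\<dots> = (1 / 2) ^ j * ?e"
      using Z_pos by (simp add: power_divide)
    finally show ?thesis .
  qed
  have "prob m ?E \<le> prob m (\<lambda>w. \<exists>j\<in>{..m}. Q j (take j w))"
  proof (rule prob_mono)
    fix w assume "?E w"
    then obtain j where j: "j \<le> m" "\<forall>i\<le>j. near_orbit S (word_prod (take i w))"
        "dist x0 z \<le> 2 * dist x0 (word_prod (take j w) x0) + K"
      by blast
    have "near_orbit S (word_prod (take i (take j w)))" if "i \<le> j" for i
      using j(2) that by (simp add: min_absorb1)
    then have "Q j (take j w)"
      using j(3) unfolding Q_def by blast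
    then show "\<exists>j\<in>{..m}. Q j (take j w)"
      using j(1) by blast
  qed
  also have "\<dots> \<le> (\<Sum>j\<in>{..m}. prob m (\<lambda>w. Q j (take j w)))"
    by (rule prob_Bex_le) simp
  also have "\<dots> = (\<Sum>j\<in>{..m}. prob j (Q j))"
    by (intro sum.cong refl prob_take) simp
  also have "\<dots> \<le> (\<Sum>j\<in>{..m}. (1 / 2) ^ j * ?e)"
    by (intro sum_mono Qprob)
  also have "\<dots> = (\<Sum>j\<in>{..m}. (1 / 2) ^ j) * ?e"
    by (simp add: sum_distrib_right)
  also have "\<dots> \<le> 2 * ?e"
  proof (rule mult_right_mono)
    have "(\<Sum>j\<in>{..m}. (1 / 2) ^ j) = 2 - (1 / 2 :: real) ^ m"
      by (induction m) (simp_all add: field_simps)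
    then show "(\<Sum>j\<in>{..m}. (1 / 2) ^ j) \<le> (2 :: real)"
      by simp
  qed simp
  finally show ?thesis .
qed

text \<open>If \<open>H\<close> grows slower than \<open>s / 2\<close>, the shadows of its far orbit points have small total measure, so with
  probability at least \<open>1 / 2\<close> the element attached to a random word is one of finitely many.\<close>

lemma prob_near_label:
  fixes \<phi> :: "('a \<Rightarrow> 'a) list \<Rightarrow> 'a \<Rightarrow> 'a"
  assumes \<phi>: "\<And>w. w \<in> words \<Longrightarrow> \<phi> w \<in> H"
    "\<And>w. w \<in> words \<Longrightarrow> dist (word_prod w x0) (\<phi> w (word_prod w x0)) \<le> D"
    and H: "\<And>h x y. h \<in> H \<Longrightarrow> dist (h x) (h y) = dist x y"
    and count: "\<And>n. n1 \<le> n \<Longrightarrow> finite {y \<in> (\<lambda>h. h x0) ` H. dist x0 y \<le> real n} \<and>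
      real (card {y \<in> (\<lambda>h. h x0) ` H. dist x0 y \<le> real n}) \<le> exp (\<sigma> * real n)"
    and \<sigma>: "\<sigma> < s / 2"
  shows "\<exists>r. \<forall>m. 1 / 2 \<le> prob m (\<lambda>w. dist x0 (\<phi> w x0) \<le> r)"
proof -
  define K where "K = 2 * L + D + 16 * C + 2 * \<rho>"
  \<comment> \<open>Makes the total probability \<open>2 * exp (s / 2 * K) * \<epsilon>\<close> of
    the far shadows equal to \<open>1 / 2\<close>.\<close>
  define \<epsilon> where "\<epsilon> = 1 / (4 * exp (s / 2 * K))"
  have \<epsilon>: "0 < \<epsilon>"
    by (simp add: \<epsilon>_def)
  have "0 < s / 2"
    using s_pos by simp
  from sum_exp_small[OF count \<sigma> this \<epsilon>] obtain r where
    r: "\<forall>B\<subseteq>(\<lambda>h. h x0) ` H. finite B \<and> (\<forall>y\<in>B. r < dist x0 y) \<longrightarrow>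
      (\<Sum>y\<in>B. exp (- (s / 2) * dist x0 y)) < \<epsilon>" ..
  have "1 / 2 \<le> prob m (\<lambda>w. dist x0 (\<phi> w x0) \<le> r)" for m
  proof -
    have "\<exists>S. geodesic_segment x0 z S" for z :: 'a
      using geodesic_ex by blast
    then obtain S where S: "\<And>z. geodesic_segment x0 z (S z)"
      by metis
    define E where "E = (\<lambda>z w. \<exists>j\<le>m. (\<forall>i\<le>j. near_orbit (S z) (word_prod (take i w))) \<and>
      dist x0 z \<le> 2 * dist x0 (word_prod (take j w) x0) + K)"
    define B where "B = {y \<in> (\<lambda>w. \<phi> w x0) ` level m. r < dist x0 y}"
    have B: "B \<subseteq> (\<lambda>h. h x0) ` H" "finite B"
      using \<phi>(1) level_lists finite_level unfolding B_def by auto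
    have "prob m (\<lambda>w. r < dist x0 (\<phi> w x0)) \<le> prob m (\<lambda>w. \<exists>z\<in>B. E z w)"
    proof (rule prob_mono)
      fix w assume w: "w \<in> level m" "r < dist x0 (\<phi> w x0)"
      have ww: "w \<in> words" and len: "length w = m"
        using w(1) by (auto simp: level_def)
      have "E (\<phi> w x0) w"
        unfolding E_def K_def near_orbit_def len[symmetric]
        by (intro shadow ww H[OF \<phi>(1)[OF ww]] \<phi>(2)[OF ww] S letter_length L_nonneg)
      then show "\<exists>z\<in>B. E z w"
        using w unfolding B_def by blast
    qed
    also have "\<dots> \<le> (\<Sum>z\<in>B. prob m (E z))"
      by (rule prob_Bex_le[OF B(2)])
    also have "\<dots> \<le> (\<Sum>z\<in>B. 2 * exp (s / 2 * K) * exp (- (s / 2) * dist x0 z))"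
    proof (rule sum_mono)
      fix z
      have "prob m (E z) \<le> 2 * exp (- (s / 2) * (dist x0 z - K))"
        unfolding E_def by (rule prob_shadow_le[OF S])
      also have "exp (- (s / 2) * (dist x0 z - K)) = exp (s / 2 * K) * exp (- (s / 2) * dist x0 z)"
      proof -
        have "- (s / 2) * (dist x0 z - K) = s / 2 * K + - (s / 2) * dist x0 z"
          by (simp add: field_simps)
        then show ?thesis
          by (simp only: exp_add)
      qed
      finally show "prob m (E z) \<le> 2 * exp (s / 2 * K) * exp (- (s / 2) * dist x0 z)"
        by simp
    qed
    also have "\<dots> = 2 * exp (s / 2 * K) * (\<Sum>z\<in>B. exp (- (s / 2) * dist x0 z))"
      by (simp add: sum_distrib_left)
    also have "\<dots> \<le> 2 * exp (s / 2 * K) * \<epsilon>"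
    proof (rule mult_left_mono)
      have "\<forall>y\<in>B. r < dist x0 y"
        unfolding B_def by simp
      then show "(\<Sum>z\<in>B. exp (- (s / 2) * dist x0 z)) \<le> \<epsilon>"
        using r B by (meson less_imp_le)
    qed simp
    also have "\<dots> = 1 / 2"
      by (simp add: \<epsilon>_def)
    finally have "prob m (\<lambda>w. r < dist x0 (\<phi> w x0)) \<le> 1 / 2" .
    moreover have "prob m (\<lambda>w. True) \<le> prob m (\<lambda>w. r < dist x0 (\<phi> w x0)) + prob m (\<lambda>w. dist x0 (\<phi> w x0) \<le> r)"
      by (rule order_trans[OF prob_mono prob_disj_le]) auto
    ultimately show ?thesis
      unfolding prob_True by linarith
  qed
  then show ?thesis
    by blast
qed

end

text \<open>Shaped for \<open>alphabet_exists\<close>: one linear factor is the branching, the other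
  counts the powers of \<open>F\<close> removed in \<open>reduced\<close>, and the term with
  \<open>A\<close> bounds the commensurating elements.\<close>

lemma eventually_exp_dominates:
  fixes s s' k1 k2 K A :: real
  assumes "s < s'" "0 < s'"
  shows "eventually (\<lambda>n. K * (real n + k1) * (real n + k2) * exp (s * real n) + A * (real n + 1) \<le> exp (s' * real n)) sequentially"
proof -
  define d where "d = s' - s"
  have "0 < d"
    using assms by (simp add: d_def)
  then have "(\<lambda>n. (real n + k1) * (real n + k2) * exp (- d * real n)) \<longlonglongrightarrow> 0"
    by real_asymp
  moreover have "(\<lambda>n. (real n + 1) * exp (- s' * real n)) \<longlonglongrightarrow> 0"
    using assms(2) by real_asymp
  ultimately have "(\<lambda>n. K * ((real n + k1) * (real n + k2) * exp (- d * real n)) + A * ((real n + 1) * exp (- s' * real n))) \<longlonglongrightarrow> K * 0 + A * 0"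
    by (intro tendsto_intros)
  then have "eventually (\<lambda>n. K * ((real n + k1) * (real n + k2) * exp (- d * real n)) + A * ((real n + 1) * exp (- s' * real n)) < 1) sequentially"
    by (intro order_tendstoD(2)) auto
  then show ?thesis
  proof (rule eventually_mono)
    fix n
    let ?E = "exp (s' * real n)"
    assume "K * ((real n + k1) * (real n + k2) * exp (- d * real n)) + A * ((real n + 1) * exp (- s' * real n)) < 1"
    then have "(K * ((real n + k1) * (real n + k2) * exp (- d * real n)) + A * ((real n + 1) * exp (- s' * real n))) * ?E \<le> 1 * ?E"
      by (intro mult_right_mono) auto
    note le = this
    have "exp (- d * real n) * ?E = exp (s * real n)" "exp (- s' * real n) * ?E = 1"
      unfolding exp_add[symmetric] d_def by (simp_all add: algebra_simps)
    then have eq: "(K * ((real n + k1) * (real n + k2) * exp (- d * real n)) + A * ((real n + 1) * exp (- s' * real n))) * ?E =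
        K * (real n + k1) * (real n + k2) * exp (s * real n) + A * (real n + 1)"
      by (simp add: distrib_right mult.assoc)
    show "K * (real n + k1) * (real n + k2) * exp (s * real n) + A * (real n + 1) \<le> ?E"
      using le unfolding eq by simp
  qed
qed

section \<open>Construction of the alphabet and of the recurrent element\<close>

context contracting_axis
begin

definition reduced :: "nat \<Rightarrow> ('a \<Rightarrow> 'a) set" where
  "reduced n = {a \<in> G. a \<notin> commensurating \<and> dist x0 (a x0) \<le> real n \<and> x0 \<in> proj (a x0)}"

lemma finite_reduced: "finite (reduced n)"
  by (rule finite_subset[OF _ finite_ball[of "real n"]]) (auto simp: reduced_def)

text \<open>Multiplying \<open>g\<close> by the power of the contracting isometry that moves the projection of \<open>g x0\<close> to
  \<open>x0\<close> does not increase its length, and only linearly many powers occur.\<close>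

lemma card_noncommensurating_le:
  "real (card {g \<in> G. g \<notin> commensurating \<and> dist x0 (g x0) \<le> real n}) \<le> real (card (reduced n)) * (2 * (c * (2 * real n + c)) + 1)"
proof -
  let ?X = "{g \<in> G. g \<notin> commensurating \<and> dist x0 (g x0) \<le> real n}"
  define m where "m = \<lfloor>c * (2 * real n + c)\<rfloor>"
  have m: "0 \<le> m" "real_of_int m \<le> c * (2 * real n + c)"
    using c1 by (simp_all add: m_def)
  have "\<exists>l. y l \<in> proj (g x0)" for g
    using proj_ex by blast
  then obtain l where l: "\<And>g. y (l g) \<in> proj (g x0)"
    by metis
  define f where "f = (\<lambda>g. (F (- l g) \<circ> g, l g))"
  have "inj_on f ?X"
  proof (rule inj_onI)
    fix g h assume "f g = f h"
    then have eq: "l g = l h" "F (- l g) \<circ> g = F (- l h) \<circ> h"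
      unfolding f_def prod.inject by blast+
    show "g = h"
    proof
      fix x
      have "F (- l g) (g x) = F (- l g) (h x)"
        using fun_cong[OF eq(2), of x] eq(1) by simp
      then show "g x = h x"
        using injective[OF F_mem] by (meson injD)
    qed
  qed
  moreover have "f ` ?X \<subseteq> reduced n \<times> {- m..m}"
  proof (rule image_subsetI)
    fix g assume g: "g \<in> ?X"
    have "dist x0 ((F (- l g) \<circ> g) x0) = dist (y (l g)) (g x0)"
      using isometry[OF F_mem, of "l g" x0 "F (- l g) (g x0)"] by (simp add: y_def)
    also have "\<dots> \<le> dist x0 (g x0)"
      using nearest_proj_le[OF l[of g] x0_Y] by (simp add: dist_commute)
    finally have "dist x0 ((F (- l g) \<circ> g) x0) \<le> real n"
      using g by simp
    moreover have "x0 \<in> proj ((F (- l g) \<circ> g) x0)"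
      using proj_F[OF l[of g], of "- l g"] by (simp add: F_y y_0)
    moreover have "F (- l g) \<circ> g \<notin> commensurating"
      using g F_commensurating by (intro not_commensurating_comp F_mem) auto
    moreover have "F (- l g) \<circ> g \<in> G"
      using g by (intro comp_mem F_mem) simp
    ultimately have "F (- l g) \<circ> g \<in> reduced n"
      by (simp add: reduced_def)
    moreover have "\<bar>l g\<bar> \<le> m"
    proof -
      have "dist (y (l g)) (y 0) \<le> 2 * dist (g x0) x0"
        using nearest_proj_dist2[OF l[of g] x0_Y] by (simp add: y_0 dist_commute)
      then have "dist (y (l g)) (y 0) + c \<le> 2 * real n + c"
        using g by (simp add: dist_commute)
      then have "c * (dist (y (l g)) (y 0) + c) \<le> c * (2 * real n + c)"
        using c1 by (intro mult_left_mono) auto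
      then have "\<bar>real_of_int (l g - 0)\<bar> \<le> c * (2 * real n + c)"
        using y_dist_lower[of "l g" 0] by linarith
      then show ?thesis
        unfolding m_def by (simp add: le_floor_iff)
    qed
    ultimately show "f g \<in> reduced n \<times> {- m..m}"
      unfolding f_def by auto
  qed
  ultimately have "card ?X \<le> card (reduced n \<times> {- m..m})"
    using finite_reduced by (intro card_inj_on_le[of f]) auto
  also have "\<dots> = card (reduced n) * nat (2 * m + 1)"
    by (simp add: card_cartesian_product)
  finally have "real (card ?X) \<le> real (card (reduced n)) * real (nat (2 * m + 1))"
    by (simp only: of_nat_mult[symmetric] of_nat_le_iff)
  also have "\<dots> \<le> real (card (reduced n)) * (2 * (c * (2 * real n + c)) + 1)"
    using m by (intro mult_left_mono) auto
  finally show ?thesis .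
qed

text \<open>The parameters are chosen in the order \<open>\<alpha>\<close>,
  \<open>\<Lambda>\<close>, \<open>N\<close>, \<open>n\<close>. Once \<open>N\<close> is fixed, the
  branching grows linearly in \<open>n\<close>, but \<open>Z\<close> exceeds it for a suitable
  \<open>n\<close> because the count of group elements has exponent \<open>s'\<close> above
  \<open>s\<close>. The elements of \<open>B\<close> are short compared with \<open>N\<close>, so
  for them both signs of the power are admissible.\<close>

lemma alphabet_exists:
  assumes growth: "\<And>n0. \<exists>n\<ge>n0. exp (s' * real n) \<le> real (card {g \<in> G. dist x0 (g x0) \<le> real n})"
    and s: "0 < s" "s < s'"
    and B: "finite B" "B \<subseteq> G - commensurating" "\<And>b. b \<in> B \<Longrightarrow> dist x0 (b x0) \<le> r" "0 \<le> r"
  shows "\<exists>T \<Lambda> L Z N. conformal_words x0 G F C c T (overlap_bound + 2 * r) \<Lambda> L s Z \<and> N0 \<le> N \<and>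
    (\<forall>b\<in>B. b \<circ> F N \<in> T \<and> b \<circ> F (- N) \<in> T)"
proof -
  define \<alpha> where "\<alpha> = overlap_bound + 2 * r"
  define \<Lambda> where "\<Lambda> = 10 * (\<alpha> + overlap_bound + 12 * C) + 100 * C + 2"
  obtain m :: nat where m: "0 < m" "\<And>j k. \<bar>j - k\<bar> \<ge> int m \<Longrightarrow> \<Lambda> + C + 2 * r < dist (y j) (y k)"
    using exists_large_index[of "\<Lambda> + C + 2 * r"] by blast
  define N where "N = max N0 (int m)"
  have N: "0 \<le> N" "N0 \<le> N" "int m \<le> N"
    by (auto simp: N_def)
  have far: "\<Lambda> + C + 2 * r < dist (y j) (y k)" if "\<bar>j - k\<bar> \<ge> N" for j k
    using m(2) that N by force
  define \<l> where "\<l> = c * real_of_int N + c"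
  have \<l>: "0 \<le> \<l>"
    using c1 N by (simp add: \<l>_def)
  have len: "dist x0 ((a \<circ> F k) x0) \<le> dist x0 (a x0) + \<l>" if "a \<in> G" "\<bar>k\<bar> = N" for a k
  proof -
    have "dist x0 (a (F k x0)) \<le> dist x0 (a x0) + dist (a x0) (a (F k x0))"
      by metric
    also have "dist (a x0) (a (F k x0)) = dist (y 0) (y k)"
      using isometry[OF that(1)] by (simp add: y_def)
    also have "\<dots> \<le> c * \<bar>real_of_int (0 - k)\<bar> + c"
      by (rule y_dist_upper)
    also have "\<bar>real_of_int (0 - k)\<bar> = real_of_int N"
      using that(2) by linarith
    finally show ?thesis
      by (simp add: \<l>_def)
  qed
  have start: "dist x0 z \<le> \<alpha>"
    if "a \<in> G" "a \<notin> commensurating" "z0 \<in> proj (a x0)" "dist x0 z0 \<le> 2 * r" "z \<in> proj ((a \<circ> F k) x0)" for a z0 z k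
  proof -
    have "dist z0 z \<le> overlap_bound"
    proof (rule bounded_projection[OF that(1,2) _ _ that(3,5)])
      show "a x0 \<in> a ` Y" "(a \<circ> F k) x0 \<in> a ` Y"
        using y_Y[of k] by (auto simp: y_def)
    qed
    moreover have "dist x0 z \<le> dist x0 z0 + dist z0 z"
      by metric
    ultimately show ?thesis
      using that(4) by (simp add: \<alpha>_def)
  qed
  \<comment> \<open>Translating by \<open>F k\<close> turns \<open>dist x0 z\<close> into the
    distance from \<open>y k\<close> to a projection of \<open>ginv a x0\<close>; so
    \<open>y k\<close> has to be far from that projection.\<close>
  have fin: "\<Lambda> \<le> dist x0 z"
    if a: "a \<in> G" and j: "y j \<in> proj (ginv a x0)" and k: "N \<le> \<bar>k - j\<bar> \<or> (dist x0 (a x0) \<le> r \<and> \<bar>k\<bar> = N)"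
      and z: "z \<in> proj (ginv (a \<circ> F k) x0)" for a j k z
  proof -
    have "ginv (a \<circ> F k) x0 = F (- k) (ginv a x0)"
      using ginv_mult[OF a F_mem] by (simp add: ginv_F)
    then have Fz: "F k z \<in> proj (ginv a x0)"
      using proj_F[OF z, of k] by simp
    have eq: "dist x0 z = dist (y k) (F k z)"
      using isometry[OF F_mem] by (simp add: y_def)
    show ?thesis
      using k
    proof
      assume "N \<le> \<bar>k - j\<bar>"
      then have "\<Lambda> + C + 2 * r < dist (y k) (y j)"
        by (rule far)
      moreover have "dist (y j) (F k z) \<le> C"
        by (rule proj_same[OF j Fz])
      moreover have "dist (y k) (y j) \<le> dist (y k) (F k z) + dist (y j) (F k z)"
        by metric
      ultimately show ?thesis
        using eq B(4) by linarith
    next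
      assume b: "dist x0 (a x0) \<le> r \<and> \<bar>k\<bar> = N"
      then have "\<Lambda> + C + 2 * r < dist (y k) (y 0)"
        by (intro far) simp
      moreover have "dist x0 (F k z) \<le> 2 * dist (ginv a x0) x0"
        by (rule nearest_proj_dist2[OF Fz x0_Y])
      then have "dist (y 0) (F k z) \<le> 2 * r"
        using b by (simp add: y_0 dist_ginv a)
      moreover have "dist (y k) (y 0) \<le> dist (y k) (F k z) + dist (y 0) (F k z)"
        by metric
      ultimately show ?thesis
        using eq C_pos by linarith
    qed
  qed
  \<comment> \<open>The sign of \<open>k\<close> is taken opposite to that of
    \<open>j\<close>.\<close>
  have "\<exists>k j. \<bar>k\<bar> = N \<and> y j \<in> proj (ginv a x0) \<and> N \<le> \<bar>k - j\<bar>" for a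
  proof -
    obtain j where j: "y j \<in> proj (ginv a x0)"
      by (rule proj_ex)
    show ?thesis
    proof (cases "j \<le> 0")
      case True
      then show ?thesis
        using j N by (intro exI[of _ N] exI[of _ j]) auto
    next
      case False
      then show ?thesis
        using j N by (intro exI[of _ "- N"] exI[of _ j]) auto
    qed
  qed
  then obtain k j where kj: "\<And>a. \<bar>k a\<bar> = N" "\<And>a. y (j a) \<in> proj (ginv a x0)" "\<And>a. N \<le> \<bar>k a - j a\<bar>"
    by metis
  obtain A where A: "0 \<le> A" "\<And>p r. 0 \<le> r \<Longrightarrow> finite {g \<in> commensurating. dist p (g x0) \<le> r} \<and>
       real (card {g \<in> commensurating. dist p (g x0) \<le> r}) \<le> A * (r + dist p x0 + 1)"
    using card_commensurating_ball by blast
  define q where "q = 8 * C + (\<alpha> + overlap_bound + 12 * C)"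
  have q: "0 \<le> q"
    unfolding q_def \<alpha>_def using B(4) overlap_bound_pos C_pos by linarith
  define M where "M = real (ball_count (2 * (q + 1)))"
  define k1 where "k1 = \<l> + r + 2 * q + 1"
  have k1: "1 \<le> k1"
    using \<l> B(4) q by (simp add: k1_def)
  define k2 where "k2 = (2 * c * c + 1) / (4 * c)"
  \<comment> \<open>\<open>4 * c\<close> comes from the number of powers of \<open>F\<close>, the
    factor \<open>2\<close> from the two signs, the exponential from the length added by
    \<open>F N\<close>, and \<open>4 * (M + 1)\<close> from the lower bound wanted for
    \<open>Z\<close>.\<close>
  define K where "K = 4 * (M + 1) * 2 * (4 * c) * exp (s * \<l>)"
  have M: "0 \<le> M"
    by (simp add: M_def)
  have "eventually (\<lambda>n. K * (real n + k1) * (real n + k2) * exp (s * real n) + A * (real n + 1) \<le> exp (s' * real n)) sequentially"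
    using s by (intro eventually_exp_dominates) auto
  then obtain n1 where n1: "\<And>n. n1 \<le> n \<Longrightarrow> K * (real n + k1) * (real n + k2) * exp (s * real n) + A * (real n + 1) \<le> exp (s' * real n)"
    unfolding eventually_sequentially by blast
  obtain n where n: "n1 \<le> n" "exp (s' * real n) \<le> real (card {g \<in> G. dist x0 (g x0) \<le> real n})"
    using growth by blast
  define T1 where "T1 = (\<lambda>a. a \<circ> F (k a)) ` reduced n"
  define T2 where "T2 = (\<lambda>b. b \<circ> F N) ` B \<union> (\<lambda>b. b \<circ> F (- N)) ` B"
  define T where "T = T1 \<union> T2"
  define L where "L = real n + \<l> + r"
  define Z where "Z = (\<Sum>t\<in>T. exp (- s * dist x0 (t x0)))"
  have finT: "finite T1" "finite T"
    unfolding T_def T1_def T2_def using finite_reduced B(1) by simp_all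
  have T_cases: "\<exists>a kk jj z0. t = a \<circ> F kk \<and> a \<in> G \<and> a \<notin> commensurating \<and> \<bar>kk\<bar> = N \<and> dist x0 (a x0) \<le> real n + r \<and>
      z0 \<in> proj (a x0) \<and> dist x0 z0 \<le> 2 * r \<and> y jj \<in> proj (ginv a x0) \<and> (N \<le> \<bar>kk - jj\<bar> \<or> dist x0 (a x0) \<le> r)"
    if tT: "t \<in> T" for t
  proof -
    from tT have "t \<in> T1 \<or> (\<exists>b\<in>B. t = b \<circ> F N) \<or> (\<exists>b\<in>B. t = b \<circ> F (- N))"
      unfolding T_def T2_def by blast
    moreover have "\<bar>N\<bar> = N" "\<bar>- N\<bar> = N"
      using N(1) by simp_all
    ultimately consider (1) a where "a \<in> reduced n" "t = a \<circ> F (k a)" | (2) b kk where "b \<in> B" "\<bar>kk\<bar> = N" "t = b \<circ> F kk"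
      unfolding T1_def by blast
    then show ?thesis
    proof cases
      case 1
      then show ?thesis
        using kj B(4) unfolding reduced_def
        by (intro exI[of _ a] exI[of _ "k a"] exI[of _ "j a"] exI[of _ x0]) auto
    next
      case 2
      obtain z0 where z0: "z0 \<in> proj (b x0)"
        using nearest_proj_exists[OF closed_Y Y_ne] .
      have br: "dist x0 (b x0) \<le> r"
        using B(3) 2(1) .
      have "dist x0 z0 \<le> 2 * dist (b x0) x0"
        by (rule nearest_proj_dist2[OF z0 x0_Y])
      then have "dist x0 z0 \<le> 2 * r"
        using br by (simp add: dist_commute)
      then show ?thesis
        using 2 B(2) br z0 kj(2)[of b]
        by (intro exI[of _ b] exI[of _ kk] exI[of _ "j b"] exI[of _ z0]) auto
    qed
  qed
  \<comment> \<open>With \<open>M + 1\<close> in place of \<open>M\<close> this single inequality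
    gives both \<open>0 < Z\<close> and \<open>2 * branching L \<le> Z\<close>.\<close>
  have Z_ge: "2 * (2 * (L + 2 * q) + 2) * (M + 1) \<le> Z"
  proof -
    define P where "P = 2 * (c * (2 * real n + c)) + 1"
    have P: "0 < P" "P = 4 * c * (real n + k2)"
      using c1 by (simp_all add: P_def k2_def field_simps add_pos_nonneg)
    have "{g \<in> G. dist x0 (g x0) \<le> real n} \<subseteq>
        {g \<in> commensurating. dist x0 (g x0) \<le> real n} \<union> {g \<in> G. g \<notin> commensurating \<and> dist x0 (g x0) \<le> real n}"
      by blast
    moreover have "finite {g \<in> G. g \<notin> commensurating \<and> dist x0 (g x0) \<le> real n}"
      by (rule finite_subset[OF _ finite_ball[of "real n"]]) blast
    ultimately have "card {g \<in> G. dist x0 (g x0) \<le> real n} \<le>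
        card {g \<in> commensurating. dist x0 (g x0) \<le> real n} + card {g \<in> G. g \<notin> commensurating \<and> dist x0 (g x0) \<le> real n}"
      using A(2)[of "real n" x0] by (intro order_trans[OF card_mono card_Un_le]) auto
    then have "exp (s' * real n) \<le> A * (real n + 1) + real (card (reduced n)) * P"
      using n(2) A(2)[of "real n" x0] card_noncommensurating_le[of n] unfolding P_def by simp
    then have "K * (real n + k1) * (real n + k2) * exp (s * real n) \<le> real (card (reduced n)) * P"
      using n1[OF n(1)] by linarith
    also have "K * (real n + k1) * (real n + k2) * exp (s * real n) =
        (4 * (M + 1) * (real n + k1) * 2 * (exp (s * \<l>) * exp (s * real n))) * P"
      unfolding K_def P(2) by (simp only: ac_simps)
    finally have le: "4 * (M + 1) * (real n + k1) * 2 * (exp (s * \<l>) * exp (s * real n)) \<le> real (card (reduced n))"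
      using P(1) by (simp only: mult_le_cancel_right_pos)
    \<comment> \<open>\<open>a\<close> is recovered from its letter and the sign of
      \<open>k a\<close>, so passing to letters at most halves the count.\<close>
    have "reduced n \<subseteq> (\<lambda>t. t \<circ> F N) ` T1 \<union> (\<lambda>t. t \<circ> F (- N)) ` T1"
    proof
      fix a assume a: "a \<in> reduced n"
      then have aT: "a \<circ> F (k a) \<in> T1"
        unfolding T1_def by blast
      have "a = (a \<circ> F (k a)) \<circ> F (- k a)"
        by auto
      moreover have "- k a = N \<or> - k a = - N"
        using kj(1)[of a] by linarith
      ultimately show "a \<in> (\<lambda>t. t \<circ> F N) ` T1 \<union> (\<lambda>t. t \<circ> F (- N)) ` T1"
        using aT by (metis UnCI image_eqI)
    qed
    then have "card (reduced n) \<le> card ((\<lambda>t. t \<circ> F N) ` T1 \<union> (\<lambda>t. t \<circ> F (- N)) ` T1)"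
      using finT(1) by (intro card_mono) auto
    also have "\<dots> \<le> card T1 + card T1"
      using finT(1) by (intro order_trans[OF card_Un_le] add_mono card_image_le)
    finally have "real (card (reduced n)) \<le> 2 * real (card T1)"
      by simp
    then have le2: "4 * (M + 1) * (real n + k1) * (exp (s * \<l>) * exp (s * real n)) \<le> real (card T1)"
      using le by simp
    have "real (card T1) * exp (- s * (real n + \<l>)) = (\<Sum>t\<in>T1. exp (- s * (real n + \<l>)))"
      by simp
    also have "\<dots> \<le> (\<Sum>t\<in>T1. exp (- s * dist x0 (t x0)))"
    proof (rule sum_mono)
      fix t assume "t \<in> T1"
      then obtain a where a: "a \<in> reduced n" "t = a \<circ> F (k a)"
        unfolding T1_def by blast
      have "dist x0 (t x0) \<le> dist x0 (a x0) + \<l>"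
        unfolding a(2) using a(1) kj(1) by (intro len) (simp_all add: reduced_def)
      also have "\<dots> \<le> real n + \<l>"
        using a(1) by (simp add: reduced_def)
      finally have "s * dist x0 (t x0) \<le> s * (real n + \<l>)"
        using s by (intro mult_left_mono) auto
      then show "exp (- s * (real n + \<l>)) \<le> exp (- s * dist x0 (t x0))"
        by simp
    qed
    also have "\<dots> \<le> Z"
      unfolding Z_def T_def using finT by (intro sum_mono2) (auto simp: T_def)
    finally have Z1: "real (card T1) * exp (- s * (real n + \<l>)) \<le> Z" .
    have e1: "(exp (s * \<l>) * exp (s * real n)) * exp (- s * (real n + \<l>)) = 1"
      unfolding exp_add[symmetric] by (simp add: algebra_simps)
    have "4 * (M + 1) * (real n + k1) = 4 * (M + 1) * (real n + k1) * ((exp (s * \<l>) * exp (s * real n)) * exp (- s * (real n + \<l>)))"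
      unfolding e1 by simp
    also have "\<dots> = 4 * (M + 1) * (real n + k1) * (exp (s * \<l>) * exp (s * real n)) * exp (- s * (real n + \<l>))"
      by (simp only: mult.assoc)
    also have "\<dots> \<le> real (card T1) * exp (- s * (real n + \<l>))"
      using le2 by (intro mult_right_mono) auto
    finally have "4 * (M + 1) * (real n + k1) \<le> Z"
      using Z1 by linarith
    moreover have "2 * (2 * (L + 2 * q) + 2) * (M + 1) = 4 * (M + 1) * (real n + k1)"
      by (simp add: L_def k1_def algebra_simps)
    ultimately show ?thesis
      by simp
  qed
  have L0: "0 \<le> L"
    using \<l> B(4) by (simp add: L_def)
  have spread: "spread_alphabet x0 G F C c T \<alpha> \<Lambda>"
  proof
    fix t assume t: "t \<in> T"
    obtain a kk jj z0 where a: "t = a \<circ> F kk" "a \<in> G" "a \<notin> commensurating" "\<bar>kk\<bar> = N"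
      "z0 \<in> proj (a x0)" "dist x0 z0 \<le> 2 * r" "y jj \<in> proj (ginv a x0)" "N \<le> \<bar>kk - jj\<bar> \<or> dist x0 (a x0) \<le> r"
      using T_cases[OF t] by blast
    show "t \<in> G"
      unfolding a(1) by (rule comp_mem[OF a(2) F_mem])
    show "t \<notin> commensurating"
      unfolding a(1) using a(3) F_commensurating by (intro not_commensurating_comp[OF a(2) F_mem]) simp
    show "dist x0 z \<le> \<alpha>" if "z \<in> proj (t x0)" for z
      using start[OF a(2,3,5,6)] that unfolding a(1) .
    show "\<Lambda> \<le> dist x0 z" if "z \<in> proj (ginv t x0)" for z
      using that a(4,8) unfolding a(1) by (intro fin[OF a(2,7)]) auto
  next
    show "0 \<le> \<alpha>"
      using B(4) overlap_bound_pos C_pos unfolding \<alpha>_def by linarith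
    show "10 * (\<alpha> + overlap_bound + 12 * C) + 100 * C + 2 \<le> \<Lambda>"
      by (simp add: \<Lambda>_def)
  qed
  then interpret spread_alphabet x0 G F C c T \<alpha> \<Lambda> .
  have br: "branching L = (2 * (L + 2 * q) + 2) * M"
    unfolding branching_def q_def M_def ..
  have "0 \<le> 2 * (L + 2 * q) + 2"
    using L0 q by simp
  then have "2 * branching L + 2 * (2 * (L + 2 * q) + 2) \<le> Z"
    using Z_ge unfolding br by (simp add: algebra_simps)
  moreover have "0 \<le> branching L"
    unfolding br using L0 q M by simp
  ultimately have "0 < Z \<and> 2 * branching L \<le> Z"
    using L0 q by argo
  then have Z: "0 < Z" "2 * branching L \<le> Z"
    by simp_all
  have "conformal_words x0 G F C c T \<alpha> \<Lambda> L s Z"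
  proof
    fix t assume "t \<in> T"
    then obtain a kk where a: "t = a \<circ> F kk" "a \<in> G" "\<bar>kk\<bar> = N" "dist x0 (a x0) \<le> real n + r"
      using T_cases by blast
    then show "dist x0 (t x0) \<le> L"
      using len[OF a(2,3)] unfolding a(1) L_def by linarith
  qed (use finT L0 s Z in \<open>auto simp: Z_def\<close>)
  then show ?thesis
    using N(2) unfolding \<alpha>_def T_def T2_def by blast
qed

lemma index_le:
  assumes "dist x0 (y i) \<le> r"
  shows "\<bar>i\<bar> \<le> \<lceil>c * (r + c)\<rceil>"
proof -
  have "c * (dist (y i) (y 0) + c) \<le> c * (r + c)"
    using assms c1 by (intro mult_left_mono) (auto simp: y_0 dist_commute)
  then have "\<bar>real_of_int (i - 0)\<bar> \<le> c * (r + c)"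
    using y_dist_lower[of i 0] by linarith
  then have "real_of_int \<bar>i\<bar> \<le> c * (r + c)"
    by simp
  then show ?thesis
    by (simp add: le_ceiling_iff)
qed

text \<open>Otherwise \<open>G\<close> is covered by \<open>commensurating\<close> and its left
  coset by \<open>b\<close>, hence grows at most linearly, against the exponential lower
  bound.\<close>

lemma noncommensurating_exists:
  assumes growth: "\<And>n0. \<exists>n\<ge>n0. exp (s' * real n) \<le> real (card {g \<in> G. dist x0 (g x0) \<le> real n})"
    and s': "0 < s'" and b: "b \<in> G"
  shows "\<exists>e\<in>G. e \<notin> commensurating \<and> ginv b \<circ> e \<notin> commensurating"
proof (rule ccontr)
  assume "\<not> ?thesis"
  then have all: "e \<in> commensurating \<or> ginv b \<circ> e \<in> commensurating" if "e \<in> G" for e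
    using that by blast
  obtain A where A: "0 \<le> A" "\<And>p r. 0 \<le> r \<Longrightarrow> finite {g \<in> commensurating. dist p (g x0) \<le> r} \<and>
       real (card {g \<in> commensurating. dist p (g x0) \<le> r}) \<le> A * (r + dist p x0 + 1)"
    using card_commensurating_ball by blast
  define d where "d = dist (ginv b x0) x0"
  have d: "0 \<le> d"
    by (simp add: d_def)
  have upper: "real (card {g \<in> G. dist x0 (g x0) \<le> real n}) \<le> A * (2 + d) * (real n + 1)" for n
  proof -
    let ?X = "{g \<in> commensurating. dist x0 (g x0) \<le> real n}"
    let ?W = "{g \<in> commensurating. dist (ginv b x0) (g x0) \<le> real n}"
    have "{g \<in> G. dist x0 (g x0) \<le> real n} \<subseteq> ?X \<union> (\<lambda>g. b \<circ> g) ` ?W"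
    proof
      fix g assume g: "g \<in> {g \<in> G. dist x0 (g x0) \<le> real n}"
      show "g \<in> ?X \<union> (\<lambda>g. b \<circ> g) ` ?W"
      proof (cases "g \<in> commensurating")
        case False
        then have "ginv b \<circ> g \<in> commensurating"
          using all g by blast
        moreover have "dist (ginv b x0) ((ginv b \<circ> g) x0) \<le> real n"
          using g isometry[OF inverse_mem[OF b]] by simp
        moreover have "g = b \<circ> (ginv b \<circ> g)"
          using b by (simp add: o_assoc ginv_comp)
        ultimately show ?thesis
          by blast
      qed (use g in simp)
    qed
    moreover have "finite ?X" "finite ?W"
      using A(2)[of "real n"] by simp_all
    ultimately have "card {g \<in> G. dist x0 (g x0) \<le> real n} \<le> card ?X + card ?W"
      by (intro order_trans[OF card_mono order_trans[OF card_Un_le add_mono[OF order_refl card_image_le]]]) simp_all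
    then have "real (card {g \<in> G. dist x0 (g x0) \<le> real n}) \<le> real (card ?X) + real (card ?W)"
      by simp
    also have "\<dots> \<le> A * (real n + 1) + A * (real n + d + 1)"
      using A(2)[of "real n" x0] A(2)[of "real n" "ginv b x0"] by (simp add: d_def add_mono)
    also have "\<dots> = A * (2 * real n + d + 2)"
      by (simp add: algebra_simps)
    also have "\<dots> \<le> A * ((2 + d) * (real n + 1))"
      using A(1) d by (intro mult_left_mono) (simp_all add: algebra_simps)
    finally show ?thesis
      by (simp only: mult.assoc)
  qed
  have "eventually (\<lambda>n. 0 * (real n + 0) * (real n + 0) * exp (0 * real n) + (A * (2 + d) + 1) * (real n + 1) \<le> exp (s' * real n)) sequentially"
    using s' by (intro eventually_exp_dominates) auto
  then obtain n0 where n0: "\<And>n. n0 \<le> n \<Longrightarrow> (A * (2 + d) + 1) * (real n + 1) \<le> exp (s' * real n)"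
    unfolding eventually_sequentially by auto
  obtain n where n: "n0 \<le> n" "exp (s' * real n) \<le> real (card {g \<in> G. dist x0 (g x0) \<le> real n})"
    using growth by blast
  have "(A * (2 + d) + 1) * (real n + 1) \<le> A * (2 + d) * (real n + 1)"
    using n0[OF n(1)] n(2) upper[of n] by linarith
  then show False
    by (simp add: distrib_right)
qed

text \<open>The case of \<open>translate_proj\<close> in which \<open>g\<close> moves
  \<open>x0\<close> by at most \<open>r\<close>: then \<open>g x0\<close> and
  \<open>ginv g x0\<close> both project within \<open>2 * r\<close> of \<open>x0\<close>.\<close>

lemma proj_far_branch:
  assumes g: "g \<in> G" "g \<notin> commensurating" and w: "w \<in> proj x" and r: "dist x0 (g x0) \<le> r"
    and far: "24 * C + overlap_bound + 2 * r < dist x0 w" and z: "z \<in> proj (g x)"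
  shows "dist x0 z \<le> 6 * C + overlap_bound + 2 * r"
proof -
  obtain z0 where z0: "z0 \<in> proj (g x0)"
    using nearest_proj_exists[OF closed_Y Y_ne] .
  obtain v0 where v0: "v0 \<in> proj (ginv g x0)"
    using nearest_proj_exists[OF closed_Y Y_ne] .
  have "dist x0 v0 \<le> 2 * r"
    using nearest_proj_dist2[OF v0 x0_Y] r by (simp add: dist_ginv g(1))
  moreover have "dist x0 z0 \<le> 2 * r"
    using nearest_proj_dist2[OF z0 x0_Y] r by (simp add: dist_commute)
  moreover have "dist x0 w \<le> dist x0 v0 + dist w v0" "dist x0 z \<le> dist x0 z0 + dist z z0"
    by metric+
  moreover have "dist z z0 \<le> 6 * C + overlap_bound"
    using far calculation(1,3) by (intro translate_proj[OF g w z v0 z0]) linarith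
  ultimately show ?thesis
    by linarith
qed

lemma funpow_displacement:
  fixes h :: "'a \<Rightarrow> 'a"
  assumes "\<And>x y. dist (h x) (h y) = dist x y" "dist x (h x) \<le> D"
  shows "dist x ((h ^^ n) x) \<le> real n * D"
proof (induction n)
  case (Suc n)
  have "dist x ((h ^^ Suc n) x) \<le> dist x (h x) + dist (h x) (h ((h ^^ n) x))"
    by simp metric
  then have "dist x ((h ^^ Suc n) x) \<le> dist x (h x) + dist x ((h ^^ n) x)"
    by (simp only: assms(1))
  then have "dist x ((h ^^ Suc n) x) \<le> D + real n * D"
    using Suc assms(2) by linarith
  then show ?case
    by (simp add: distrib_right)
qed simp

lemma funpow_isometry:
  fixes h :: "'a \<Rightarrow> 'a"
  assumes "\<And>x y. dist (h x) (h y) = dist x y"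
  shows "dist ((h ^^ n) x) ((h ^^ n) z) = dist x z"
  by (induction n) (simp_all add: assms)

text \<open>The recurrent label \<open>h\<close> of the random words moves far away points beyond each letter after \<open>v\<close> a bounded
  amount, so \<open>h ^^ n\<close> coarsely fixes the centres of the tripods spanned by three letters.\<close>

lemma recurrent_element:
  assumes growth: "\<And>n0. \<exists>n\<ge>n0. exp (s' * real n) \<le> real (card {g \<in> G. dist x0 (g x0) \<le> real n})"
    and s: "0 < s" "s < s'" "\<sigma> < s / 2"
    and H: "\<And>h x y. h \<in> H \<Longrightarrow> dist (h x) (h y) = dist x y"
    and H_fin: "\<And>r. finite {h \<in> H. dist x0 (h x0) \<le> r}"
    and count: "\<And>n. n1 \<le> n \<Longrightarrow> real (card {y \<in> (\<lambda>h. h x0) ` H. dist x0 y \<le> real n}) \<le> exp (\<sigma> * real n)"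
    and conf: "\<And>g. g \<in> G \<Longrightarrow> \<exists>h\<in>H. ginv g \<circ> h \<circ> g \<in> Q"
    and Q: "\<And>p. p \<in> Q \<Longrightarrow> dist x0 (p x0) \<le> D"
  shows "\<exists>K. \<forall>B. finite B \<and> B \<subseteq> G - commensurating \<longrightarrow>
    (\<exists>v\<in>G. \<exists>h\<in>H. ginv v \<circ> h \<circ> v \<in> Q \<and> (\<forall>b\<in>B. \<forall>n. dist (v (b x0)) ((h ^^ n) (v (b x0))) \<le> K))"
proof -
  \<comment> \<open>\<open>K\<close> is obtained before \<open>B\<close> is introduced and depends
    only on the constants of the axis.\<close>
  obtain K m1 where m1: "0 < m1" and tripod: "\<And>q b1 b2 b3 i1 i2 i3. (\<And>u v. dist (q u) (q v) = dist u v) \<Longrightarrow>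
      y i1 \<in> proj b1 \<Longrightarrow> y i2 \<in> proj b2 \<Longrightarrow> y i3 \<in> proj b3 \<Longrightarrow>
      dist b1 (q b1) \<le> infdist b1 Y \<Longrightarrow> dist b2 (q b2) \<le> infdist b2 Y \<Longrightarrow> dist b3 (q b3) \<le> infdist b3 Y \<Longrightarrow>
      m1 \<le> i1 \<Longrightarrow> i2 \<le> - m1 \<Longrightarrow> i3 + m1 \<le> i1 \<Longrightarrow> i2 + m1 \<le> i3 \<Longrightarrow> dist x0 (q x0) \<le> K"
    by (rule tripod_displacement) blast
  have D: "0 \<le> D"
    using conf[OF id_mem] Q zero_le_dist order_trans by metis
  have "\<exists>v\<in>G. \<exists>h\<in>H. ginv v \<circ> h \<circ> v \<in> Q \<and> (\<forall>b\<in>B. \<forall>n. dist (v (b x0)) ((h ^^ n) (v (b x0))) \<le> K)"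
    if B: "finite B" "B \<subseteq> G - commensurating" for B
  proof -
    have s'0: "0 < s'"
      using s by linarith
    \<comment> \<open>The letters \<open>b \<circ> F N\<close> and \<open>b \<circ> F (- N)\<close>
      will give two ends of the tripod at \<open>b\<close>. The third uses another letter
      \<open>e b \<circ> F N\<close>; as \<open>ginv b \<circ> e b\<close> is not commensurating,
      this branch leaves the axis near its middle.\<close>
    have "\<exists>e. e \<in> G \<and> e \<notin> commensurating \<and> ginv b \<circ> e \<notin> commensurating" if "b \<in> B" for b
      using noncommensurating_exists[OF growth s'0, of b] B(2) that by blast
    then obtain e where e: "\<And>b. b \<in> B \<Longrightarrow> e b \<in> G \<and> e b \<notin> commensurating \<and> ginv b \<circ> e b \<notin> commensurating"
      by metis
    define B' where "B' = B \<union> e ` B"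
    have B': "finite B'" "B' \<subseteq> G - commensurating"
      using B e by (auto simp: B'_def)
    define r where "r = (\<Sum>b\<in>B'. dist x0 (b x0))"
    have r: "0 \<le> r" "\<And>b. b \<in> B' \<Longrightarrow> dist x0 (b x0) \<le> r"
      unfolding r_def using B'(1) by (auto intro!: sum_nonneg member_le_sum)
    define \<alpha> where "\<alpha> = overlap_bound + 2 * r"
    define \<rho>0 where "\<rho>0 = \<alpha> + overlap_bound + 6 * C"
    define R3 where "R3 = 6 * C + overlap_bound + 2 * (2 * r)"
    obtain m2 :: nat where m2: "\<And>j k. \<bar>j - k\<bar> \<ge> int m2 \<Longrightarrow> 24 * C + overlap_bound + 2 * (2 * r) + \<rho>0 < dist (y j) (y k)"
      using exists_large_index[of "24 * C + overlap_bound + 2 * (2 * r) + \<rho>0"] by metis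
    define k0 where "k0 = \<lceil>c * (\<rho>0 + c)\<rceil>"
    define k3 where "k3 = \<lceil>c * (R3 + c)\<rceil>"
    \<comment> \<open>The first entry makes the third branch deep enough for
      \<open>proj_far_branch\<close>; the second keeps the indices near \<open>N\<close>,
      \<open>- N\<close> and \<open>0\<close> apart by \<open>m1\<close> in spite of the errors
      \<open>k0\<close> and \<open>k3\<close>.\<close>
    define N0 where "N0 = max (int m2) (m1 + \<bar>k0\<bar> + \<bar>k3\<bar>)"
    have "\<exists>T \<Lambda> L Z N. conformal_words x0 G F C c T \<alpha> \<Lambda> L s Z \<and> N0 \<le> N \<and>
        (\<forall>b\<in>B'. b \<circ> F N \<in> T \<and> b \<circ> F (- N) \<in> T)"
      unfolding \<alpha>_def by (rule alphabet_exists[OF growth s(1,2) B'(1,2)]) (use r in auto)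
    then obtain T \<Lambda> L Z N where "conformal_words x0 G F C c T \<alpha> \<Lambda> L s Z"
      and N: "N0 \<le> N" and BT: "\<And>b. b \<in> B' \<Longrightarrow> b \<circ> F N \<in> T" "\<And>b. b \<in> B' \<Longrightarrow> b \<circ> F (- N) \<in> T"
      by blast
    then interpret conformal_words x0 G F C c T \<alpha> \<Lambda> L s Z
      by simp
    have "\<exists>h. w \<in> words \<longrightarrow> h \<in> H \<and> ginv (word_prod w) \<circ> h \<circ> word_prod w \<in> Q" for w
      using conf[OF word_prod_G[of w]] by blast
    then obtain \<phi> where \<phi>: "\<And>w. w \<in> words \<Longrightarrow> \<phi> w \<in> H \<and> ginv (word_prod w) \<circ> \<phi> w \<circ> word_prod w \<in> Q"
      by metis
    have \<phi>D: "dist (word_prod w x0) (\<phi> w (word_prod w x0)) \<le> D" if "w \<in> words" for w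
    proof -
      have "dist x0 ((ginv (word_prod w) \<circ> \<phi> w \<circ> word_prod w) x0) \<le> D"
        using Q \<phi>[OF that] by blast
      then show ?thesis
        by (simp add: dist_ginv' word_prod_G[OF that])
    qed
    have count': "finite {y \<in> (\<lambda>h. h x0) ` H. dist x0 y \<le> real n} \<and>
      real (card {y \<in> (\<lambda>h. h x0) ` H. dist x0 y \<le> real n}) \<le> exp (\<sigma> * real n)" if "n1 \<le> n" for n
    proof -
      have "{y \<in> (\<lambda>h. h x0) ` H. dist x0 y \<le> real n} \<subseteq> (\<lambda>h. h x0) ` {h \<in> H. dist x0 (h x0) \<le> real n}"
        by blast
      then have "finite {y \<in> (\<lambda>h. h x0) ` H. dist x0 y \<le> real n}"
        using H_fin by (meson finite_imageI finite_subset)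
      then show ?thesis
        using count[OF that] by simp
    qed
    obtain r' where r': "\<And>m. 1 / 2 \<le> prob m (\<lambda>w. dist x0 (\<phi> w x0) \<le> r')"
      using prob_near_label[of \<phi> H D n1 \<sigma>, OF conjunct1[OF \<phi>] \<phi>D H count' s(3)] by blast
    have "1 / 2 \<le> prob m (\<lambda>w. \<phi> w \<in> {h \<in> H. dist x0 (h x0) \<le> r'})" for m
    proof (rule order_trans[OF r'[of m] prob_mono])
      fix w assume "w \<in> level m" "dist x0 (\<phi> w x0) \<le> r'"
      then show "\<phi> w \<in> {h \<in> H. dist x0 (h x0) \<le> r'}"
        using \<phi> level_lists by blast
    qed
    from recurrent_label[OF H_fin this] obtain v where v: "v \<in> words"
      and rec: "\<And>t M. t \<in> T \<Longrightarrow> \<exists>u\<in>words. M \<le> length u \<and> \<phi> (v @ t # u) = \<phi> v"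
      by blast
    define g where "g = word_prod v"
    define h where "h = \<phi> v"
    have g: "g \<in> G"
      unfolding g_def by (rule word_prod_G[OF v])
    have h: "h \<in> H" "ginv g \<circ> h \<circ> g \<in> Q"
      using \<phi>[OF v] by (simp_all add: h_def g_def)
    note hiso = H[OF h(1)]
    \<comment> \<open>\<open>u\<close> is chosen after \<open>n\<close>: recurrence makes it so long
      that the displacement \<open>n * D\<close> under \<open>h ^^ n\<close> is less than the
      distance from the end of the branch to the axis. Hence the final bound does not depend on
      \<open>n\<close>.\<close>
    have far: "\<exists>u\<in>words. R \<le> real (length u) \<and> dist (g (t (word_prod u x0))) ((h ^^ n) (g (t (word_prod u x0)))) \<le> real n * D"
      if t: "t \<in> T" for t R n
    proof -
      obtain u where u: "u \<in> words" "nat \<lceil>R\<rceil> \<le> length u" "\<phi> (v @ t # u) = h"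
        using rec[OF t, of "nat \<lceil>R\<rceil>"] unfolding h_def by blast
      have "v @ t # u \<in> words"
        using v t u(1) by simp
      then have "dist (word_prod (v @ t # u) x0) (h (word_prod (v @ t # u) x0)) \<le> D"
        using \<phi>D u(3) by metis
      then have "dist (g (t (word_prod u x0))) (h (g (t (word_prod u x0)))) \<le> D"
        by (simp add: word_prod_append g_def)
      then have "dist (g (t (word_prod u x0))) ((h ^^ n) (g (t (word_prod u x0)))) \<le> real n * D"
        by (rule funpow_displacement[OF hiso])
      moreover have "R \<le> real (length u)"
        using u(2) by linarith
      ultimately show ?thesis
        using u(1) by blast
    qed
    have "dist (g (b x0)) ((h ^^ n) (g (b x0))) \<le> K" if b: "b \<in> B" for b n
    proof -
      have bG: "b \<in> G" and bB': "b \<in> B'" and eB': "e b \<in> B'" and eG: "e b \<in> G"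
        using b B(2) e by (auto simp: B'_def)
      define a where "a = g \<circ> b"
      have a: "a \<in> G"
        unfolding a_def by (rule comp_mem[OF g bG])
      \<comment> \<open>Conjugation by \<open>a\<close> moves the tripod at \<open>v (b x0)\<close>
        to the standard axis \<open>Y\<close>, with \<open>x0\<close> in place of that
        point.\<close>
      define q where "q = (\<lambda>z. ginv a ((h ^^ n) (a z)))"
      have qiso: "dist (q z) (q z') = dist z z'" for z z'
        unfolding q_def using isometry[OF inverse_mem[OF a]] isometry[OF a] funpow_isometry[OF hiso, where n = n] by simp
      have qd: "dist z (q z) = dist (a z) ((h ^^ n) (a z))" for z
        by (simp add: q_def dist_ginv' a)
      have deep: "real n * D \<le> infdist z Y"
        if "w \<in> proj z" "dist p w \<le> R" "real n * D + R \<le> dist z p" for z w p R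
      proof -
        have "dist z p \<le> dist z w + dist p w"
          by metric
        then show ?thesis
          using that nearest_projD(2)[OF that(1)] by linarith
      qed
      \<comment> \<open>The two ends along the axis: the end of a word \<open>u\<close> projects
        near \<open>x0\<close>, and \<open>F k\<close> shifts this projection to index about
        \<open>k\<close>.\<close>
      have branch: "\<exists>z i. y i \<in> proj z \<and> \<bar>i - k\<bar> \<le> k0 \<and> dist z (q z) \<le> infdist z Y"
        if k: "b \<circ> F k \<in> T" for k
      proof -
        obtain u where u: "u \<in> words" "real n * D + \<rho>0 \<le> real (length u)"
          "dist (g ((b \<circ> F k) (word_prod u x0))) ((h ^^ n) (g ((b \<circ> F k) (word_prod u x0)))) \<le> real n * D"
          using far[OF k] by blast
        let ?w = "word_prod u x0"
        let ?z = "F k ?w"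
        obtain i where i: "y i \<in> proj ?z"
          by (rule proj_ex)
        have i': "y (i - k) \<in> proj ?w"
          using proj_F[OF i, of "- k"] by (simp add: F_y)
        moreover have "?w \<in> visible \<rho>0"
          unfolding \<rho>0_def by (rule word_visible[OF u(1) x0_visible_\<rho>])
        ultimately have d: "dist x0 (y (i - k)) \<le> \<rho>0"
          unfolding visible_def by blast
        then have "\<bar>i - k\<bar> \<le> k0"
          unfolding k0_def by (rule index_le)
        moreover have "dist ?z (q ?z) \<le> real n * D"
          using u(3) by (simp add: qd a_def)
        moreover have "real n * D \<le> infdist ?z Y"
        proof (rule deep[OF i])
          show "dist (y k) (y i) \<le> \<rho>0"
            using d isometry[OF F_mem, of k x0 "y (i - k)"] by (simp add: F_y y_def[of k])
          have "dist ?z (y k) = dist x0 ?w"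
            using isometry[OF F_mem] by (simp add: y_def dist_commute)
          then show "real n * D + \<rho>0 \<le> dist ?z (y k)"
            using length_le_word[OF u(1)] u(2) by linarith
        qed
        ultimately show ?thesis
          using i by (meson order_trans)
      qed
      obtain b1 i1 where b1: "y i1 \<in> proj b1" "\<bar>i1 - N\<bar> \<le> k0" "dist b1 (q b1) \<le> infdist b1 Y"
        using branch[OF BT(1)[OF bB']] by blast
      obtain b2 i2 where b2: "y i2 \<in> proj b2" "\<bar>i2 - (- N)\<bar> \<le> k0" "dist b2 (q b2) \<le> infdist b2 Y"
        using branch[OF BT(2)[OF bB']] by blast
      \<comment> \<open>The third end, reached from the frame of \<open>b\<close> through
        \<open>ginv b \<circ> e b\<close>, projects near index \<open>0\<close>.\<close>
      have "\<exists>z i. y i \<in> proj z \<and> \<bar>i\<bar> \<le> k3 \<and> dist z (q z) \<le> infdist z Y"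
      proof -
        define \<gamma> where "\<gamma> = ginv b \<circ> e b"
        have \<gamma>: "\<gamma> \<in> G" "\<gamma> \<notin> commensurating"
          unfolding \<gamma>_def using comp_mem[OF inverse_mem[OF bG] eG] e[OF b] by auto
        have "dist x0 (\<gamma> x0) = dist (b x0) (e b x0)"
          by (simp add: \<gamma>_def dist_ginv' bG)
        also have "\<dots> \<le> dist x0 (b x0) + dist x0 (e b x0)"
          by metric
        finally have \<gamma>r: "dist x0 (\<gamma> x0) \<le> 2 * r"
          using r(2)[OF bB'] r(2)[OF eB'] by linarith
        define R where "R = real n * D + R3 + dist x0 (\<gamma> (F N x0))"
        obtain u where u: "u \<in> words" "R \<le> real (length u)"
          "dist (g ((e b \<circ> F N) (word_prod u x0))) ((h ^^ n) (g ((e b \<circ> F N) (word_prod u x0)))) \<le> real n * D"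
          using far[OF BT(1)[OF eB']] by blast
        let ?w = "word_prod u x0"
        let ?z = "\<gamma> (F N ?w)"
        obtain i where i: "y i \<in> proj ?z"
          by (rule proj_ex)
        obtain j where j: "y j \<in> proj ?w"
          by (rule proj_ex)
        have j': "y (N + j) \<in> proj (F N ?w)"
          using proj_F[OF j, of N] by (simp add: F_y)
        have "?w \<in> visible \<rho>0"
          unfolding \<rho>0_def by (rule word_visible[OF u(1) x0_visible_\<rho>])
        then have d: "dist x0 (y j) \<le> \<rho>0"
          using j unfolding visible_def by blast
        have "24 * C + overlap_bound + 2 * (2 * r) + \<rho>0 < dist (y N) (y 0)"
          using N by (intro m2) (simp add: N0_def)
        moreover have "dist (y N) (y 0) \<le> dist x0 (y (N + j)) + dist (y N) (y (N + j))"
          unfolding y_0 by metric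
        moreover have "dist (y N) (y (N + j)) = dist x0 (y j)"
          using isometry[OF F_mem, of N x0 "y j"] by (simp add: F_y y_def[of N])
        ultimately have "24 * C + overlap_bound + 2 * (2 * r) < dist x0 (y (N + j))"
          using d by linarith
        then have i3: "dist x0 (y i) \<le> R3"
          unfolding R3_def by (rule proj_far_branch[OF \<gamma> j' \<gamma>r _ i])
        then have "\<bar>i\<bar> \<le> k3"
          unfolding k3_def by (rule index_le)
        moreover have "b (\<gamma> z) = e b z" for z
          by (simp add: \<gamma>_def bG)
        then have "dist ?z (q ?z) \<le> real n * D"
          using u(3) by (simp add: qd a_def)
        moreover have "real n * D \<le> infdist ?z Y"
        proof (rule deep[OF i i3])
          have "dist ?z (\<gamma> (F N x0)) = dist x0 ?w"
            using isometry[OF \<gamma>(1)] isometry[OF F_mem] by (simp add: dist_commute)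
          moreover have "dist ?z (\<gamma> (F N x0)) \<le> dist ?z x0 + dist x0 (\<gamma> (F N x0))"
            by metric
          ultimately show "real n * D + R3 \<le> dist ?z x0"
            using length_le_word[OF u(1)] u(2) unfolding R_def by linarith
        qed
        ultimately show ?thesis
          using i by (meson order_trans)
      qed
      then obtain b3 i3 where b3: "y i3 \<in> proj b3" "\<bar>i3\<bar> \<le> k3" "dist b3 (q b3) \<le> infdist b3 Y"
        by blast
      have NN: "m1 + \<bar>k0\<bar> + \<bar>k3\<bar> \<le> N"
        using N by (simp add: N0_def)
      have "dist x0 (q x0) \<le> K"
        by (rule tripod[OF qiso b1(1) b2(1) b3(1) b1(3) b2(3) b3(3)])
          (use NN b1(2) b2(2) b3(2) in linarith)+
      then show ?thesis
        by (simp add: qd a_def)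
    qed
    then show ?thesis
      using g h by blast
  qed
  then show ?thesis
    by blast
qed

end

section \<open>Isometries of bounded displacement and the boundary\<close>

lemma tendsto_bdry_escapes:
  fixes \<iota> :: "'a::heine_borel \<Rightarrow> 'b::metric_space"
  assumes cont: "continuous_on UNIV \<iota>" and \<xi>: "\<xi> \<in> bdry \<iota>" and lim: "(\<lambda>n. \<iota> (u n)) \<longlonglongrightarrow> \<xi>"
  shows "eventually (\<lambda>n. r < dist x0 (u n)) sequentially"
proof -
  have "compact (\<iota> ` cball x0 r)"
    by (intro compact_continuous_image continuous_on_subset[OF cont]) auto
  then have "open (- \<iota> ` cball x0 r)"
    by (simp add: compact_imp_closed open_Compl)
  moreover have "\<xi> \<in> - \<iota> ` cball x0 r"
    using \<xi> by (auto simp: bdry_def)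
  ultimately have "eventually (\<lambda>n. \<iota> (u n) \<in> - \<iota> ` cball x0 r) sequentially"
    using lim by (rule topological_tendstoD[rotated])
  then show ?thesis
    by (rule eventually_mono) (auto simp: not_le)
qed

lemma contracting_pair:
  assumes "dist u w \<le> K" "0 \<le> K"
  shows "contracting K {u, w}"
proof (rule contractingI)
  fix x y z v assume "z \<in> nearest_proj {u, w} x" "v \<in> nearest_proj {u, w} y"
  then have "z \<in> {u, w}" "v \<in> {u, w}"
    by (auto dest: nearest_projD)
  then show "dist z v \<le> K"
    using assms by (auto simp: dist_commute)
qed (use assms in auto)

text \<open>A step function on the unit interval parametrises the pair. Quasi-isometric embeddings
  need not be continuous, and for a constant at least \<open>1\<close> their lower bound is vacuous
  on this interval.\<close>

lemma quasi_geodesic_pair: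
  assumes "dist u w \<le> K"
  shows "quasi_geodesic (max 1 K) {u, w}"
  unfolding quasi_geodesic_def
proof (intro exI conjI)
  let ?q = "\<lambda>t::real. if t = 0 then u else w"
  show "is_interval {0..1::real}" "{0..1::real} \<noteq> {}"
    by (auto simp: is_interval_cc)
  show "{u, w} = ?q ` {0..1}"
    by (auto intro: image_eqI[of _ _ 0] image_eqI[of _ _ 1])
  show "quasi_isometric_embedding_on (max 1 K) {0..1} ?q"
    unfolding quasi_isometric_embedding_on_def
  proof (intro conjI ballI)
    fix s t :: real assume st: "s \<in> {0..1}" "t \<in> {0..1}"
    define k where "k = max 1 K"
    have k: "1 \<le> k" "K \<le> k"
      by (auto simp: k_def)
    have "\<bar>s - t\<bar> \<le> 1"
      using st by auto
    then have "\<bar>s - t\<bar> / k \<le> 1"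
      using k(1) by (simp add: divide_le_eq)
    then have "\<bar>s - t\<bar> / k - k \<le> 0"
      using k(1) by linarith
    then show "\<bar>s - t\<bar> / max 1 K - max 1 K \<le> dist (?q s) (?q t)"
      unfolding k_def[symmetric] using zero_le_dist order_trans by blast
    have "dist (?q s) (?q t) \<le> k"
      using assms k by (auto simp: dist_commute)
    moreover have "0 \<le> k * \<bar>s - t\<bar>"
      using k by simp
    ultimately show "dist (?q s) (?q t) \<le> max 1 K * \<bar>s - t\<bar> + max 1 K"
      unfolding k_def[symmetric] by linarith
  qed simp
qed

lemma mem_cone:
  assumes "geodesic_space TYPE('a::metric_space)" "(y::'a) \<in> Z"
  shows "y \<in> cone p Z"
proof -
  obtain S where S: "geodesic_segment p y S"
    using assms(1) unfolding geodesic_space_def by blast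
  then show ?thesis
    unfolding cone_def using geodesic_segment_ends(2)[OF S] assms(2) by blast
qed

lemma compactificationD:
  assumes "compactification \<iota> act" "p \<in> carrier Isom"
  shows "continuous_on UNIV \<iota> \<and> continuous_on UNIV (act p) \<and> (\<forall>x. act p (\<iota> x) = \<iota> (p x))"
proof -
  obtain \<kappa> where "homeomorphism UNIV (range \<iota>) \<iota> \<kappa>"
    using assms(1) unfolding compactification_def by (elim conjE exE)
  moreover obtain h where "homeomorphism UNIV UNIV (act p) h \<and> (\<forall>x. act p (\<iota> x) = \<iota> (p x))"
    using assms unfolding compactification_def by metis
  ultimately show ?thesis
    by (simp add: homeomorphism_def)
qed

text \<open>\<open>act\<close> is not assumed to be a homomorphism. The identity holds on the dense
  image of \<open>\<iota>\<close> and extends by continuity.\<close>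

lemma act_inverse:
  fixes \<iota> :: "'a::metric_space \<Rightarrow> 'b::metric_space"
  assumes comp: "compactification \<iota> act" and p: "p \<in> carrier Isom" "q \<in> carrier Isom" "\<And>x. p (q x) = x"
  shows "act p (act q z) = z"
proof -
  have "continuous_on UNIV (act p)" "continuous_on UNIV (act q)"
    and \<iota>: "act p (\<iota> x) = \<iota> (p x)" "act q (\<iota> x) = \<iota> (q x)" for x
    using compactificationD[OF comp p(1)] compactificationD[OF comp p(2)] by blast+
  then have "continuous_on UNIV (\<lambda>z. act p (act q z))"
    by (metis continuous_on_compose2 subset_UNIV)
  then have "closed {z. act p (act q z) = z}"
    by (intro closed_Collect_eq continuous_on_id)
  moreover have "range \<iota> \<subseteq> {z. act p (act q z) = z}"
    using \<iota> p(3) by auto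
  ultimately have "closure (range \<iota>) \<subseteq> {z. act p (act q z) = z}"
    by (rule closure_minimal[rotated])
  moreover have "closure (range \<iota>) = UNIV"
    using comp unfolding compactification_def by blast
  ultimately show ?thesis
    by blast
qed

text \<open>If \<open>g\<^sub>n x0\<close> tends to \<open>\<xi>\<close>, axiom (B) applied to the pairs \<open>{g\<^sub>n x0, p (g\<^sub>n x0)}\<close> shows that
  \<open>\<xi>\<close> and its image under \<open>p\<close> are in the same class.\<close>

lemma bounded_displacement_E_group:
  fixes x0 :: "'a::heine_borel" and \<iota> :: "'a \<Rightarrow> 'b::metric_space"
  assumes geo: "geodesic_space TYPE('a)"
    and comp: "compactification \<iota> act" and part: "invariant_partition \<iota> act R" and B: "conv_bdry_B x0 \<iota> R"
    and p: "p \<in> carrier Isom" and disp: "\<And>g. g \<in> \<Gamma> \<Longrightarrow> dist (g x0) (p (g x0)) \<le> K"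
  shows "p \<in> E_group x0 \<iota> act R \<Gamma>"
proof -
  have cont: "continuous_on UNIV \<iota>" and act\<iota>: "act p (\<iota> x) = \<iota> (p x)" and cont_act: "continuous_on UNIV (act p)" for x
    using compactificationD[OF comp p] by blast+
  have R: "equiv (bdry \<iota>) R"
    and inv: "\<forall>g\<in>carrier Isom. \<forall>(\<xi>, \<eta>)\<in>R. (act g \<xi>, act g \<eta>) \<in> R"
    using part unfolding invariant_partition_def by (rule conjunct1, rule conjunct2)
  have R_act: "(act g \<xi>, act g \<eta>) \<in> R" if "g \<in> carrier Isom" "(\<xi>, \<eta>) \<in> R" for g \<xi> \<eta>
    using bspec[OF bspec[OF inv that(1)] that(2)] by simp
  have "sym R" "trans R"
    using R by (auto elim: equivE)
  then have symR: "(\<eta>, \<xi>) \<in> R" if "(\<xi>, \<eta>) \<in> R" for \<xi> \<eta>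
    using that by (meson symD)
  have transR: "(\<xi>, \<zeta>) \<in> R" if "(\<xi>, \<eta>) \<in> R" "(\<eta>, \<zeta>) \<in> R" for \<xi> \<eta> \<zeta>
    using \<open>trans R\<close> that by (meson transD)
  have "act p ` c = c" if c: "c \<in> bdry \<iota> // R" "c \<subseteq> R `` limit_set x0 \<iota> \<Gamma>" for c
  proof -
    obtain \<xi>0 where \<xi>0: "\<xi>0 \<in> bdry \<iota>" "c = R `` {\<xi>0}"
      using c(1) by (rule quotientE)
    have "\<xi>0 \<in> c"
      unfolding \<xi>0(2) using equiv_class_self[OF R \<xi>0(1)] .
    then obtain \<xi> where \<xi>: "\<xi> \<in> limit_set x0 \<iota> \<Gamma>" "(\<xi>, \<xi>0) \<in> R"
      using c(2) by blast
    have c_eq: "\<eta> \<in> c \<longleftrightarrow> (\<xi>, \<eta>) \<in> R" for \<eta>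
      unfolding \<xi>0(2) using \<xi>(2) symR transR by blast
    have \<xi>b: "\<xi> \<in> bdry \<iota>" and "\<xi> islimpt (\<lambda>g. \<iota> (g x0)) ` \<Gamma>"
      using \<xi>(1) unfolding limit_set_def by auto
    then obtain u where u: "\<And>n. u n \<in> (\<lambda>g. \<iota> (g x0)) ` \<Gamma>" "u \<longlonglongrightarrow> \<xi>"
      unfolding islimpt_sequential by blast
    have "\<exists>g. g \<in> \<Gamma> \<and> u n = \<iota> (g x0)" for n
      using u(1)[of n] by blast
    then obtain g where g: "\<And>n. g n \<in> \<Gamma>" "\<And>n. u n = \<iota> (g n x0)"
      by metis
    have lim: "(\<lambda>n. \<iota> (g n x0)) \<longlonglongrightarrow> \<xi>"
      using u(2) unfolding g(2)[symmetric] .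
    define K' where "K' = max 0 K"
    have K': "dist (g n x0) (p (g n x0)) \<le> K'" "0 \<le> K'" for n
      using disp[OF g(1), of n] by (auto simp: K'_def)
    define Z where "Z = (\<lambda>n. {g n x0, p (g n x0)})"
    have "escaping x0 Z"
      unfolding escaping_def filterlim_at_top
    proof
      fix r
      show "eventually (\<lambda>n. r \<le> infdist x0 (Z n)) sequentially"
        using tendsto_bdry_escapes[OF cont \<xi>b lim, of "r + K'" x0]
      proof (rule eventually_mono)
        fix n assume n: "r + K' < dist x0 (g n x0)"
        have "r \<le> dist x0 z" if "z \<in> Z n" for z
        proof -
          have "dist x0 (g n x0) \<le> dist x0 z + dist (g n x0) z"
            by metric
          moreover have "dist (g n x0) z \<le> K'"
            using that K'(1)[of n] K'(2) unfolding Z_def by auto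
          ultimately show ?thesis
            using n by linarith
        qed
        moreover have "Z n \<noteq> {}"
          by (simp add: Z_def)
        ultimately have "r \<le> (INF z\<in>Z n. dist x0 z)"
          by (intro cINF_greatest)
        then show "r \<le> infdist x0 (Z n)"
          using \<open>Z n \<noteq> {}\<close> by (simp add: infdist_def)
      qed
    qed
    moreover have "contracting K' (Z n) \<and> quasi_geodesic (max 1 K') (Z n)" for n
      unfolding Z_def using contracting_pair[OF K'] quasi_geodesic_pair[OF K'(1)] by blast
    ultimately have "(\<forall>n. contracting K' (Z n) \<and> quasi_geodesic (max 1 K') (Z n)) \<and> escaping x0 Z"
      by blast
    from B[unfolded conv_bdry_B_def, THEN spec, THEN spec, THEN spec, THEN mp, OF this, THEN spec, of x0]
    obtain r \<xi>1 where r: "strict_mono r"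
      and acc: "\<forall>z. (\<forall>n. z n \<in> cone x0 (Z (r n))) \<longrightarrow> accumulates_into \<iota> z (R `` {\<xi>1})"
      by (elim exE conjE bexE)
    have limit_class: "(\<xi>1, l) \<in> R" if "\<And>n. z n \<in> Z (r n)" "(\<lambda>n. \<iota> (z n)) \<longlonglongrightarrow> l" for z l
    proof -
      have "accumulates_into \<iota> z (R `` {\<xi>1})"
        using acc[THEN spec, THEN mp] mem_cone[OF geo] that(1) by simp
      then show ?thesis
        using that(2) unfolding accumulates_into_def
        by (elim allE[of _ "id :: nat \<Rightarrow> nat"] allE[of _ l]) (auto simp: strict_mono_def)
    qed
    have lim_r: "(\<lambda>n. \<iota> (g (r n) x0)) \<longlonglongrightarrow> \<xi>"
      using LIMSEQ_subseq_LIMSEQ[OF lim r] by (simp add: comp_def)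
    have "(\<xi>1, \<xi>) \<in> R"
      by (rule limit_class[OF _ lim_r]) (simp add: Z_def)
    moreover have "(\<xi>1, act p \<xi>) \<in> R"
    proof (rule limit_class)
      show "p (g (r n) x0) \<in> Z (r n)" for n
        by (simp add: Z_def)
      have "(\<lambda>n. act p (\<iota> (g (r n) x0))) \<longlonglongrightarrow> act p \<xi>"
        using continuous_on_tendsto_compose[OF cont_act lim_r] by simp
      then show "(\<lambda>n. \<iota> (p (g (r n) x0))) \<longlonglongrightarrow> act p \<xi>"
        by (simp only: act\<iota>)
    qed
    ultimately have \<xi>p: "(\<xi>, act p \<xi>) \<in> R"
      using symR transR by blast
    \<comment> \<open>Since \<open>act p\<close> preserves \<open>R\<close> and keeps
      \<open>\<xi>\<close> in its class, it maps \<open>c\<close> into itself; the inverse isometry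
      gives the other inclusion.\<close>
    let ?q = "inv_into UNIV p"
    have q: "?q \<in> carrier Isom"
      using inverse_carrier_Isom[OF p] by simp
    have pq: "p (?q x) = x" "?q (p x) = x" for x
      using p fun_cong[OF inverse_carrier_Isom(2)[OF p], of x] by (simp_all add: carrier_Isom surj_f_inv_f)
    show ?thesis
    proof (intro equalityI subsetI)
      fix \<eta> assume "\<eta> \<in> act p ` c"
      then obtain \<zeta> where "(\<xi>, \<zeta>) \<in> R" "\<eta> = act p \<zeta>"
        using c_eq by blast
      then show "\<eta> \<in> c"
        using R_act[OF p] \<xi>p transR c_eq by blast
    next
      fix \<eta> assume "\<eta> \<in> c"
      then have "(act p \<xi>, \<eta>) \<in> R"
        using c_eq \<xi>p symR transR by blast
      then have "(act ?q (act p \<xi>), act ?q \<eta>) \<in> R"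
        by (rule R_act[OF q])
      then have "act ?q \<eta> \<in> c"
        using act_inverse[OF comp q p pq(2)] c_eq by simp
      then show "\<eta> \<in> act p ` c"
        using act_inverse[OF comp p q pq(1), of \<eta>] by (metis image_eqI)
    qed
  qed
  then show ?thesis
    unfolding E_group_def using p by blast
qed

section \<open>Growth of confined subgroups\<close>

lemma (in isometry_group) orbit_ball_eq:
  "orbit_ball x0 G n = {y \<in> (\<lambda>g. g x0) ` G. dist x0 y \<le> real n}"
  by (auto simp: orbit_ball_def)

lemma (in isometry_group) finite_orbit_ball: "finite (orbit_ball x0 G n)"
  and card_orbit_ball_le: "card (orbit_ball x0 G n) \<le> card {g \<in> G. dist x0 (g x0) \<le> real n}"
  and card_orbit_ball_pos: "0 < card (orbit_ball x0 G n)"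
proof -
  have eq: "orbit_ball x0 G n = (\<lambda>g. g x0) ` {g \<in> G. dist x0 (g x0) \<le> real n}"
    by (auto simp: orbit_ball_def)
  show fin: "finite (orbit_ball x0 G n)"
    unfolding eq by (intro finite_imageI finite_ball)
  show "card (orbit_ball x0 G n) \<le> card {g \<in> G. dist x0 (g x0) \<le> real n}"
    unfolding eq by (intro card_image_le finite_ball)
  have "x0 \<in> orbit_ball x0 G n"
    unfolding orbit_ball_def mem_Collect_eq by (rule exI[of _ id]) (simp only: id_apply id_mem dist_self of_nat_0_le_iff simp_thms)
  then show "0 < card (orbit_ball x0 G n)"
    using fin card_gt_0_iff by blast
qed

lemma (in isometry_group) log_card_orbit_ball:
  "log_card (orbit_ball x0 G n) = ereal (ln (real (card (orbit_ball x0 G n))))"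
  using finite_orbit_ball[of n] card_orbit_ball_pos[of n] by (auto simp: log_card_def)

lemma (in isometry_group) growth_rate_eq:
  "growth_rate x0 G = limsup (\<lambda>n. ereal (ln (real (card (orbit_ball x0 G n)))) / ereal (real n))"
  unfolding growth_rate_def log_card_orbit_ball ..

lemma (in isometry_group) growth_rate_nonneg: "0 \<le> growth_rate x0 G"
proof -
  have "0 \<le> ereal (ln (real (card (orbit_ball x0 G n)))) / ereal (real n)" for n
  proof -
    \<comment> \<open>For \<open>n = 0\<close> the quotient is the product of this logarithm with
      infinity, which is still nonnegative.\<close>
    have "0 \<le> ln (real (card (orbit_ball x0 G n)))"
      using card_orbit_ball_pos[of n] by simp
    then show ?thesis
      by (cases "n = 0") (simp_all add: divide_ereal_def)
  qed
  then have "limsup (\<lambda>n. 0 :: ereal) \<le> growth_rate x0 G"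
    unfolding growth_rate_eq by (intro Limsup_mono) simp
  then show ?thesis
    by (simp add: Limsup_const)
qed

lemma (in isometry_group) card_orbit_ball_le_exp:
  assumes "growth_rate x0 G < ereal \<sigma>"
  shows "\<exists>n1. \<forall>n\<ge>n1. real (card (orbit_ball x0 G n)) \<le> exp (\<sigma> * real n)"
proof -
  have "eventually (\<lambda>n. ereal (ln (real (card (orbit_ball x0 G n)))) / ereal (real n) < ereal \<sigma>) sequentially"
    using assms unfolding growth_rate_eq by (rule Limsup_lessD)
  then obtain n1 where n1: "\<And>n. n1 \<le> n \<Longrightarrow> ereal (ln (real (card (orbit_ball x0 G n)))) / ereal (real n) < ereal \<sigma>"
    unfolding eventually_sequentially by blast
  have "real (card (orbit_ball x0 G n)) \<le> exp (\<sigma> * real n)" if n: "max 1 n1 \<le> n" for n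
  proof -
    have "ln (real (card (orbit_ball x0 G n))) / real n < \<sigma>"
      using n1[of n] n by simp
    then have "ln (real (card (orbit_ball x0 G n))) \<le> \<sigma> * real n"
      using n by (simp add: divide_less_eq)
    then have "exp (ln (real (card (orbit_ball x0 G n)))) \<le> exp (\<sigma> * real n)"
      by simp
    then show ?thesis
      using card_orbit_ball_pos[of n] by simp
  qed
  then show ?thesis
    by blast
qed

text \<open>\<open>growth_rate\<close> counts orbit points, of which there are at most as many as
  group elements, so a lower bound for the former passes to the latter.\<close>

lemma (in isometry_group) exp_le_card_ball:
  assumes "ereal s < growth_rate x0 G"
  shows "\<exists>n\<ge>n0. exp (s * real n) \<le> real (card {g \<in> G. dist x0 (g x0) \<le> real n})"
proof (rule ccontr)
  assume neg: "\<not> ?thesis"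
  have "ereal (ln (real (card (orbit_ball x0 G n)))) / ereal (real n) \<le> ereal s" if n: "max 1 n0 \<le> n" for n
  proof -
    have "real (card (orbit_ball x0 G n)) \<le> real (card {g \<in> G. dist x0 (g x0) \<le> real n})"
      using card_orbit_ball_le[of n] by simp
    also have "\<dots> \<le> exp (s * real n)"
    proof -
      have "n0 \<le> n"
        using n by simp
      then have "\<not> exp (s * real n) \<le> real (card {g \<in> G. dist x0 (g x0) \<le> real n})"
        using neg by blast
      then show ?thesis
        by simp
    qed
    finally have "ln (real (card (orbit_ball x0 G n))) \<le> ln (exp (s * real n))"
      using card_orbit_ball_pos[of n] by (subst ln_le_cancel_iff) auto
    then have "ln (real (card (orbit_ball x0 G n))) / real n \<le> s"
      using n by (simp add: divide_le_eq)
    then show ?thesis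
      using n by simp
  qed
  then have "eventually (\<lambda>n. ereal (ln (real (card (orbit_ball x0 G n)))) / ereal (real n) \<le> ereal s) sequentially"
    unfolding eventually_sequentially by blast
  then have "growth_rate x0 G \<le> ereal s"
    unfolding growth_rate_eq by (rule Limsup_bounded)
  then show False
    using assms by simp
qed

lemma contracting_isometry_axis:
  fixes x0 :: "'a::heine_borel"
  assumes geo: "geodesic_space TYPE('a)" and G: "isometry_group x0 G" "subgroup G Isom"
    and f: "f \<in> G" "contracting_isometry x0 f"
  shows "\<exists>c C. contracting_axis x0 G (\<lambda>k. f [^]\<^bsub>Isom\<^esub> k) C c"
proof -
  interpret isometry_group x0 G
    by (rule G(1))
  interpret I: group "Isom :: ('a \<Rightarrow> 'a) monoid"
    by (rule group_Isom)
  obtain c where "quasi_isometric_embedding_on c \<int> (\<lambda>t. (f [^]\<^bsub>Isom\<^esub> \<lfloor>t\<rfloor>) x0)"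
    using f(2) unfolding contracting_isometry_def by blast
  then have c: "1 \<le> c" and q: "\<And>s t. s \<in> \<int> \<Longrightarrow> t \<in> \<int> \<Longrightarrow>
      \<bar>s - t\<bar> / c - c \<le> dist ((f [^]\<^bsub>Isom\<^esub> \<lfloor>s\<rfloor>) x0) ((f [^]\<^bsub>Isom\<^esub> \<lfloor>t\<rfloor>) x0) \<and>
      dist ((f [^]\<^bsub>Isom\<^esub> \<lfloor>s\<rfloor>) x0) ((f [^]\<^bsub>Isom\<^esub> \<lfloor>t\<rfloor>) x0) \<le> c * \<bar>s - t\<bar> + c"
    unfolding quasi_isometric_embedding_on_def by blast+
  obtain C where C: "contracting C (range (\<lambda>n::int. (f [^]\<^bsub>Isom\<^esub> n) x0))"
    using f(2) unfolding contracting_isometry_def by blast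
  have fc: "f \<in> carrier Isom"
    using f(2) unfolding contracting_isometry_def by blast
  \<comment> \<open>\<open>max 1 C\<close> supplies the positive constant that the locale asks
    for.\<close>
  have "contracting_axis x0 G (\<lambda>k. f [^]\<^bsub>Isom\<^esub> k) (max 1 C) c"
  proof
    show "geodesic_space TYPE('a)" "1 \<le> c" "0 < max 1 C"
      using geo c by simp_all
    show "f [^]\<^bsub>Isom\<^esub> k \<in> G" for k :: int
      by (rule I.subgroup_int_pow_closed[OF G(2) f(1)])
    show "f [^]\<^bsub>Isom\<^esub> (j + k) = (f [^]\<^bsub>Isom\<^esub> j) \<circ> (f [^]\<^bsub>Isom\<^esub> k)" for j k :: int
      using I.int_pow_mult[OF fc, of j k] by simp
    show "\<bar>real_of_int (j - k)\<bar> / c - c \<le> dist ((f [^]\<^bsub>Isom\<^esub> j) x0) ((f [^]\<^bsub>Isom\<^esub> k) x0)"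
      "dist ((f [^]\<^bsub>Isom\<^esub> j) x0) ((f [^]\<^bsub>Isom\<^esub> k) x0) \<le> c * \<bar>real_of_int (j - k)\<bar> + c" for j k :: int
      using q[of "of_int j" "of_int k"] by simp_all
    show "contracting (max 1 C) (range (\<lambda>k::int. (f [^]\<^bsub>Isom\<^esub> k) x0))"
      by (rule contracting_mono[OF C]) simp
  qed
  then show ?thesis
    by blast
qed

text \<open>All powers lie in one finite ball of the discrete group, so two of them
  coincide.\<close>

lemma (in isometry_group) bounded_powers_imp_torsion:
  assumes h: "h \<in> G" and bounded: "\<And>n. dist x ((h ^^ n) x) \<le> K"
  shows "\<exists>n>0. h ^^ n = id"
proof -
  have mem: "h ^^ n \<in> G" for n
  proof (induction n)
    case 0
    show ?case
      unfolding funpow.simps by (rule id_mem)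
  next
    case (Suc n)
    then show ?case
      unfolding funpow.simps by (rule comp_mem[OF h])
  qed
  have "range (\<lambda>n. h ^^ n) \<subseteq> {g \<in> G. dist x (g x) \<le> K}"
    using mem bounded by blast
  then have "finite (range (\<lambda>n. h ^^ n))"
    using finite_ball_at finite_subset by blast
  then have "\<not> inj (\<lambda>n. h ^^ n)"
    using finite_imageD infinite_UNIV_nat by blast
  then obtain i j where "i \<noteq> j" "h ^^ i = h ^^ j"
    unfolding inj_def by blast
  then obtain i j where ij: "i < j" "h ^^ i = h ^^ j"
    by (metis nat_neq_iff)
  have "h ^^ (j - i) = id"
  proof
    fix z
    have "(h ^^ i) ((h ^^ (j - i)) z) = (h ^^ i) z"
    proof -
      have "(h ^^ (i + (j - i))) z = (h ^^ i) z"
        using ij by simp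
      then show ?thesis
        by (simp only: funpow_add comp_apply)
    qed
    then show "(h ^^ (j - i)) z = id z"
      using injective[OF mem[of i]] by (simp add: inj_eq)
  qed
  then show ?thesis
    using ij(1) by (intro exI[of _ "j - i"]) simp
qed

lemma nat_pow_Isom: "h [^]\<^bsub>Isom\<lparr>carrier := H\<rparr>\<^esub> n = h ^^ (n::nat)"
proof (induction n)
  case 0
  show ?case
    by (simp add: nat_pow_def Isom_def)
next
  case (Suc n)
  have "h [^]\<^bsub>Isom\<lparr>carrier := H\<rparr>\<^esub> Suc n = h [^]\<^bsub>Isom\<lparr>carrier := H\<rparr>\<^esub> n \<circ> h"
    by (simp add: nat_pow_def Isom_def)
  then show ?case
    unfolding Suc by (simp add: funpow_Suc_right del: funpow.simps)
qed

theorem corollary1p12: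
  fixes x0 :: "'x::heine_borel"
    and \<iota> :: "'x \<Rightarrow> 'b::metric_space"
    and act :: "('x \<Rightarrow> 'x) \<Rightarrow> 'b \<Rightarrow> 'b"
    and R :: "('b \<times> 'b) set"
    and \<Gamma> H P :: "('x \<Rightarrow> 'x) set"
    and Chor :: "'b set" and B :: "'b \<Rightarrow> 'x \<Rightarrow> 'x \<Rightarrow> real" and \<epsilon> :: "'b set \<Rightarrow> real"
    and \<mu> :: "'x \<Rightarrow> 'b measure"
  assumes "geodesic_space TYPE('x)"
    and "discrete_subgroup \<Gamma>"
    and "\<not> elementary (Isom\<lparr>carrier := \<Gamma>\<rparr>)"
    and "convergence_boundary x0 \<iota> act R \<Gamma>"
    and "\<exists>f\<in>\<Gamma>. non_pinched_contracting x0 \<iota> R f"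
    and "SCC x0 \<Gamma>"
    and "busemann_cocycles x0 \<iota> R Chor B \<epsilon>"
    and "quasi_conformal_density x0 \<iota> act R \<Gamma> Chor B (real_of_ereal (growth_rate x0 \<Gamma>)) \<mu>"
    and "discrete_subgroup H"
    and "confined_by \<Gamma> H P"
    and "(torsion_free (Isom\<lparr>carrier := H\<rparr>) \<and>
            (gromov_hyperbolic TYPE('x) \<or> (geodesically_complete TYPE('x) \<and> cat0 TYPE('x)))) \<or>
         (finite P \<and> P \<inter> E_group x0 \<iota> act R \<Gamma> \<subseteq> {\<one>\<^bsub>Isom\<^esub>})"
  shows "growth_rate x0 H \<ge> growth_rate x0 \<Gamma> / 2"
proof (rule ccontr)
  assume "\<not> growth_rate x0 \<Gamma> / 2 \<le> growth_rate x0 H"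
  then have less: "growth_rate x0 H < growth_rate x0 \<Gamma> / 2"
    by simp
  interpret H: isometry_group x0 H
    by (rule discrete_subgroup_isometry_group[OF assms(9)])
  have \<Gamma>: "isometry_group x0 \<Gamma>" "subgroup \<Gamma> Isom"
    using discrete_subgroup_isometry_group[OF assms(2)] assms(2) by (simp_all add: discrete_subgroup_def)
  obtain f where f: "f \<in> \<Gamma>" "contracting_isometry x0 f"
    using assms(5) unfolding non_pinched_contracting_def by blast
  obtain c C where "contracting_axis x0 \<Gamma> (\<lambda>k. f [^]\<^bsub>Isom\<^esub> k) C c"
    using contracting_isometry_axis[OF assms(1) \<Gamma> f] by blast
  then interpret contracting_axis x0 \<Gamma> "\<lambda>k. f [^]\<^bsub>Isom\<^esub> k" C c .
  \<comment> \<open>\<open>\<sigma>\<close> lies above the growth of \<open>H\<close>,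
    \<open>s\<close> above \<open>2 * \<sigma>\<close>, and \<open>s'\<close> strictly between
    \<open>s\<close> and the growth of \<open>\<Gamma>\<close>; the gap from \<open>s\<close> to
    \<open>s'\<close> absorbs the polynomial factors in \<open>alphabet_exists\<close>.\<close>
  obtain \<sigma> where \<sigma>: "growth_rate x0 H < ereal \<sigma>" "ereal \<sigma> < growth_rate x0 \<Gamma> / 2"
    using ereal_dense2[OF less] by blast
  obtain \<tau> where \<tau>: "ereal \<sigma> < ereal \<tau>" "ereal \<tau> < growth_rate x0 \<Gamma> / 2"
    using ereal_dense2[OF \<sigma>(2)] by blast
  define s where "s = 2 * \<tau>"
  have "ereal s < growth_rate x0 \<Gamma>"
    using \<tau>(2) by (cases "growth_rate x0 \<Gamma>") (auto simp: s_def)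
  then obtain s' where s': "ereal s < ereal s'" "ereal s' < growth_rate x0 \<Gamma>"
    using ereal_dense2 by blast
  have "0 \<le> \<sigma>"
    using H.growth_rate_nonneg \<sigma>(1) by (cases "growth_rate x0 H") auto
  then have s: "0 < s" "s < s'" "\<sigma> < s / 2"
    using \<tau>(1) s'(1) by (simp_all add: s_def)
  obtain n1 where n1: "\<And>n. n1 \<le> n \<Longrightarrow> real (card (orbit_ball x0 H n)) \<le> exp (\<sigma> * real n)"
    using H.card_orbit_ball_le_exp[OF \<sigma>(1)] by blast
  define Q where "Q = P - {id}"
  have conf: "\<exists>h\<in>H. ginv g \<circ> h \<circ> g \<in> Q" if g: "g \<in> \<Gamma>" for g
  proof -
    have "g \<in> carrier Isom"
      using subgroup.mem_carrier[OF \<Gamma>(2) g] .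
    moreover have "(\<lambda>h. inv\<^bsub>Isom\<^esub> g \<otimes>\<^bsub>Isom\<^esub> h \<otimes>\<^bsub>Isom\<^esub> g) ` H \<inter> (P - {\<one>\<^bsub>Isom\<^esub>}) \<noteq> {}"
      using assms(10) g unfolding confined_by_def by blast
    ultimately show ?thesis
      unfolding Q_def by (auto simp: inv_Isom)
  qed
  have "compactin Isom_topology P"
    using assms(10) unfolding confined_by_def by blast
  from compactin_Isom_bounded[OF this] obtain D where "\<And>p. p \<in> P \<Longrightarrow> dist x0 (p x0) \<le> D"
    by blast
  then have D: "\<And>p. p \<in> Q \<Longrightarrow> dist x0 (p x0) \<le> D"
    unfolding Q_def by blast
  have "\<exists>K. \<forall>B. finite B \<and> B \<subseteq> \<Gamma> - commensurating \<longrightarrow>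
    (\<exists>v\<in>\<Gamma>. \<exists>h\<in>H. ginv v \<circ> h \<circ> v \<in> Q \<and> (\<forall>b\<in>B. \<forall>n. dist (v (b x0)) ((h ^^ n) (v (b x0))) \<le> K))"
  proof (rule recurrent_element[of s' s \<sigma> H n1 Q D])
    show "\<exists>n\<ge>n0. exp (s' * real n) \<le> real (card {g \<in> \<Gamma>. dist x0 (g x0) \<le> real n})" for n0
      by (rule exp_le_card_ball[OF s'(2)])
    show "real (card {y \<in> (\<lambda>h. h x0) ` H. dist x0 y \<le> real n}) \<le> exp (\<sigma> * real n)" if "n1 \<le> n" for n
      using n1[OF that] unfolding H.orbit_ball_eq .
    show "dist (h x) (h z) = dist x z" if "h \<in> H" for h x z
      by (rule H.isometry[OF that])
    show "finite {h \<in> H. dist x0 (h x0) \<le> r}" for r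
      by (rule H.finite_ball)
  qed (rule s conf D, assumption?)+
  then obtain K where "\<forall>B. finite B \<and> B \<subseteq> \<Gamma> - commensurating \<longrightarrow>
    (\<exists>v\<in>\<Gamma>. \<exists>h\<in>H. ginv v \<circ> h \<circ> v \<in> Q \<and> (\<forall>b\<in>B. \<forall>n. dist (v (b x0)) ((h ^^ n) (v (b x0))) \<le> K))" ..
  then have K: "\<exists>v\<in>\<Gamma>. \<exists>h\<in>H. ginv v \<circ> h \<circ> v \<in> Q \<and> (\<forall>b\<in>B. \<forall>n. dist (v (b x0)) ((h ^^ n) (v (b x0))) \<le> K)"
    if "finite B" "B \<subseteq> \<Gamma> - commensurating" for B
    using that by simp
  have "0 < s'"
    using s by linarith
  then obtain e where e: "e \<in> \<Gamma>" "e \<notin> commensurating"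
    using noncommensurating_exists[OF exp_le_card_ball[OF s'(2)] _ id_mem] by blast
  from assms(11) show False
  proof
    assume tf: "torsion_free (Isom\<lparr>carrier := H\<rparr>) \<and>
            (gromov_hyperbolic TYPE('x) \<or> (geodesically_complete TYPE('x) \<and> cat0 TYPE('x)))"
    \<comment> \<open>A single base point suffices here, because the bound holds for all powers of
      \<open>h\<close>.\<close>
    obtain v h where v: "v \<in> \<Gamma>" "h \<in> H" "ginv v \<circ> h \<circ> v \<in> Q" "\<And>n. dist (v (e x0)) ((h ^^ n) (v (e x0))) \<le> K"
      using K[of "{e}"] e by auto
    obtain n where "0 < n" "h ^^ n = id"
      using H.bounded_powers_imp_torsion[OF v(2,4)] by blast
    moreover have "\<forall>k\<in>H. (\<exists>n>0. k ^^ n = id) \<longrightarrow> k = id"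
      using tf unfolding torsion_free_def nat_pow_Isom by simp
    ultimately have "h = id"
      using v(2) by blast
    then have "ginv v \<circ> h \<circ> v = id"
      using v(1) by (simp add: ginv_comp)
    then show False
      using v(3) by (simp add: Q_def)
  next
    assume P: "finite P \<and> P \<inter> E_group x0 \<iota> act R \<Gamma> \<subseteq> {\<one>\<^bsub>Isom\<^esub>}"
    \<comment> \<open>Otherwise \<open>p\<close> would have bounded displacement on the whole orbit
      and so belong to \<open>E_group\<close>, which meets \<open>P\<close> at most in the
      identity.\<close>
    have "\<exists>b\<in>\<Gamma> - commensurating. K < dist (b x0) (p (b x0))" if p: "p \<in> Q" "p \<in> carrier Isom" for p
    proof (rule ccontr)
      assume neg: "\<not> ?thesis"
      have piso: "dist (p z) (p z') = dist z z'" for z z'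
        using p(2) by (simp add: carrier_Isom)
      \<comment> \<open>A commensurating \<open>g\<close> is replaced by \<open>g \<circ> e\<close>,
        which is not commensurating and whose orbit point is at distance
        \<open>dist x0 (e x0)\<close> from \<open>g x0\<close>.\<close>
      have le: "dist (g x0) (p (g x0)) \<le> \<bar>K\<bar> + 2 * dist x0 (e x0)" if g: "g \<in> \<Gamma>" for g
      proof (cases "g \<in> commensurating")
        case False
        then have "dist (g x0) (p (g x0)) \<le> K"
          using neg g by force
        then show ?thesis
          using abs_ge_self[of K] zero_le_dist[of x0 "e x0"] by linarith
      next
        case True
        then have "g \<circ> e \<in> \<Gamma> - commensurating"
          using not_commensurating_comp[OF g e(1)] e(2) comp_mem[OF g e(1)] by simp
        then have "dist (g (e x0)) (p (g (e x0))) \<le> K"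
          using neg by force
        moreover have "dist (g x0) (p (g x0)) \<le> dist (g x0) (g (e x0)) + dist (g (e x0)) (p (g (e x0))) + dist (p (g (e x0))) (p (g x0))"
          by metric
        moreover have "dist (p (g (e x0))) (p (g x0)) = dist x0 (e x0)" "dist (g x0) (g (e x0)) = dist x0 (e x0)"
          using piso isometry[OF g] by (simp_all add: dist_commute)
        ultimately show ?thesis
          using abs_ge_self[of K] by linarith
      qed
      have "p \<in> E_group x0 \<iota> act R \<Gamma>"
        using assms(4) unfolding convergence_boundary_def
        by (intro bounded_displacement_E_group[OF assms(1) _ _ _ p(2) le]) simp_all
      then show False
        using P p(1) unfolding Q_def one_Isom by blast
    qed
    then have "\<forall>p\<in>Q \<inter> carrier Isom. \<exists>b. b \<in> \<Gamma> - commensurating \<and> K < dist (b x0) (p (b x0))"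
      by blast
    then obtain b where b: "\<And>p. p \<in> Q \<inter> carrier Isom \<Longrightarrow> b p \<in> \<Gamma> - commensurating \<and> K < dist (b p x0) (p (b p x0))"
      by metis
    \<comment> \<open>Finiteness of \<open>P\<close> enters here: one witness for each possible
      \<open>p\<close> makes a finite set, chosen after \<open>K\<close>.\<close>
    have "finite (b ` (Q \<inter> carrier Isom))" "b ` (Q \<inter> carrier Isom) \<subseteq> \<Gamma> - commensurating"
      using P b by (auto simp: Q_def)
    from K[OF this] obtain v h where v: "v \<in> \<Gamma>" "h \<in> H" "ginv v \<circ> h \<circ> v \<in> Q"
      and small: "\<forall>g\<in>b ` (Q \<inter> carrier Isom). \<forall>n. dist (v (g x0)) ((h ^^ n) (v (g x0))) \<le> K"
      by (elim bexE conjE)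
    define p where "p = ginv v \<circ> h \<circ> v"
    have "subgroup H Isom"
      using assms(9) unfolding discrete_subgroup_def by (rule conjunct1)
    then have carr: "h \<in> carrier Isom" "v \<in> carrier Isom"
      using subgroup.mem_carrier v(2) subgroup.mem_carrier[OF \<Gamma>(2) v(1)] by metis+
    interpret I: group "Isom :: ('x \<Rightarrow> 'x) monoid"
      by (rule group_Isom)
    have "ginv v \<otimes>\<^bsub>Isom\<^esub> h \<otimes>\<^bsub>Isom\<^esub> v \<in> carrier Isom"
      by (intro I.m_closed inverse_carrier_Isom(1) carr)
    then have "p \<in> carrier Isom"
      unfolding p_def mult_Isom .
    then have p: "p \<in> Q \<inter> carrier Isom"
      using v(3) unfolding p_def by (rule IntI[rotated])
    \<comment> \<open>\<open>p\<close> is conjugate to \<open>h\<close> by \<open>v\<close>, so the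
      bound for the first power of \<open>h\<close> contradicts the choice of the witness
      \<open>b p\<close>.\<close>
    have "dist (b p x0) (p (b p x0)) = dist (v (b p x0)) (h (v (b p x0)))"
      by (simp add: p_def dist_ginv' v(1))
    also have "\<dots> \<le> K"
      using bspec[OF small imageI[OF p], THEN spec, of 1] by simp
    finally show False
      using b[OF p] by simp
  qed
qed

end
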